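(* Let $k$ be a field of characteristic different from $2$ such that $[k(\zeta_8):k]=4$, where $\zeta_8$ is a primitive eighth root of unity. Let $K=k(t)$ with $t$ transcendental over $k$, let $x_0:=t$, $f(z)=z^2-1$, $K_\infty:=\bigcup_{n\ge0}K(f^{-n}(t))$ inside an algebraic closure of $K$, and $G_\infty:=\mathrm{Gal}(K_\infty/K)$. Then $G_\infty\cong M_\infty$ as groups acting on trees; that is, there is a labeling of the preimage tree of $t$ such that the induced injective homomorphism $G_\infty\to\mathrm{Aut}(T_\infty)$ has image exactly $M_\infty$.
   Context: $f^{-n}(t)$ is the set of roots of $f^n(z)=t$, $f^n$ the $n$-th iterate. A labeling of the preimage tree is a bijection $w\mapsto[w]$ from finite words over $\{a,b\}$ onto $\coprod_{n\ge0}f^{-n}(t)$ with empty word $\mapsto t$, words of length $n$ mapping into $f^{-n}(t)$, and $\{[wa],[wb]\}=f^{-1}([w])$; $\sigma\in G_\infty$ then acts on words by $\sigma([w])=[\sigma(w)]$. $T_\infty$ is the infinite binary rooted tree whose nodes at level $m$ are words of length $m$ over $\{a,b\}$ (root $x_0$ = empty word), $w$ joined to $wa,wb$; $\mathrm{Aut}(T_\infty)$ its root-preserving automorphism group. $\mathrm{Par}(\sigma,x)=0$ if $\sigma(xa)=\sigma(x)a$ and $\sigma(xb)=\sigma(x)b$, and $=1$ if $\sigma(xa)=\sigma(x)b$ and $\sigma(xb)=\sigma(x)a$. $Q(\sigma,x):=\sum_{i\ge0}2^i\sum_{s_1,\ldots,s_i\in\{a,b\}}\mathrm{Par}(\sigma,x\,a\,s_1\,a\,s_2\cdots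 a\,s_i)\in\mathbb{Z}_2$ (concatenated words), $P(\sigma,x):=(-1)^{\mathrm{Par}(\sigma,x)}+2\sum_{t'\in\{a,b\}}Q(\sigma,xbt')-2\sum_{t'\in\{a,b\}}Q(\sigma,xat')\in\mathbb{Z}_2^\times$. $M_\infty:=\{\sigma\in\mathrm{Aut}(T_\infty):P(\sigma,x)=P(\sigma,x_0)\text{ for all nodes }x\}$. *)

theory Defs
  imports Complex_Main "HOL-Algebra.Algebra" "HOL-Computational_Algebra.Computational_Algebra"
    "HOL-Algebra.Algebraic_Closure_Type"
begin

section \<open>The ring of 2-adic integers\<close>

text \<open>The inverse limit of the rings of integers modulo \<open>2 ^ n\<close>; the \<open>n\<close>-th component of an
  element is its residue modulo \<open>2 ^ n\<close>, represented in \<open>{0..<2 ^ n}\<close>.\<close>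

typedef zint2 = "{s :: nat \<Rightarrow> int. \<forall>n. s n = s (Suc n) mod 2 ^ n}"
  morphisms residue Abs_zint2
  by (rule exI[of _ "\<lambda>_. 0"]) simp

setup_lifting type_definition_zint2

lemma residue_Suc: "residue x (Suc n) mod 2 ^ n = residue x n"
proof -
  have "\<forall>n. residue x n = residue x (Suc n) mod 2 ^ n"
    using residue[of x] by (rule CollectD)
  from spec[OF this, of n] show ?thesis by (rule sym)
qed

lemma zint2_eqI: "(\<And>n. residue x n = residue y n) \<Longrightarrow> x = y"
  by (simp add: residue_inject[symmetric] fun_eq_iff)

lemma mod_pow2_Suc: "(a :: int) mod 2 ^ Suc n mod 2 ^ n = a mod 2 ^ n"
  by (rule mod_mod_cancel) simp

lemma residue_mod [simp]: "residue x n mod 2 ^ n = residue x n"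
  by (subst (1 2) residue_Suc[symmetric]) (rule mod_mod_trivial)

lemma residue_at_0 [simp]: "residue x 0 = 0"
  using residue_mod[of x 0] by (simp del: residue_mod)

lemma residue_mod_le: "n \<le> m \<Longrightarrow> residue x m mod 2 ^ n = residue x n"
proof (induction m rule: dec_induct)
  case base
  show ?case by simp
next
  case (step m)
  have "residue x (Suc m) mod 2 ^ n = residue x (Suc m) mod 2 ^ m mod 2 ^ n"
    using step by (simp add: mod_mod_cancel le_imp_power_dvd)
  also have "\<dots> = residue x n"
    using step by (simp add: residue_Suc)
  finally show ?case .
qed

instantiation zint2 :: comm_ring_1
begin

lift_definition zero_zint2 :: zint2 is "\<lambda>n. 0 mod 2 ^ n" by simp

lift_definition one_zint2 :: zint2 is "\<lambda>n. 1 mod 2 ^ n"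
  by (rule mod_pow2_Suc[symmetric])

lift_definition plus_zint2 :: "zint2 \<Rightarrow> zint2 \<Rightarrow> zint2" is "\<lambda>r s n. (r n + s n) mod 2 ^ n"
  subgoal premises coh for r s n
    by (simp only: coh(1)[of n] coh(2)[of n] mod_pow2_Suc mod_add_eq)
  done

lift_definition minus_zint2 :: "zint2 \<Rightarrow> zint2 \<Rightarrow> zint2" is "\<lambda>r s n. (r n - s n) mod 2 ^ n"
  subgoal premises coh for r s n
    by (simp only: coh(1)[of n] coh(2)[of n] mod_pow2_Suc mod_diff_eq)
  done

lift_definition uminus_zint2 :: "zint2 \<Rightarrow> zint2" is "\<lambda>r n. (- r n) mod 2 ^ n"
  subgoal premises coh for r n
    by (simp only: coh[of n] mod_pow2_Suc mod_minus_eq)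
  done

lift_definition times_zint2 :: "zint2 \<Rightarrow> zint2 \<Rightarrow> zint2" is "\<lambda>r s n. (r n * s n) mod 2 ^ n"
  subgoal premises coh for r s n
    by (simp only: coh(1)[of n] coh(2)[of n] mod_pow2_Suc mod_mult_eq)
  done

instance
proof
  fix x y z :: zint2
  show "x + y + z = x + (y + z)"
    by (rule zint2_eqI) (simp add: plus_zint2.rep_eq mod_simps add.assoc)
  show "x + y = y + x"
    by (rule zint2_eqI) (simp add: plus_zint2.rep_eq add.commute)
  show "0 + x = x"
    by (rule zint2_eqI) (simp add: plus_zint2.rep_eq zero_zint2.rep_eq)
  show "- x + x = 0"
    by (rule zint2_eqI) (simp add: plus_zint2.rep_eq uminus_zint2.rep_eq zero_zint2.rep_eq mod_simps)
  show "x - y = x + - y"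
    by (rule zint2_eqI) (simp add: plus_zint2.rep_eq uminus_zint2.rep_eq minus_zint2.rep_eq mod_simps)
  show "x * y * z = x * (y * z)"
    by (rule zint2_eqI) (simp add: times_zint2.rep_eq mod_simps mult.assoc)
  show "x * y = y * x"
    by (rule zint2_eqI) (simp add: times_zint2.rep_eq mult.commute)
  show "1 * x = x"
    by (rule zint2_eqI) (simp only: times_zint2.rep_eq one_zint2.rep_eq mod_mult_left_eq mult_1 residue_mod)
  show "(x + y) * z = x * z + y * z"
    by (rule zint2_eqI) (simp add: times_zint2.rep_eq plus_zint2.rep_eq mod_simps algebra_simps)
  have "residue 0 1 \<noteq> residue 1 1"
    by (simp add: zero_zint2.rep_eq one_zint2.rep_eq)
  then show "(0 :: zint2) \<noteq> 1" by metis
qed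

end

lemma residue_0 [simp]: "residue 0 n = 0"
  by (simp add: zero_zint2.rep_eq)

lemma residue_two_power_mult:
  assumes "n \<le> i"
  shows "residue (2 ^ i * x) n = 0"
proof -
  have two: "residue (2 * y) m = (2 * residue y m) mod 2 ^ m" for y m
    using plus_zint2.rep_eq[of y y] by (simp flip: mult_2)
  have "residue (2 ^ i * x) n = (2 ^ i * residue x n) mod 2 ^ n"
    by (induction i) (simp_all add: two mult.assoc mod_simps)
  moreover have "2 ^ n dvd (2 ^ i * residue x n :: int)"
    using assms by (intro dvd_mult2 le_imp_power_dvd)
  ultimately show ?thesis by simp
qed

text \<open>The 2-adic metric: the exponent is the largest \<open>n\<close> such that \<open>x\<close> and \<open>y\<close> are congruent
  modulo \<open>2 ^ n\<close>.\<close>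

definition zint2_val :: "zint2 \<Rightarrow> zint2 \<Rightarrow> nat" where
  "zint2_val x y = (LEAST n. residue x (Suc n) \<noteq> residue y (Suc n))"

lemma le_zint2_val_iff:
  assumes "x \<noteq> y"
  shows "n \<le> zint2_val x y \<longleftrightarrow> residue x n = residue y n"
proof -
  let ?P = "\<lambda>n. residue x (Suc n) \<noteq> residue y (Suc n)"
  obtain m where m: "residue x m \<noteq> residue y m"
    using assms zint2_eqI by blast
  then obtain m' where "m = Suc m'"
    by (cases m) auto
  with m have ex: "?P m'" by simp
  have ne: "?P (zint2_val x y)"
    unfolding zint2_val_def by (rule LeastI, rule ex)
  show ?thesis
  proof
    assume le: "n \<le> zint2_val x y"
    show "residue x n = residue y n"
    proof (cases n)
      case (Suc k)
      then have "k < (LEAST n. ?P n)"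
        using le by (simp add: zint2_val_def)
      from not_less_Least[OF this] Suc show ?thesis by simp
    qed simp
  next
    assume eq: "residue x n = residue y n"
    show "n \<le> zint2_val x y"
    proof (rule ccontr)
      assume "\<not> n \<le> zint2_val x y"
      then have "Suc (zint2_val x y) \<le> n" by simp
      from residue_mod_le[OF this, of x] residue_mod_le[OF this, of y] eq ne
      show False by simp
    qed
  qed
qed

instantiation zint2 :: metric_space
begin

definition dist_zint2 :: "zint2 \<Rightarrow> zint2 \<Rightarrow> real" where
  "dist_zint2 x y = (if x = y then 0 else (1 / 2) ^ zint2_val x y)"

definition uniformity_zint2 :: "(zint2 \<times> zint2) filter" where
  "uniformity_zint2 = (INF e\<in>{0<..}. principal {(x, y). dist x y < e})"

definition open_zint2 :: "zint2 set \<Rightarrow> bool" where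
  "open_zint2 U \<longleftrightarrow> (\<forall>x\<in>U. \<forall>\<^sub>F (x', y) in uniformity. x' = x \<longrightarrow> y \<in> U)"

lemma dist_zint2_le: "dist x y \<le> (1 / 2 :: real) ^ n \<longleftrightarrow> residue x n = residue y n" for x y :: zint2
proof (cases "x = y")
  case False
  then have "dist x y \<le> (1 / 2 :: real) ^ n \<longleftrightarrow> n \<le> zint2_val x y"
    by (simp add: dist_zint2_def power_decreasing_iff)
  with False show ?thesis by (simp add: le_zint2_val_iff)
qed (simp add: dist_zint2_def)

instance
proof
  fix x y z :: zint2
  show "dist x y = 0 \<longleftrightarrow> x = y"
    by (simp add: dist_zint2_def)
  show "dist x y \<le> dist x z + dist y z"
  proof (cases "x = y \<or> x = z \<or> y = z")
    case True
    have "zint2_val x z = zint2_val z x" for x z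
      by (simp add: zint2_val_def eq_commute)
    with True show ?thesis by (auto simp: dist_zint2_def)
  next
    case False
    let ?n = "min (zint2_val x z) (zint2_val y z)"
    have "residue x ?n = residue z ?n" "residue y ?n = residue z ?n"
      using False by (simp_all flip: le_zint2_val_iff)
    then have "dist x y \<le> (1 / 2) ^ ?n"
      by (simp add: dist_zint2_le)
    also have "\<dots> \<le> dist x z + dist y z"
      using False by (auto simp: dist_zint2_def min_def)
    finally show ?thesis .
  qed
qed (simp_all add: uniformity_zint2_def open_zint2_def)

end

lemma summable_zint2: "summable (\<lambda>i. 2 ^ i * c i :: zint2)"
proof -
  let ?S = "\<lambda>m. \<Sum>i<m. 2 ^ i * c i"
  have add: "residue (?S (m + k)) m = residue (?S m) m" for m k
  proof (induction k)
    case (Suc k)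
    then show ?case by (simp add: plus_zint2.rep_eq residue_two_power_mult)
  qed simp
  have stable: "residue (?S m) n = residue (?S n) n" if "n \<le> m" for m n
    using add[of n "m - n"] that by simp
  have coh: "residue (?S n) n = residue (?S (Suc n)) (Suc n) mod 2 ^ n" for n
    by (metis stable residue_Suc le_Suc_eq order_refl)
  define l where "l = Abs_zint2 (\<lambda>n. residue (?S n) n)"
  have l: "residue l n = residue (?S n) n" for n
    unfolding l_def by (subst Abs_zint2_inverse) (rule CollectI allI coh refl)+
  have "?S \<longlonglongrightarrow> l"
  proof (rule metric_LIMSEQ_I)
    fix e :: real assume "e > 0"
    then obtain n where n: "(1 / 2) ^ n < e"
      using real_arch_pow_inv[of e "1/2"] by auto
    have "dist (?S m) l < e" if "n \<le> m" for m
    proof -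
      have "dist (?S m) l \<le> (1 / 2) ^ n"
        by (simp only: dist_zint2_le l stable[OF that])
      with n show ?thesis by simp
    qed
    then show "\<exists>no. \<forall>m\<ge>no. dist (?S m) l < e" by blast
  qed
  then show ?thesis
    by (auto simp: summable_def sums_def)
qed


section \<open>The binary rooted tree and the group \<open>M\<^sub>\<infinity>\<close>\<close>

datatype letter = La | Lb

type_synonym node = "letter list"

definition tree_adj :: "node \<Rightarrow> node \<Rightarrow> bool" where
  "tree_adj v w \<longleftrightarrow> (\<exists>s. w = v @ [s] \<or> v = w @ [s])"

definition tree_aut :: "(node \<Rightarrow> node) set" where
  "tree_aut = {\<sigma>. bij \<sigma> \<and> \<sigma> [] = [] \<and> (\<forall>v w. tree_adj (\<sigma> v) (\<sigma> w) \<longleftrightarrow> tree_adj v w)}"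

definition TreeAutGroup :: "(node \<Rightarrow> node) monoid" where
  "TreeAutGroup = BijGroup UNIV \<lparr>carrier := tree_aut\<rparr>"

text \<open>For a tree automorphism, failure of the first alternative means that \<open>\<sigma>\<close> exchanges the
  last letters of the two children.\<close>

definition Par :: "(node \<Rightarrow> node) \<Rightarrow> node \<Rightarrow> nat" where
  "Par \<sigma> x = (if \<sigma> (x @ [La]) = \<sigma> x @ [La] \<and> \<sigma> (x @ [Lb]) = \<sigma> x @ [Lb] then 0 else 1)"

text \<open>The list \<open>ss\<close> is \<open>s\<^sub>1, \<dots>, s\<^sub>i\<close>; the series converges by \<open>summable_zint2\<close>.\<close>

definition Q :: "(node \<Rightarrow> node) \<Rightarrow> node \<Rightarrow> zint2" where
  "Q \<sigma> x = suminf (\<lambda>i. 2 ^ i *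
     (\<Sum>ss | length ss = i. of_nat (Par \<sigma> (x @ concat (map (\<lambda>s. [La, s]) ss)))))"

definition P :: "(node \<Rightarrow> node) \<Rightarrow> node \<Rightarrow> zint2" where
  "P \<sigma> x = (- 1) ^ Par \<sigma> x + 2 * (\<Sum>s\<in>{La, Lb}. Q \<sigma> (x @ [Lb, s]))
     - 2 * (\<Sum>s\<in>{La, Lb}. Q \<sigma> (x @ [La, s]))"

definition M_inf :: "(node \<Rightarrow> node) set" where
  "M_inf = {\<sigma> \<in> tree_aut. \<forall>x. P \<sigma> x = P \<sigma> []}"


section \<open>Fields and Galois groups\<close>

definition GaloisGroup :: "'a :: field set \<Rightarrow> 'a set \<Rightarrow> ('a \<Rightarrow> 'a) monoid" where
  "GaloisGroup K L = BijGroup L \<lparr>carrier :=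
     {\<sigma> \<in> Bij L \<inter> ring_hom (ring_of_type_algebra \<lparr>carrier := L\<rparr>) (ring_of_type_algebra \<lparr>carrier := L\<rparr>).
        \<forall>x\<in>K. \<sigma> x = x}\<rparr>"

definition adjoin :: "'a :: field set \<Rightarrow> 'a set \<Rightarrow> 'a set" where
  "adjoin K S = generate_field ring_of_type_algebra (K \<union> S)"

definition primitive_root_of_unity :: "nat \<Rightarrow> 'a :: field \<Rightarrow> bool" where
  "primitive_root_of_unity n \<zeta> \<longleftrightarrow> \<zeta> ^ n = 1 \<and> (\<forall>m. 0 < m \<and> m < n \<longrightarrow> \<zeta> ^ m \<noteq> 1)"


section \<open>The preimage tree of \<open>t\<close>\<close>

text \<open>The field \<open>K = k(t)\<close> is the fraction field of the polynomial ring over \<open>k\<close>.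
  It is embedded in its algebraic closure by \<open>to_ac\<close>.\<close>

definition base_field :: "'k :: field poly fract alg_closure set" where
  "base_field = range to_ac"

definition var_t :: "'k :: field poly fract alg_closure" where
  "var_t = to_ac (Fract [:0, 1:] 1)"

definition basilica :: "'a :: field \<Rightarrow> 'a" where
  "basilica z = z ^ 2 - 1"

definition preimages :: "nat \<Rightarrow> 'a :: field \<Rightarrow> 'a set" where
  "preimages n t = {z. (basilica ^^ n) z = t}"

definition K_inf :: "'k :: field poly fract alg_closure set" where
  "K_inf = (\<Union>n. adjoin base_field (preimages n var_t))"

definition G_inf :: "('k :: field poly fract alg_closure \<Rightarrow> 'k poly fract alg_closure) monoid" where
  "G_inf = GaloisGroup base_field K_inf"

text \<open>A point of the disjoint union of the \<open>f\<^sup>-\<^sup>n(t)\<close> is a pair of a level \<open>n\<close> and a root in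
  \<open>f\<^sup>-\<^sup>n(t)\<close>; the word \<open>w\<close> is mapped to level \<open>length w\<close>.\<close>

definition is_labeling :: "'a :: field \<Rightarrow> (node \<Rightarrow> 'a) \<Rightarrow> bool" where
  "is_labeling t lab \<longleftrightarrow>
     bij_betw (\<lambda>w. (length w, lab w)) UNIV (SIGMA n:UNIV. preimages n t) \<and>
     lab [] = t \<and>
     (\<forall>w. {lab (w @ [La]), lab (w @ [Lb])} = {z. basilica z = lab w})"

definition induced_action :: "(node \<Rightarrow> 'a) \<Rightarrow> ('a \<Rightarrow> 'a) \<Rightarrow> node \<Rightarrow> node" where
  "induced_action lab \<sigma> w = (THE v. length v = length w \<and> lab v = \<sigma> (lab w))"

end

(* Write r n (v) for the product of the labels of the nodes v s1 a s2 a ... sn a. Its square is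
   r (n - 1) (v), and r 1 (v)^2 = - [v], so that r n (yb) / r n (ya) is a root of unity of order
   2^(n + 1); the labeling is chosen so that this root of unity zeta does not depend on y. Then
   sigma (r n (ya)) = r n (sigma(y)a) zeta^(Q sigma y) and sigma (zeta) = zeta^(P sigma y), which
   shows that the image of the Galois group lies in M_inf.

   For the converse consider first the subgroup B_inf of M_inf given by P = 1 and a constant field
   kappa that is algebraically closed. By induction on n, for all transcendental roots u at once, every
   element of B_inf agrees up to level n with a Galois automorphism: the field generated over
   kappa(u) by alpha = [a] is again rational, so the hypothesis applies to the subtrees above
   alpha and - alpha; inertia at alpha = 1 gives an automorphism which acts trivially above alpha
   and exchanges the two children of - alpha, and the normal closure in B_inf of such an element
   is, up to level n, the subgroup N_inf of those elements which also fix all r n (root). This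
   accounts for everything up to the values of P and of the exponent on r n (root), which are
   matched on the two subtrees in the same way on both sides.

   Finally [k(zeta_8) : k] = 4 says that - 1, 2 and - 2 are not squares in k, hence not in k(t);
   this gives automorphisms with P congruent to 5 modulo 8 and to 3 modulo 4, and these generate
   a dense subgroup of the units of the 2-adic integers. *)
theory Submission
  imports Defs
begin

section \<open>2-adic integers, tree automorphisms and the invariants \<open>Q\<close> and
  \<open>P\<close>\<close>

section \<open>Arithmetic of 2-adic integers\<close>

text \<open>The critical point 0 of z^2 - 1 lies on the cycle 0, -1, so ramification can only come
  from labels that become 0 or -1. This singles out the place alpha = 1: there - alpha is -1, whose
  two preimages collide at 0, while 1 lies off the cycle and everything above alpha stays
  unramified. The invariants \<open>Q\<close> and \<open>P\<close> are 2-adic and no finite level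
  sees them completely. Agreement up to level n therefore does not preserve them, and every such
  comparison is repaired by an element that is trivial up to level n. For this reason the subgroups
  considered contain a whole \<open>K_lev n\<close>; they are full preimages of subgroups of a
  finite quotient, and density can be used in place of closures. The elements \<open>alpha z\<close>
  and \<open>beta z\<close> supply all values of \<open>Q\<close> and \<open>QQ\<close> at the root.
  For elements of \<open>B_inf\<close> that fix the two children of the root, the condition P = 1 at
  the root says that the two subtree actions have the same \<open>QQ\<close>. The induction is thus
  about a fibre product: it needs surjectivity onto the left factor and the whole kernel of the left
  projection, and this kernel is \<open>N_inf\<close>.\<close>

lemma residue_double: "residue (2 * x) (Suc n) = 2 * residue x n"
proof -
  have two: "residue (2 * x) m = (2 * residue x m) mod 2 ^ m" for m
    using plus_zint2.rep_eq[of x x] by (simp flip: mult_2)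
  have "residue (2 * x) (Suc n) = (2 * residue x (Suc n)) mod (2 * 2 ^ n)"
    unfolding two by simp
  also have "\<dots> = 2 * (residue x (Suc n) mod 2 ^ n)"
    by (simp only: mult_mod_right)
  finally show ?thesis by (simp only: residue_Suc)
qed

lemma zint2_double_cancel: "2 * x = 2 * y \<longleftrightarrow> x = y" for x y :: zint2
proof
  assume "2 * x = 2 * y"
  then have "residue x n = residue y n" for n
    using residue_double[of x n] residue_double[of y n] by simp
  then show "x = y" by (rule zint2_eqI)
qed simp

lemma residue_1_cases: "residue x (Suc 0) = 0 \<or> residue x (Suc 0) = 1"
  using residue_mod[of x "Suc 0"] by (auto simp del: residue_mod)

lemma zint2_even_odd: "\<exists>h. x = 2 * h \<or> x = 1 + 2 * h" for x :: zint2
proof -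
  have even: "\<exists>h. x = 2 * h" if "residue x (Suc 0) = 0" for x
  proof -
    have ev: "even (residue x (Suc n))" for n
      using residue_mod_le[of "Suc 0" "Suc n" x] that by (simp add: even_iff_mod_2_eq_zero)
    define h where "h = Abs_zint2 (\<lambda>n. residue x (Suc n) div 2)"
    have coh: "residue x (Suc n) div 2 = (residue x (Suc (Suc n)) div 2) mod 2 ^ n" for n
    proof -
      have "2 * (residue x (Suc n) div 2) = residue x (Suc (Suc n)) mod (2 * 2 ^ n)"
        using ev[of n] residue_Suc[of x "Suc n"] by simp
      also have "\<dots> = 2 * ((residue x (Suc (Suc n)) div 2) mod 2 ^ n)"
        using ev[of "Suc n"] by (simp only: mult_mod_right even_two_times_div_two)
      finally show ?thesis by simp
    qed
    have h: "residue h n = residue x (Suc n) div 2" for n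
      unfolding h_def by (subst Abs_zint2_inverse) (rule CollectI allI coh refl)+
    have "x = 2 * h"
    proof (rule zint2_eqI)
      fix n show "residue x n = residue (2 * h) n"
      proof (cases n)
        case (Suc m)
        then show ?thesis using ev[of m] by (simp add: residue_double h)
      qed simp
    qed
    then show ?thesis ..
  qed
  show ?thesis
  proof (cases "residue x (Suc 0) = 0")
    case False
    then have "residue x (Suc 0) = 1" using residue_1_cases by blast
    then have "residue (x - 1) (Suc 0) = 0"
      by (simp add: minus_zint2.rep_eq one_zint2.rep_eq)
    then obtain h where "x - 1 = 2 * h" using even by blast
    then have "x = 1 + 2 * h" by (simp add: diff_eq_eq add.commute)
    then show ?thesis by blast
  qed (use even in blast)
qed

lemma residue_eq_0_iff: "residue x n = 0 \<longleftrightarrow> 2 ^ n dvd x"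
proof
  show "2 ^ n dvd x \<Longrightarrow> residue x n = 0"
    by (auto simp: residue_two_power_mult)
  show "residue x n = 0 \<Longrightarrow> 2 ^ n dvd x"
  proof (induction n arbitrary: x)
    case (Suc n)
    obtain h where "x = 2 * h \<or> x = 1 + 2 * h" using zint2_even_odd by blast
    moreover have "residue (1 + 2 * h) (Suc n) \<noteq> 0"
    proof
      assume "residue (1 + 2 * h) (Suc n) = 0"
      then have "residue (1 + 2 * h) (Suc 0) = 0"
        using residue_mod_le[of "Suc 0" "Suc n" "1 + 2 * h"] by simp
      then show False
        by (simp add: plus_zint2.rep_eq one_zint2.rep_eq residue_double)
    qed
    ultimately have h: "x = 2 * h" using Suc.prems by blast
    then have "residue h n = 0" using Suc.prems by (simp add: residue_double)
    then have "2 ^ n dvd h" by (rule Suc.IH)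
    then show ?case unfolding h power_Suc by (intro mult_dvd_mono) simp_all
  qed simp
qed

lemma residue_eq_iff_dvd: "residue x n = residue y n \<longleftrightarrow> 2 ^ n dvd x - y"
proof -
  have "2 ^ n dvd x - y \<longleftrightarrow> (residue x n - residue y n) mod 2 ^ n = 0"
    by (simp add: minus_zint2.rep_eq flip: residue_eq_0_iff)
  also have "\<dots> \<longleftrightarrow> residue x n mod 2 ^ n = residue y n mod 2 ^ n"
    by (simp add: mod_eq_dvd_iff mod_eq_0_iff_dvd del: residue_mod)
  finally show ?thesis by simp
qed

lemma zint2_eqI_dvd:
  fixes x y :: zint2
  assumes "\<And>n. 2 ^ n dvd x - y"
  shows "x = y"
  using assms by (intro zint2_eqI) (simp add: residue_eq_iff_dvd)

text \<open>Only 0 is divisible by all powers of 2. This is for identities whose defect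
  \<open>D\<close> at one argument is twice a sum of defects at other arguments: divisibility of all
  defects then improves by one factor 2 at each round.\<close>

lemma zint2_coinduct:
  fixes D :: "'b \<Rightarrow> zint2"
  assumes "\<And>n x. (\<And>y. 2 ^ n dvd D y) \<Longrightarrow> 2 ^ Suc n dvd D x"
  shows "D x = 0"
proof -
  have "2 ^ n dvd D x" for n
    by (induction n arbitrary: x) (simp, rule assms)
  then show ?thesis using zint2_eqI_dvd[of "D x" 0] by simp
qed

lemma zint2_not_even_odd: "2 * x \<noteq> 1 + 2 * (y :: zint2)"
proof
  assume eq: "2 * x = 1 + 2 * y"
  have "residue (1 + 2 * y) (Suc 0) = 1"
    by (simp add: plus_zint2.rep_eq one_zint2.rep_eq residue_double)
  then show False
    by (simp add: residue_double flip: eq)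
qed

lemma two_power_dvd_imp: "2 ^ Suc n dvd 2 * (x :: zint2) \<Longrightarrow> 2 ^ n dvd x"
proof -
  assume "2 ^ Suc n dvd 2 * x"
  then obtain k where "2 * x = 2 ^ Suc n * k" by (rule dvdE)
  then have "2 * x = 2 * (2 ^ n * k)" by (simp only: power_Suc mult.assoc)
  then have "x = 2 ^ n * k" by (simp only: zint2_double_cancel)
  then show ?thesis by simp
qed

text \<open>\<open>zodd\<close> and \<open>zhalf\<close> are the last binary digit and the shift;
  they let functions on the tree recurse on a 2-adic exponent.\<close>

definition zodd :: "zint2 \<Rightarrow> bool" where
  "zodd x \<longleftrightarrow> (\<exists>h. x = 1 + 2 * h)"

definition zhalf :: "zint2 \<Rightarrow> zint2" where
  "zhalf x = (THE h. x = of_bool (zodd x) + 2 * h)"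

lemma zhalf_eq: "of_bool (zodd x) + 2 * zhalf x = x"
proof -
  obtain h where h: "x = of_bool (zodd x) + 2 * h"
  proof (cases "zodd x")
    case True
    then show ?thesis using that by (auto simp: zodd_def)
  next
    case False
    then obtain h where "x = 2 * h" using zint2_even_odd[of x] by (auto simp: zodd_def)
    then show ?thesis using that[of h] False by simp
  qed
  have "zhalf x = h"
    unfolding zhalf_def
  proof (rule the_equality)
    fix h' assume "x = of_bool (zodd x) + 2 * h'"
    with h have "of_bool (zodd x) + 2 * h' = of_bool (zodd x) + 2 * h" by simp
    then show "h' = h" by (simp add: zint2_double_cancel)
  qed (rule h)
  with h show ?thesis by simp
qed

lemma zodd_double [simp]: "\<not> zodd (2 * x)"
  by (simp add: zodd_def zint2_not_even_odd)

lemma zodd_1_double [simp]: "zodd (1 + 2 * x)"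
  by (auto simp: zodd_def)

lemma zhalf_double [simp]: "zhalf (2 * x) = x"
  using zhalf_eq[of "2 * x"] by (simp add: zint2_double_cancel)

lemma zhalf_1_double [simp]: "zhalf (1 + 2 * x) = x"
  using zhalf_eq[of "1 + 2 * x"] by (simp add: zint2_double_cancel)

lemma zint2_parity_cases:
  fixes x :: zint2
  obtains (even) h where "x = 2 * h" | (odd) h where "x = 1 + 2 * h"
  using zint2_even_odd by blast

text \<open>An odd 2-adic integer generates a dense additive subgroup: if the error \<open>z\<close>
  is odd, adding \<open>2 ^ n\<close> to the multiplier makes it even.\<close>

lemma odd_multiple_approx:
  fixes v x :: zint2
  assumes "zodd v"
  shows "\<exists>k z. x = of_nat k * v + 2 ^ n * z"
proof (induction n)
  case 0
  show ?case by (rule exI[of _ 0]) auto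
next
  case (Suc n)
  then obtain k z where x: "x = of_nat k * v + 2 ^ n * z" by blast
  obtain c where v: "v = 1 + 2 * c" using assms by (auto simp: zodd_def)
  show ?case
  proof (cases z rule: zint2_parity_cases)
    case (even h)
    then have "x = of_nat k * v + 2 ^ Suc n * h" using x by (simp add: algebra_simps)
    then show ?thesis by blast
  next
    case (odd h)
    then have "x = of_nat (k + 2 ^ n) * v + 2 ^ Suc n * (h - c)"
      using x v by (simp add: algebra_simps)
    then show ?thesis by blast
  qed
qed

subsection \<open>Series\<close>

lemma residue_suminf:
  "residue (suminf (\<lambda>i. 2 ^ i * c i)) n = residue (\<Sum>i<n. 2 ^ i * c i) n"
proof -
  let ?S = "\<lambda>m. \<Sum>i<m. 2 ^ i * c i"
  have "?S \<longlonglongrightarrow> suminf (\<lambda>i. 2 ^ i * c i)"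
    by (rule summable_LIMSEQ[OF summable_zint2])
  from metric_LIMSEQ_D[OF this, of "(1/2) ^ n"]
  obtain no where "\<forall>m\<ge>no. dist (?S m) (suminf (\<lambda>i. 2 ^ i * c i)) < (1/2) ^ n" by auto
  then have "dist (?S (n + no)) (suminf (\<lambda>i. 2 ^ i * c i)) \<le> (1/2) ^ n"
    by (intro less_imp_le) auto
  then have "residue (suminf (\<lambda>i. 2 ^ i * c i)) n = residue (?S (n + no)) n"
    by (simp only: dist_zint2_le)
  also have "\<dots> = residue (?S n) n"
    by (induction no) (simp_all add: plus_zint2.rep_eq residue_two_power_mult)
  finally show ?thesis .
qed

lemma suminf_two_power_Suc:
  fixes c :: "nat \<Rightarrow> zint2"
  shows "suminf (\<lambda>i. 2 ^ i * c i) = c 0 + 2 * suminf (\<lambda>i. 2 ^ i * c (Suc i))"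
proof (rule zint2_eqI_dvd)
  fix n
  have A: "2 ^ Suc n dvd suminf (\<lambda>i. 2 ^ i * c i) - (\<Sum>i<Suc n. 2 ^ i * c i)"
    by (simp only: residue_suminf flip: residue_eq_iff_dvd)
  have "2 ^ n dvd suminf (\<lambda>i. 2 ^ i * c (Suc i)) - (\<Sum>i<n. 2 ^ i * c (Suc i))"
    by (simp only: residue_suminf flip: residue_eq_iff_dvd)
  then have B: "2 ^ Suc n dvd 2 * (suminf (\<lambda>i. 2 ^ i * c (Suc i)) - (\<Sum>i<n. 2 ^ i * c (Suc i)))"
    unfolding power_Suc by (intro mult_dvd_mono) simp_all
  have C: "(\<Sum>i<Suc n. 2 ^ i * c i) = c 0 + 2 * (\<Sum>i<n. 2 ^ i * c (Suc i))"
    by (subst sum.lessThan_Suc_shift) (simp add: sum_distrib_left mult.assoc)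
  have "2 ^ Suc n dvd (suminf (\<lambda>i. 2 ^ i * c i) - (\<Sum>i<Suc n. 2 ^ i * c i))
       - 2 * (suminf (\<lambda>i. 2 ^ i * c (Suc i)) - (\<Sum>i<n. 2 ^ i * c (Suc i)))"
    by (rule dvd_diff[OF A B])
  also have "\<dots> = suminf (\<lambda>i. 2 ^ i * c i) - (c 0 + 2 * suminf (\<lambda>i. 2 ^ i * c (Suc i)))"
    unfolding C by (simp add: algebra_simps)
  finally show "2 ^ n dvd suminf (\<lambda>i. 2 ^ i * c i) - (c 0 + 2 * suminf (\<lambda>i. 2 ^ i * c (Suc i)))"
    by (rule dvd_trans[rotated]) (rule le_imp_power_dvd, simp)
qed

lemma suminf_two_power_add:
  fixes c d :: "nat \<Rightarrow> zint2"
  shows "suminf (\<lambda>i. 2 ^ i * (c i + d i)) = suminf (\<lambda>i. 2 ^ i * c i) + suminf (\<lambda>i. 2 ^ i * d i)"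
proof (rule zint2_eqI)
  fix n
  have "residue (suminf (\<lambda>i. 2 ^ i * (c i + d i))) n
      = residue ((\<Sum>i<n. 2 ^ i * c i) + (\<Sum>i<n. 2 ^ i * d i)) n"
    unfolding residue_suminf by (simp add: distrib_left sum.distrib)
  then show "residue (suminf (\<lambda>i. 2 ^ i * (c i + d i))) n
      = residue (suminf (\<lambda>i. 2 ^ i * c i) + suminf (\<lambda>i. 2 ^ i * d i)) n"
    by (simp only: residue_suminf plus_zint2.rep_eq)
qed

section \<open>Tree automorphisms\<close>

lemma letter_UNIV: "(UNIV :: letter set) = {La, Lb}"
  using letter.exhaust by auto

lemma tree_autD:
  assumes "\<sigma> \<in> tree_aut"
  shows "bij \<sigma>" "\<sigma> [] = []" "tree_adj (\<sigma> v) (\<sigma> w) \<longleftrightarrow> tree_adj v w"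
  using assms by (auto simp: tree_aut_def)

lemma tree_aut_snoc:
  assumes "\<sigma> \<in> tree_aut"
  shows "\<exists>s'. \<sigma> (w @ [s]) = \<sigma> w @ [s']"
proof (induction w arbitrary: s rule: rev_induct)
  case Nil
  have "tree_adj [] [s]" by (simp add: tree_adj_def)
  then have "tree_adj (\<sigma> []) (\<sigma> [s])" by (simp only: tree_autD(3)[OF assms])
  then show ?case using tree_autD(2)[OF assms] by (auto simp: tree_adj_def)
next
  case (snoc s0 w)
  from snoc obtain s1 where s1: "\<sigma> (w @ [s0]) = \<sigma> w @ [s1]" by blast
  have "tree_adj (w @ [s0]) (w @ [s0, s])" by (simp add: tree_adj_def)
  then have "tree_adj (\<sigma> (w @ [s0])) (\<sigma> (w @ [s0, s]))"
    by (simp only: tree_autD(3)[OF assms])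
  then consider t where "\<sigma> (w @ [s0, s]) = \<sigma> (w @ [s0]) @ [t]"
    | t where "\<sigma> (w @ [s0]) = \<sigma> (w @ [s0, s]) @ [t]"
    by (auto simp: tree_adj_def)
  then show ?case
  proof cases
    case 2
    then have "\<sigma> (w @ [s0, s]) = \<sigma> w" using s1 by simp
    then have "w @ [s0, s] = w" using tree_autD(1)[OF assms] by (simp add: bij_def inj_eq)
    then show ?thesis by simp
  qed simp
qed

lemma tree_aut_length:
  assumes "\<sigma> \<in> tree_aut"
  shows "length (\<sigma> w) = length w"
proof (induction w rule: rev_induct)
  case (snoc s w)
  then show ?case using tree_aut_snoc[OF assms, of w s] by auto
qed (use tree_autD(2)[OF assms] in simp)

lemma tree_autI:
  assumes "bij \<sigma>" "\<sigma> [] = []" and snoc: "\<And>w s. \<exists>s'. \<sigma> (w @ [s]) = \<sigma> w @ [s']"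
  shows "\<sigma> \<in> tree_aut"
proof -
  have len: "length (\<sigma> w) = length w" for w
  proof (induction w rule: rev_induct)
    case (snoc s w)
    then show ?case using assms(3)[of w s] by auto
  qed (simp add: assms)
  have *: "(\<exists>s. \<sigma> w = \<sigma> v @ [s]) \<longleftrightarrow> (\<exists>s. w = v @ [s])" for v w
  proof
    assume "\<exists>s. \<sigma> w = \<sigma> v @ [s]"
    then obtain t where t: "\<sigma> w = \<sigma> v @ [t]" by blast
    then have "w \<noteq> []" using len[of w] by auto
    then obtain w' s where w: "w = w' @ [s]" by (metis rev_exhaust)
    then obtain s' where "\<sigma> w = \<sigma> w' @ [s']" using snoc by blast
    then have "\<sigma> w' = \<sigma> v" using t by simp
    then have "w' = v" using assms(1) by (simp add: bij_def inj_eq)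
    then show "\<exists>s. w = v @ [s]" using w by blast
  qed (use snoc in auto)
  show ?thesis
    by (simp add: tree_aut_def tree_adj_def ex_disj_distrib * assms(1,2))
qed

lemma tree_aut_id: "id \<in> tree_aut"
  by (auto simp: tree_aut_def)

lemma tree_aut_comp: "\<sigma> \<in> tree_aut \<Longrightarrow> \<tau> \<in> tree_aut \<Longrightarrow> \<sigma> \<circ> \<tau> \<in> tree_aut"
  by (auto simp: tree_aut_def intro: bij_comp)

abbreviation tinv :: "(node \<Rightarrow> node) \<Rightarrow> node \<Rightarrow> node" where
  "tinv \<sigma> \<equiv> inv_into UNIV \<sigma>"

lemma tree_aut_inv:
  assumes "\<sigma> \<in> tree_aut" shows "tinv \<sigma> \<in> tree_aut"
proof -
  have b: "bij \<sigma>" using tree_autD(1)[OF assms] .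
  then have "\<sigma> (tinv \<sigma> x) = x" for x by (simp add: bij_is_surj surj_f_inv_f)
  then have "tree_adj (tinv \<sigma> v) (tinv \<sigma> w) = tree_adj v w" for v w
    using tree_autD(3)[OF assms, of "tinv \<sigma> v" "tinv \<sigma> w"] by simp
  moreover have "tinv \<sigma> [] = []"
    using tree_autD(2)[OF assms] b by (metis bij_inv_eq_iff)
  ultimately show ?thesis using b by (auto simp: tree_aut_def bij_imp_bij_inv)
qed

lemma tree_aut_inv_comp:
  assumes "\<sigma> \<in> tree_aut"
  shows "tinv \<sigma> \<circ> \<sigma> = id" "\<sigma> \<circ> tinv \<sigma> = id" "\<sigma> (tinv \<sigma> w) = w" "tinv \<sigma> (\<sigma> w) = w"
  using tree_autD(1)[OF assms]
  by (auto simp: bij_def surj_iff inv_f_f surj_f_inv_f)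

text \<open>The decomposition of the automorphism group of the tree as a wreath product, with the
  exchange of the two subtrees performed last.\<close>

fun br :: "bool \<Rightarrow> (node \<Rightarrow> node) \<Rightarrow> (node \<Rightarrow> node) \<Rightarrow> node \<Rightarrow> node" where
  "br sw s t [] = []"
| "br sw s t (La # w) = (if sw then Lb else La) # s w"
| "br sw s t (Lb # w) = (if sw then La else Lb) # t w"

lemma node_cases:
  obtains (Nil) "w = []" | (La) v where "w = La # v" | (Lb) v where "w = Lb # v"
proof (cases w)
  case (Cons c v)
  then show ?thesis using La Lb by (cases c) auto
qed (use Nil in blast)

lemma br_comp:
  "br sw s t \<circ> br sw' s' t' =
     br (sw \<noteq> sw') ((if sw' then t else s) \<circ> s') ((if sw' then s else t) \<circ> t')"
proof
  fix w show "(br sw s t \<circ> br sw' s' t') w = br (sw \<noteq> sw') ((if sw' then t else s) \<circ> s') ((if sw' then s else t) \<circ> t') w"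
    by (cases w rule: node_cases) auto
qed

lemma br_id: "br False id id = id"
proof
  fix w show "br False id id w = id w"
    by (cases w rule: node_cases) auto
qed

lemma br_snoc:
  assumes "s \<in> tree_aut" "t \<in> tree_aut"
  shows "\<exists>x'. br sw s t (w @ [x]) = br sw s t w @ [x']"
proof (cases w rule: node_cases)
  case Nil
  then show ?thesis
    using tree_autD(2)[OF assms(1)] tree_autD(2)[OF assms(2)] by (cases x) auto
next
  case (La v)
  then show ?thesis using tree_aut_snoc[OF assms(1)] by auto
next
  case (Lb v)
  then show ?thesis using tree_aut_snoc[OF assms(2)] by auto
qed

lemma br_inverse:
  assumes "s \<in> tree_aut" "t \<in> tree_aut"
  shows "br sw (if sw then tinv t else tinv s) (if sw then tinv s else tinv t) \<circ> br sw s t = id"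
    and "br sw s t \<circ> br sw (if sw then tinv t else tinv s) (if sw then tinv s else tinv t) = id"
  using tree_aut_inv_comp[OF assms(1)] tree_aut_inv_comp[OF assms(2)]
  by (auto simp: br_comp br_id)

lemma br_tree_aut:
  assumes "s \<in> tree_aut" "t \<in> tree_aut"
  shows "br sw s t \<in> tree_aut"
proof (rule tree_autI)
  show "bij (br sw s t)" by (rule o_bij) (fact br_inverse[OF assms])+
qed (simp_all add: br_snoc[OF assms])

lemma inv_br:
  assumes "s \<in> tree_aut" "t \<in> tree_aut"
  shows "tinv (br sw s t) = br sw (if sw then tinv t else tinv s) (if sw then tinv s else tinv t)"
  by (rule inv_unique_comp) (fact br_inverse[OF assms])+

lemma tree_aut_br:
  assumes "\<sigma> \<in> tree_aut"
  obtains sw s t where "s \<in> tree_aut" "t \<in> tree_aut" "\<sigma> = br sw s t"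
proof -
  obtain la lb where la: "\<sigma> [La] = [la]" and lb: "\<sigma> [Lb] = [lb]"
    using tree_aut_snoc[OF assms, of "[]"] tree_autD(2)[OF assms] by fastforce
  have ne: "la \<noteq> lb"
    using la lb tree_autD(1)[OF assms] by (metis bij_def inj_eq list.inject letter.distinct(1))
  have hd: "\<exists>v. \<sigma> (c # w) = \<sigma> [c] @ v" for c w
  proof (induction w rule: rev_induct)
    case (snoc x w)
    then show ?case using tree_aut_snoc[OF assms, of "c # w" x] by auto
  qed simp
  define sec where "sec c w = tl (\<sigma> (c # w))" for c w
  have sa: "\<sigma> (La # w) = la # sec La w" and sb: "\<sigma> (Lb # w) = lb # sec Lb w" for w
    using hd[of La w] hd[of Lb w] la lb by (auto simp: sec_def)
  have eq: "\<sigma> = br (la = Lb) (sec La) (sec Lb)"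
  proof
    fix w show "\<sigma> w = br (la = Lb) (sec La) (sec Lb) w"
      using ne tree_autD(2)[OF assms] by (cases w rule: node_cases; cases la; cases lb) (auto simp: sa sb)
  qed
  have inj: "inj \<sigma>" and surj: "surj \<sigma>" using tree_autD(1)[OF assms] by (auto simp: bij_def)
  have "sec c \<in> tree_aut" for c
  proof (rule tree_autI)
    have cs: "\<sigma> (c # w) = hd (\<sigma> [c]) # sec c w" for w
      using sa sb la lb by (cases c) auto
    show "sec c [] = []" using la lb by (cases c) (auto simp: sec_def)
    show "\<exists>s'. sec c (w @ [s]) = sec c w @ [s']" for w s
      using tree_aut_snoc[OF assms, of "c # w" s] cs[of "w @ [s]"] cs[of w] by auto
    show "bij (sec c)"
      unfolding bij_def
    proof
      show "inj (sec c)"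
      proof (rule injI)
        fix v w assume "sec c v = sec c w"
        then have "\<sigma> (c # v) = \<sigma> (c # w)" unfolding cs[of v] cs[of w] by simp
        then show "v = w" using inj by (simp add: inj_eq)
      qed
      show "surj (sec c)"
      unfolding surj_def proof
        fix v
        obtain u where u: "\<sigma> u = hd (\<sigma> [c]) # v" using surj by (metis surjD)
        then obtain d w where dw: "u = d # w" using tree_autD(2)[OF assms] by (cases u) auto
        then have "\<sigma> u = hd (\<sigma> [d]) # sec d w" using sa sb la lb by (cases d) auto
        then have "hd (\<sigma> [d]) = hd (\<sigma> [c])" using u by simp
        then have "d = c" using ne la lb by (cases c; cases d) auto
        then show "\<exists>w. v = sec c w" using u dw cs[of w] by auto
      qed
    qed
  qed
  then show thesis using that eq by blast
qed

section \<open>The functions \<open>Q\<close> and \<open>P\<close>\<close>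

text \<open>On the field side \<open>QQ \<sigma> x\<close> is the exponent that the products of
  labels belonging to \<open>x\<close> itself acquire, just as \<open>Q \<sigma> x\<close> belongs
  to the child \<open>x @ [La]\<close>.\<close>

definition QQ :: "(node \<Rightarrow> node) \<Rightarrow> node \<Rightarrow> zint2" where
  "QQ \<sigma> x = Q \<sigma> (x @ [La]) + Q \<sigma> (x @ [Lb])"

lemma finite_length_letters: "finite {ss :: letter list. length ss = i}"
proof -
  have "finite (UNIV :: letter set)" by (simp add: letter_UNIV)
  from finite_lists_length_eq[OF this] show ?thesis by simp
qed

lemma sum_length_Suc:
  fixes g :: "letter list \<Rightarrow> 'c :: comm_monoid_add"
  shows "(\<Sum>ss | length ss = Suc i. g ss) =
    (\<Sum>ss | length ss = i. g (La # ss)) + (\<Sum>ss | length ss = i. g (Lb # ss))"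
proof -
  have eq: "{ss. length ss = Suc i} = (#) La ` {ss. length ss = i} \<union> (#) Lb ` {ss. length ss = i}"
    by (auto simp: length_Suc_conv image_iff) (metis letter.exhaust)
  show ?thesis
    unfolding eq
    by (subst sum.union_disjoint)
      (auto simp: finite_length_letters sum.reindex inj_on_def)
qed

lemma Q_rec: "Q \<sigma> x = of_nat (Par \<sigma> x) + 2 * QQ \<sigma> (x @ [La])"
proof -
  let ?c = "\<lambda>y i. \<Sum>ss | length ss = i. of_nat (Par \<sigma> (y @ concat (map (\<lambda>s. [La, s]) ss))) :: zint2"
  have Suc: "?c x (Suc i) = ?c (x @ [La, La]) i + ?c (x @ [La, Lb]) i" for i
    by (subst sum_length_Suc) simp
  have "Q \<sigma> x = ?c x 0 + 2 * suminf (\<lambda>i. 2 ^ i * ?c x (Suc i))"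
    unfolding Q_def by (rule suminf_two_power_Suc)
  also have "suminf (\<lambda>i. 2 ^ i * ?c x (Suc i)) = Q \<sigma> (x @ [La, La]) + Q \<sigma> (x @ [La, Lb])"
    unfolding Suc suminf_two_power_add Q_def ..
  finally show ?thesis by (simp add: QQ_def)
qed

lemma P_rec: "P \<sigma> x = (- 1) ^ Par \<sigma> x + 2 * QQ \<sigma> (x @ [Lb]) - 2 * QQ \<sigma> (x @ [La])"
  by (simp add: P_def QQ_def)

fun flip :: "letter \<Rightarrow> letter" where
  "flip La = Lb"
| "flip Lb = La"

lemma Par_cases:
  assumes "\<sigma> \<in> tree_aut"
  obtains (id) "Par \<sigma> x = 0" "\<And>s. \<sigma> (x @ [s]) = \<sigma> x @ [s]"
  | (flip) "Par \<sigma> x = Suc 0" "\<And>s. \<sigma> (x @ [s]) = \<sigma> x @ [flip s]"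
proof -
  obtain la lb where l: "\<sigma> (x @ [La]) = \<sigma> x @ [la]" "\<sigma> (x @ [Lb]) = \<sigma> x @ [lb]"
    using tree_aut_snoc[OF assms] by meson
  have "\<sigma> (x @ [La]) \<noteq> \<sigma> (x @ [Lb])"
    using tree_autD(1)[OF assms] by (simp add: bij_def inj_eq)
  then have ne: "la \<noteq> lb" using l by auto
  show thesis
  proof (cases la)
    case La
    then have "lb = Lb" using ne by (cases lb) auto
    then have "\<sigma> (x @ [s]) = \<sigma> x @ [s]" for s using l La by (cases s) auto
    then show thesis by (intro id) (auto simp: Par_def)
  next
    case Lb
    then have "lb = La" using ne by (cases lb) auto
    then have "\<sigma> (x @ [s]) = \<sigma> x @ [flip s]" for s using l Lb by (cases s) auto
    then show thesis by (intro flip) (auto simp: Par_def)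
  qed
qed

lemma QQ_image:
  assumes "\<tau> \<in> tree_aut"
  shows "Q \<sigma> (\<tau> (y @ [La])) + Q \<sigma> (\<tau> (y @ [Lb])) = QQ \<sigma> (\<tau> y)"
  using assms by (cases rule: Par_cases[where x = y]) (simp_all add: QQ_def add.commute)

lemma Par_comp:
  assumes "\<sigma> \<in> tree_aut" "\<tau> \<in> tree_aut"
  shows "Par (\<sigma> \<circ> \<tau>) x = (if Par \<tau> x = 0 then Par \<sigma> (\<tau> x) else 1 - Par \<sigma> (\<tau> x))"
proof -
  from assms(2) show ?thesis
  proof (cases rule: Par_cases[where x = x])
    case id
    then show ?thesis by (simp add: Par_def)
  next
    case flip
    from assms(1) show ?thesis
      by (cases rule: Par_cases[where x = "\<tau> x"]) (simp_all add: flip, simp_all add: Par_def flip)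
  qed
qed

lemma P_minus_one_power:
  "\<sigma> \<in> tree_aut \<Longrightarrow> (- 1) ^ Par \<sigma> x = (1 - 2 * of_nat (Par \<sigma> x) :: zint2)"
  by (erule Par_cases[where x = x]) auto

lemma M_infD:
  assumes "\<sigma> \<in> M_inf"
  shows "\<sigma> \<in> tree_aut" "P \<sigma> x = P \<sigma> []"
  using assms unfolding M_inf_def by blast+

text \<open>A cocycle identity. Its defect at \<open>x\<close> is twice the sum of the defects at
  \<open>x @ [La, La]\<close> and \<open>x @ [La, Lb]\<close>, hence 0. If \<tau> exchanges the
  children of \<open>x\<close>, the tail of the series for \<sigma> is taken at
  \<open>\<tau> x @ [Lb]\<close> instead of \<open>\<tau> x @ [La]\<close>, and the formula for
  \<open>P \<sigma>\<close> at \<open>\<tau> x\<close> is exactly the correction required.\<close>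

lemma Q_comp:
  assumes \<sigma>: "\<sigma> \<in> M_inf" and \<tau>: "\<tau> \<in> tree_aut"
  shows "Q (\<sigma> \<circ> \<tau>) x = Q \<sigma> (\<tau> x) + P \<sigma> [] * Q \<tau> x"
proof -
  note \<sigma>' = M_infD(1)[OF \<sigma>]
  define D where "D x = Q (\<sigma> \<circ> \<tau>) x - (Q \<sigma> (\<tau> x) + P \<sigma> [] * Q \<tau> x)" for x
  have rec: "D x = 2 * (D (x @ [La, La]) + D (x @ [La, Lb]))" for x
  proof -
    have "QQ (\<sigma> \<circ> \<tau>) (x @ [La]) - (QQ \<sigma> (\<tau> (x @ [La])) + P \<sigma> [] * QQ \<tau> (x @ [La]))
        = D (x @ [La, La]) + D (x @ [La, Lb])"
      using QQ_image[OF \<tau>, of \<sigma> "x @ [La]"]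
      by (simp add: D_def QQ_def algebra_simps)
    moreover have "D x = 2 * (QQ (\<sigma> \<circ> \<tau>) (x @ [La])
        - (QQ \<sigma> (\<tau> (x @ [La])) + P \<sigma> [] * QQ \<tau> (x @ [La])))"
      using \<tau>
    proof (cases rule: Par_cases[where x = x])
      case id
      then show ?thesis
        unfolding D_def Q_rec[of _ x] Q_rec[of _ "\<tau> x"] Par_comp[OF \<sigma>' \<tau>]
        by (simp add: algebra_simps)
    next
      case flip
      have 1: "P \<sigma> [] = 1 - 2 * of_nat (Par \<sigma> (\<tau> x)) + 2 * QQ \<sigma> (\<tau> x @ [Lb]) - 2 * QQ \<sigma> (\<tau> x @ [La])"
        by (subst M_infD(2)[OF \<sigma>, symmetric, of "\<tau> x"])
          (simp add: P_rec P_minus_one_power[OF \<sigma>'])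
      have 2: "of_nat (1 - Par \<sigma> (\<tau> x)) = (1 - of_nat (Par \<sigma> (\<tau> x)) :: zint2)"
        using \<sigma>' by (cases rule: Par_cases[where x = "\<tau> x"]) auto
      have a: "Q (\<sigma> \<circ> \<tau>) x = 1 - of_nat (Par \<sigma> (\<tau> x)) + 2 * QQ (\<sigma> \<circ> \<tau>) (x @ [La])"
        unfolding Q_rec[of _ x] Par_comp[OF \<sigma>' \<tau>] using flip 2 by simp
      have b: "Q \<sigma> (\<tau> x) = of_nat (Par \<sigma> (\<tau> x)) + 2 * QQ \<sigma> (\<tau> x @ [La])"
        by (rule Q_rec)
      have c: "P \<sigma> [] * Q \<tau> x = P \<sigma> [] + P \<sigma> [] * (2 * QQ \<tau> (x @ [La]))"
        unfolding Q_rec[of \<tau> x] using flip by (simp add: distrib_left)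
      have d: "\<tau> (x @ [La]) = \<tau> x @ [Lb]" using flip by simp
      have "1 - p + 2 * S - (p + 2 * A + (u + u * (2 * C))) = 2 * (S - (B + u * C))"
        if "u = 1 - 2 * p + 2 * B - 2 * A" for u p A B C S :: zint2
        unfolding that by (simp add: algebra_simps)
      from this[OF 1] show ?thesis
        unfolding D_def a b c d .
    qed
    ultimately show ?thesis by simp
  qed
  have "2 ^ Suc n dvd D x" if "\<And>y. 2 ^ n dvd D y" for n x
    unfolding rec[of x] power_Suc by (intro mult_dvd_mono dvd_add dvd_refl that)
  then have "D x = 0" by (rule zint2_coinduct)
  then show ?thesis by (simp add: D_def)
qed

lemma QQ_comp:
  assumes "\<sigma> \<in> M_inf" "\<tau> \<in> tree_aut"
  shows "QQ (\<sigma> \<circ> \<tau>) x = QQ \<sigma> (\<tau> x) + P \<sigma> [] * QQ \<tau> x"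
  using QQ_image[OF assms(2), of \<sigma> x]
  by (simp add: QQ_def Q_comp[OF assms] algebra_simps)

text \<open>As \<open>P \<sigma>\<close> is constant, the same factor \<open>P \<sigma> []\<close>
  appears in the cocycle identity at both children, and an exchange by \<tau> only changes the
  overall sign of the terms coming from \<sigma>. Thus \<open>P\<close> is a character of
  \<open>M_inf\<close>.\<close>

lemma P_comp:
  assumes \<sigma>: "\<sigma> \<in> M_inf" and \<tau>: "\<tau> \<in> tree_aut"
  shows "P (\<sigma> \<circ> \<tau>) x = P \<sigma> [] * P \<tau> x"
proof -
  note \<sigma>' = M_infD(1)[OF \<sigma>]
  have 1: "P \<sigma> [] = (- 1) ^ Par \<sigma> (\<tau> x) + 2 * QQ \<sigma> (\<tau> x @ [Lb]) - 2 * QQ \<sigma> (\<tau> x @ [La])"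
    by (subst M_infD(2)[OF \<sigma>, symmetric, of "\<tau> x"]) (simp add: P_rec)
  from \<tau> show ?thesis
  proof (cases rule: Par_cases[where x = x])
    case id
    then have "P (\<sigma> \<circ> \<tau>) x = (- 1) ^ Par \<sigma> (\<tau> x) + 2 * (QQ \<sigma> (\<tau> x @ [Lb]) + P \<sigma> [] * QQ \<tau> (x @ [Lb]))
        - 2 * (QQ \<sigma> (\<tau> x @ [La]) + P \<sigma> [] * QQ \<tau> (x @ [La]))"
      by (simp add: P_rec[of _ x] Par_comp[OF \<sigma>' \<tau>] QQ_comp[OF assms])
    also have "\<dots> = P \<sigma> [] * (1 + 2 * QQ \<tau> (x @ [Lb]) - 2 * QQ \<tau> (x @ [La]))"
      using 1 by (simp add: algebra_simps)
    finally show ?thesis using id by (simp add: P_rec[of _ x])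
  next
    case flip
    have 2: "(- 1) ^ (1 - Par \<sigma> (\<tau> x)) = (- ((- 1) ^ Par \<sigma> (\<tau> x)) :: zint2)"
      using \<sigma>' by (cases rule: Par_cases[where x = "\<tau> x"]) auto
    have "P (\<sigma> \<circ> \<tau>) x = - ((- 1) ^ Par \<sigma> (\<tau> x)) + 2 * (QQ \<sigma> (\<tau> x @ [La]) + P \<sigma> [] * QQ \<tau> (x @ [Lb]))
        - 2 * (QQ \<sigma> (\<tau> x @ [Lb]) + P \<sigma> [] * QQ \<tau> (x @ [La]))"
      using flip 2 by (simp add: P_rec[of _ x] Par_comp[OF \<sigma>' \<tau>] QQ_comp[OF assms])
    also have "\<dots> = P \<sigma> [] * (- 1 + 2 * QQ \<tau> (x @ [Lb]) - 2 * QQ \<tau> (x @ [La]))"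
      using 1 by (simp add: algebra_simps)
    finally show ?thesis using flip by (simp add: P_rec[of _ x])
  qed
qed

lemma Par_id [simp]: "Par id x = 0" by (simp add: Par_def)

lemma Q_id [simp]: "Q id x = 0"
  by (simp add: Q_def)

lemma P_id [simp]: "P id x = 1"
  by (simp add: P_def)

lemma QQ_id [simp]: "QQ id x = 0"
  by (simp add: QQ_def)

lemma M_inf_id: "id \<in> M_inf"
  by (simp add: M_inf_def tree_aut_id)

lemma M_inf_comp: "\<sigma> \<in> M_inf \<Longrightarrow> \<tau> \<in> M_inf \<Longrightarrow> \<sigma> \<circ> \<tau> \<in> M_inf"
proof -
  assume \<sigma>: "\<sigma> \<in> M_inf" and \<tau>: "\<tau> \<in> M_inf"
  have "P (\<sigma> \<circ> \<tau>) x = P (\<sigma> \<circ> \<tau>) []" for x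
    by (simp only: P_comp[OF \<sigma> M_infD(1)[OF \<tau>]] M_infD(2)[OF \<tau>, of x])
  then show ?thesis
    using tree_aut_comp[OF M_infD(1)[OF \<sigma>] M_infD(1)[OF \<tau>]] by (auto simp: M_inf_def)
qed

lemma M_inf_inv:
  assumes "\<sigma> \<in> M_inf"
  shows "tinv \<sigma> \<in> M_inf"
proof -
  note \<sigma> = M_infD(1)[OF assms]
  have u: "P \<sigma> [] * P (tinv \<sigma>) x = 1" for x
    using P_comp[OF assms tree_aut_inv[OF \<sigma>], of x] tree_aut_inv_comp[OF \<sigma>] by simp
  have "P (tinv \<sigma>) x = P (tinv \<sigma>) []" for x
  proof -
    have "P (tinv \<sigma>) x = (P \<sigma> [] * P (tinv \<sigma>) []) * P (tinv \<sigma>) x" by (simp only: u mult_1)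
    also have "\<dots> = (P \<sigma> [] * P (tinv \<sigma>) x) * P (tinv \<sigma>) []" by (simp only: ac_simps)
    finally show ?thesis by (simp only: u mult_1)
  qed
  then show ?thesis using tree_aut_inv[OF \<sigma>] by (simp add: M_inf_def)
qed

subsection \<open>Passing to subtrees\<close>

lemma Par_br:
  "Par (br sw s t) (La # x) = Par s x" "Par (br sw s t) (Lb # x) = Par t x"
  by (simp_all add: Par_def)

lemma Par_br_Nil:
  assumes "s \<in> tree_aut" "t \<in> tree_aut"
  shows "Par (br sw s t) [] = of_bool sw"
  using tree_autD(2)[OF assms(1)] tree_autD(2)[OF assms(2)] by (simp add: Par_def)

lemma Q_br:
  "Q (br sw s t) (La # x) = Q s x" "Q (br sw s t) (Lb # x) = Q t x"
  by (simp_all add: Q_def Par_br)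

lemma P_br:
  "P (br sw s t) (La # x) = P s x" "P (br sw s t) (Lb # x) = P t x"
  by (simp_all add: P_def Par_br Q_br)

lemma QQ_br:
  "QQ (br sw s t) (La # x) = QQ s x" "QQ (br sw s t) (Lb # x) = QQ t x"
  by (simp_all add: QQ_def Q_br)

lemma br_Nil:
  assumes "s \<in> tree_aut" "t \<in> tree_aut"
  shows "P (br sw s t) [] = (- 1) ^ of_bool sw + 2 * QQ t [] - 2 * QQ s []"
    and "Q (br sw s t) [] = of_bool sw + 2 * QQ s []"
    and "QQ (br sw s t) [] = Q s [] + Q t []"
  by (simp add: P_rec Par_br_Nil[OF assms] QQ_br)
    (simp add: Q_rec[of _ "[]"] Par_br_Nil[OF assms] QQ_br, simp add: QQ_def Q_br)

lemma br_in_M_inf_iff: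
  assumes "s \<in> tree_aut" "t \<in> tree_aut"
  shows "br sw s t \<in> M_inf \<longleftrightarrow>
    s \<in> M_inf \<and> t \<in> M_inf \<and> P s [] = P (br sw s t) [] \<and> P t [] = P (br sw s t) []"
proof
  assume M: "br sw s t \<in> M_inf"
  have "P s x = P (br sw s t) []" "P t x = P (br sw s t) []" for x
    using M_infD(2)[OF M, of "La # x"] M_infD(2)[OF M, of "Lb # x"] by (simp_all add: P_br)
  then show "s \<in> M_inf \<and> t \<in> M_inf \<and> P s [] = P (br sw s t) [] \<and> P t [] = P (br sw s t) []"
    using assms by (simp add: M_inf_def)
next
  assume R: "s \<in> M_inf \<and> t \<in> M_inf \<and> P s [] = P (br sw s t) [] \<and> P t [] = P (br sw s t) []"
  have "P (br sw s t) x = P (br sw s t) []" for x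
  proof (cases x rule: node_cases)
    case (La v)
    then show ?thesis using R M_infD(2)[of s v] by (simp add: P_br)
  next
    case (Lb v)
    then show ?thesis using R M_infD(2)[of t v] by (simp add: P_br)
  qed simp
  then show "br sw s t \<in> M_inf"
    using br_tree_aut[OF assms] by (simp add: M_inf_def)
qed

section \<open>The kernel of \<open>P\<close>: explicit elements and generation by
  commutators\<close>

section \<open>The kernel of \<open>P\<close> and two of its subgroups\<close>

definition B_inf :: "(node \<Rightarrow> node) set" where
  "B_inf = {\<sigma> \<in> M_inf. P \<sigma> [] = 1}"

text \<open>On \<open>B_inf\<close> both \<open>QQ _ []\<close> and \<open>Q _ []\<close> are
  additive. The same set also arises as the set of right subtree actions of those elements of
  \<open>B_inf\<close> that fix the two children of the root and act trivially on the left
  subtree.\<close>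

definition N_inf :: "(node \<Rightarrow> node) set" where
  "N_inf = {\<sigma> \<in> B_inf. QQ \<sigma> [] = 0}"

definition L_inf :: "(node \<Rightarrow> node) set" where
  "L_inf = {\<sigma> \<in> N_inf. Q \<sigma> [] = 0}"

lemma B_infD:
  assumes "\<sigma> \<in> B_inf" shows "\<sigma> \<in> M_inf" "\<sigma> \<in> tree_aut" "P \<sigma> [] = 1"
  using assms M_infD by (auto simp: B_inf_def)

lemma N_infD:
  assumes "\<sigma> \<in> N_inf" shows "\<sigma> \<in> B_inf" "QQ \<sigma> [] = 0"
  using assms by (auto simp: N_inf_def)

lemma B_comp: "\<sigma> \<in> B_inf \<Longrightarrow> \<tau> \<in> B_inf \<Longrightarrow> \<sigma> \<circ> \<tau> \<in> B_inf"
  using P_comp[of \<sigma> \<tau> "[]"] by (auto simp: B_inf_def M_inf_comp dest: M_infD)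

lemma B_id: "id \<in> B_inf" by (simp add: B_inf_def M_inf_id)

lemma B_Q_comp:
  assumes "\<sigma> \<in> B_inf" "\<tau> \<in> B_inf"
  shows "Q (\<sigma> \<circ> \<tau>) [] = Q \<sigma> [] + Q \<tau> []" "QQ (\<sigma> \<circ> \<tau>) [] = QQ \<sigma> [] + QQ \<tau> []"
  using Q_comp[OF B_infD(1)[OF assms(1)] B_infD(2)[OF assms(2)], of "[]"]
    QQ_comp[OF B_infD(1)[OF assms(1)] B_infD(2)[OF assms(2)], of "[]"]
    B_infD(3)[OF assms(1)] tree_autD(2)[OF B_infD(2)[OF assms(2)]]
  by simp_all

lemma B_inv:
  assumes "\<sigma> \<in> B_inf"
  shows "tinv \<sigma> \<in> B_inf"
  using P_comp[OF B_infD(1)[OF assms] tree_aut_inv[OF B_infD(2)[OF assms]], of "[]"]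
    tree_aut_inv_comp[OF B_infD(2)[OF assms]] B_infD[OF assms] M_inf_inv
  by (simp add: B_inf_def)

lemma B_Q_inv:
  assumes "\<sigma> \<in> B_inf"
  shows "Q (tinv \<sigma>) [] = - Q \<sigma> []" "QQ (tinv \<sigma>) [] = - QQ \<sigma> []"
  using B_Q_comp[OF assms B_inv[OF assms]] tree_aut_inv_comp[OF B_infD(2)[OF assms]]
  by (simp_all add: eq_neg_iff_add_eq_0 add.commute)

lemma N_comp: "\<sigma> \<in> N_inf \<Longrightarrow> \<tau> \<in> N_inf \<Longrightarrow> \<sigma> \<circ> \<tau> \<in> N_inf"
  by (simp add: N_inf_def B_comp B_Q_comp)

lemma N_inv: "\<sigma> \<in> N_inf \<Longrightarrow> tinv \<sigma> \<in> N_inf"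
  by (simp add: N_inf_def B_inv B_Q_inv)

lemma br_in_B_iff:
  assumes "s \<in> tree_aut" "t \<in> tree_aut"
  shows "br sw s t \<in> B_inf \<longleftrightarrow> s \<in> B_inf \<and> t \<in> B_inf \<and> QQ t [] = QQ s [] + of_bool sw"
proof -
  have "P (br sw s t) [] = 1 \<longleftrightarrow> 2 * QQ t [] = 2 * (QQ s [] + of_bool sw)"
    by (simp add: br_Nil[OF assms] algebra_simps)
  also have "\<dots> \<longleftrightarrow> QQ t [] = QQ s [] + of_bool sw"
    by (rule zint2_double_cancel)
  finally show ?thesis
    using br_in_M_inf_iff[OF assms, of sw] by (auto simp: B_inf_def)
qed

lemma br_in_N_iff:
  assumes "s \<in> tree_aut" "t \<in> tree_aut"
  shows "br sw s t \<in> N_inf \<longleftrightarrow>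
    s \<in> B_inf \<and> t \<in> B_inf \<and> QQ t [] = QQ s [] + of_bool sw \<and> Q s [] + Q t [] = 0"
  using br_in_B_iff[OF assms] br_Nil(3)[OF assms] by (auto simp: N_inf_def)

section \<open>Explicit elements\<close>

text \<open>These are the powers with exponent \<open>z\<close> of the automorphisms \<open>a = br True id b\<close> and
  \<open>b = br False id a\<close>, which are the standard generators of the geometric monodromy group.\<close>

fun alpha beta :: "zint2 \<Rightarrow> node \<Rightarrow> node" where
  "alpha z [] = []"
| "alpha z (La # w) = (if zodd z then Lb else La) # beta (zhalf z) w"
| "alpha z (Lb # w) = (if zodd z then La else Lb) # beta (zhalf z + of_bool (zodd z)) w"
| "beta z [] = []"
| "beta z (La # w) = La # w"
| "beta z (Lb # w) = Lb # alpha z w"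

lemma alpha_br: "alpha z = br (zodd z) (beta (zhalf z)) (beta (zhalf z + of_bool (zodd z)))"
proof
  fix w show "alpha z w = br (zodd z) (beta (zhalf z)) (beta (zhalf z + of_bool (zodd z))) w"
    by (cases w rule: node_cases) auto
qed

lemma beta_br: "beta z = br False id (alpha z)"
proof
  fix w show "beta z w = br False id (alpha z) w"
    by (cases w rule: node_cases) auto
qed

lemma alpha_beta_minus: "alpha (- z) (alpha z w) = w \<and> beta (- z) (beta z w) = w"
proof (induction "length w" arbitrary: z w)
  case 0
  then show ?case by simp
next
  case (Suc n)
  have IH: "alpha (- z) (alpha z v) = v" "beta (- z) (beta z v) = v" if "length v = n" for z v
    using Suc.hyps(1) that by auto
  have A: "alpha (- z) (alpha z w) = w"
  proof (cases z rule: zint2_parity_cases)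
    case (even h)
    have mz: "- z = 2 * (- h)" using even by simp
    have "\<not> zodd (- z)" "zhalf (- z) = - h"
      unfolding mz by (rule zodd_double zhalf_double)+
    moreover have "\<not> zodd z" "zhalf z = h"
      unfolding even by (rule zodd_double zhalf_double)+
    ultimately show ?thesis
      using Suc.hyps(2) IH by (cases w rule: node_cases) auto
  next
    case (odd h)
    \<comment> \<open>The half of \<open>- (1 + 2 * h)\<close> is \<open>- (h + 1)\<close>. The
      exchange of the subtrees makes it meet the exponent \<open>h + 1\<close>, and makes
      \<open>- h\<close> meet \<open>h\<close>.\<close>
    have mz: "- z = 1 + 2 * (- (h + 1))" using odd by (simp add: algebra_simps)
    have *: "zodd (- z)" "zhalf (- z) = - (h + 1)"
      unfolding mz by (rule zodd_1_double zhalf_1_double)+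
    have **: "zodd z" "zhalf z = h"
      unfolding odd by (rule zodd_1_double zhalf_1_double)+
    have "beta (- (h + 1)) (beta (h + 1) v) = v" "beta (- (h + 1) + 1) (beta h v) = v" if "length v = n" for v
      using IH(2)[OF that, of "h + 1"] IH(2)[OF that, of h] by (simp_all add: algebra_simps)
    then show ?thesis
      using Suc.hyps(2) by (cases w rule: node_cases) (auto simp: * ** simp del: minus_add_distrib)
  qed
  moreover have "beta (- z) (beta z w) = w"
    using Suc.hyps(2) IH(1) by (cases w rule: node_cases) auto
  ultimately show ?case ..
qed

lemma alpha_beta_snoc:
  "\<exists>s'. alpha z (w @ [s]) = alpha z w @ [s']" "\<exists>s'. beta z (w @ [s]) = beta z w @ [s']"
proof -
  have "(\<exists>s'. alpha z (w @ [s]) = alpha z w @ [s']) \<and> (\<exists>s'. beta z (w @ [s]) = beta z w @ [s'])"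
  proof (induction w arbitrary: z)
    case Nil
    then show ?case by (cases s) auto
  next
    case (Cons c w)
    then show ?case by (cases c) simp_all
  qed
  then show "\<exists>s'. alpha z (w @ [s]) = alpha z w @ [s']" "\<exists>s'. beta z (w @ [s]) = beta z w @ [s']"
    by blast+
qed

lemma alpha_beta_tree_aut: "alpha z \<in> tree_aut" "beta z \<in> tree_aut"
proof -
  have "bij (alpha z)"
    by (rule o_bij[of "alpha (- z)"])
      (use alpha_beta_minus[of z] alpha_beta_minus[of "- z"] in \<open>auto simp: fun_eq_iff\<close>)
  then show "alpha z \<in> tree_aut" by (rule tree_autI) (simp, rule alpha_beta_snoc)
  have "bij (beta z)"
    by (rule o_bij[of "beta (- z)"])
      (use alpha_beta_minus[of z] alpha_beta_minus[of "- z"] in \<open>auto simp: fun_eq_iff\<close>)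
  then show "beta z \<in> tree_aut" by (rule tree_autI) (simp, rule alpha_beta_snoc)
qed

lemma QQ_beta_eq: "QQ (beta z) [] = Q (alpha z) []"
  unfolding beta_br by (simp add: br_Nil tree_aut_id alpha_beta_tree_aut)

text \<open>The recursion of \<open>alpha\<close> reproduces the binary expansion of
  \<open>z\<close>. Together with \<open>QQ_alpha\<close>, \<open>Q_beta\<close> and
  \<open>QQ_beta\<close> this shows that \<open>alpha z\<close> and \<open>beta z\<close> realise
  the pairs (z, 0) and (0, z) as values of \<open>Q\<close> and \<open>QQ\<close> at the
  root.\<close>

lemma Q_alpha: "Q (alpha z) [] = z"
proof -
  define D where "D z = Q (alpha z) [] - z" for z
  have rec: "D z = 2 * D (zhalf z)" for z
  proof -
    have "Q (alpha z) [] = of_bool (zodd z) + 2 * Q (alpha (zhalf z)) []"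
      by (subst alpha_br) (simp add: br_Nil alpha_beta_tree_aut QQ_beta_eq)
    moreover have "z = of_bool (zodd z) + 2 * zhalf z" by (rule zhalf_eq[symmetric])
    ultimately have "D z = (of_bool (zodd z) + 2 * Q (alpha (zhalf z)) []) - (of_bool (zodd z) + 2 * zhalf z)"
      unfolding D_def by simp
    then show ?thesis by (simp add: D_def algebra_simps)
  qed
  have "2 ^ Suc n dvd D z" if "\<And>y. 2 ^ n dvd D y" for n z
    unfolding rec[of z] power_Suc by (intro mult_dvd_mono dvd_refl that)
  then have "D z = 0" by (rule zint2_coinduct)
  then show ?thesis by (simp add: D_def)
qed

lemma QQ_beta: "QQ (beta z) [] = z"
  by (simp add: QQ_beta_eq Q_alpha)

lemma Q_beta: "Q (beta z) [] = 0"
  unfolding beta_br by (simp add: br_Nil tree_aut_id alpha_beta_tree_aut)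

lemma QQ_alpha: "QQ (alpha z) [] = 0"
  unfolding alpha_br by (simp add: br_Nil alpha_beta_tree_aut Q_beta)

lemma P_beta_Nil: "P (beta z) [] = 1"
  unfolding beta_br by (simp add: br_Nil tree_aut_id alpha_beta_tree_aut QQ_alpha)

lemma P_alpha_Nil: "P (alpha z) [] = 1"
  unfolding alpha_br by (simp add: br_Nil alpha_beta_tree_aut QQ_beta)

lemma P_alpha_beta: "P (alpha z) x = 1 \<and> P (beta z) x = 1"
proof (induction x arbitrary: z)
  case (Cons c x)
  then have "P (alpha z) (c # x) = 1"
    by (subst alpha_br, cases c) (simp_all only: P_br)
  moreover have "P (beta z) (c # x) = 1"
    using Cons by (subst beta_br, cases c) (simp_all only: P_br P_id)
  ultimately show ?case ..
qed (simp add: P_alpha_Nil P_beta_Nil)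

lemma alpha_beta_B: "alpha z \<in> B_inf" "beta z \<in> B_inf"
  by (simp_all add: B_inf_def M_inf_def P_alpha_beta alpha_beta_tree_aut)

text \<open>Each application of \<open>alpha\<close> halves the exponent and goes down one level.
  The elements \<open>beta (2 ^ n * z)\<close> thus change the value of \<open>QQ\<close> by
  \<open>2 ^ n * z\<close> while being invisible up to level \<open>n\<close>.\<close>

lemma alpha_beta_trivial:
  "length w \<le> n \<Longrightarrow> alpha (2 ^ n * z) w = w \<and> beta (2 ^ n * z) w = w"
proof (induction w arbitrary: n z)
  case (Cons c w)
  then obtain m where n: "n = Suc m" "length w \<le> m" by (cases n) auto
  have *: "2 ^ n * z = 2 * (2 ^ m * z)" using n by (simp add: mult.assoc)
  have "zodd (2 ^ n * z) = False" "zhalf (2 ^ n * z) = 2 ^ m * z"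
    unfolding * by simp_all
  moreover have "beta (2 ^ m * z) w = w" using Cons.IH[OF n(2)] by blast
  moreover have "alpha (2 ^ n * z) w = w"
    using Cons.IH[of n z] n by simp
  ultimately show ?case by (cases c) simp_all
qed simp

section \<open>Subgroups of the automorphism group of the tree\<close>

text \<open>The congruence subgroups, a basis of neighbourhoods of the identity; a subgroup that
  contains one of them is open.\<close>

definition K_lev :: "nat \<Rightarrow> (node \<Rightarrow> node) set" where
  "K_lev n = {\<sigma> \<in> tree_aut. \<forall>w. length w \<le> n \<longrightarrow> \<sigma> w = w}"

definition tsub :: "(node \<Rightarrow> node) set \<Rightarrow> bool" where
  "tsub H \<longleftrightarrow> H \<subseteq> tree_aut \<and> id \<in> H \<and> (\<forall>\<sigma>\<in>H. \<forall>\<tau>\<in>H. \<sigma> \<circ> \<tau> \<in> H) \<and> (\<forall>\<sigma>\<in>H. tinv \<sigma> \<in> H)"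

lemma tsubD:
  assumes "tsub H"
  shows "\<sigma> \<in> H \<Longrightarrow> \<sigma> \<in> tree_aut" "id \<in> H" "\<sigma> \<in> H \<Longrightarrow> \<tau> \<in> H \<Longrightarrow> \<sigma> \<circ> \<tau> \<in> H" "\<sigma> \<in> H \<Longrightarrow> tinv \<sigma> \<in> H"
  using assms by (auto simp: tsub_def)

lemma tsub_funpow:
  assumes "tsub H" "\<sigma> \<in> H" shows "\<sigma> ^^ k \<in> H"
  by (induction k) (simp_all only: funpow.simps tsubD(2,3)[OF assms(1)] assms)

lemma K_lev_Suc: "K_lev (Suc n) \<subseteq> K_lev n"
  by (auto simp: K_lev_def)

lemma K_lev_comp: "\<sigma> \<in> K_lev n \<Longrightarrow> \<tau> \<in> K_lev n \<Longrightarrow> \<sigma> \<circ> \<tau> \<in> K_lev n"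
  by (auto simp: K_lev_def tree_aut_comp)

lemma K_lev_inv: "\<sigma> \<in> K_lev n \<Longrightarrow> tinv \<sigma> \<in> K_lev n"
  using tree_aut_inv tree_aut_inv_comp(4) by (auto simp: K_lev_def) metis

lemma K_lev_conj:
  assumes "\<sigma> \<in> K_lev n" "\<tau> \<in> tree_aut"
  shows "\<tau> \<circ> \<sigma> \<circ> tinv \<tau> \<in> K_lev n"
  using assms tree_aut_length[OF tree_aut_inv[OF assms(2)]]
  by (auto simp: K_lev_def tree_aut_comp tree_aut_inv tree_aut_inv_comp)

lemma br_K_lev:
  assumes "s \<in> K_lev n" "t \<in> K_lev n"
  shows "br False s t \<in> K_lev (Suc n)"
proof -
  have "br False s t w = w" if "length w \<le> Suc n" for w
    using that assms by (cases w rule: node_cases) (auto simp: K_lev_def)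
  then show ?thesis using assms by (auto simp: K_lev_def br_tree_aut)
qed

lemma K_lev_id: "id \<in> K_lev n"
  by (simp add: K_lev_def tree_aut_id)

lemma beta_K_lev: "beta (2 ^ n * z) \<in> K_lev n"
  using alpha_beta_trivial by (auto simp: K_lev_def alpha_beta_tree_aut)

lemma B_funpow:
  assumes "\<sigma> \<in> B_inf"
  shows "\<sigma> ^^ k \<in> B_inf" "QQ (\<sigma> ^^ k) [] = of_nat k * QQ \<sigma> []" "Q (\<sigma> ^^ k) [] = of_nat k * Q \<sigma> []"
proof -
  show *: "\<sigma> ^^ k \<in> B_inf" for k
    by (induction k) (simp_all only: funpow.simps B_id B_comp assms)
  show "QQ (\<sigma> ^^ k) [] = of_nat k * QQ \<sigma> []" "Q (\<sigma> ^^ k) [] = of_nat k * Q \<sigma> []"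
    by (induction k)
      (simp_all only: funpow.simps B_Q_comp[OF assms *] QQ_id Q_id of_nat_0 of_nat_Suc mult_zero_left distrib_right mult_1)
qed

lemma br_funpow: "br False s t ^^ k = br False (s ^^ k) (t ^^ k)"
  by (induction k) (simp_all only: funpow.simps br_id br_comp simp_thms if_False)

text \<open>Passing from \<open>H\<close> to this subgroup lowers the level: if \<open>H\<close>
  contains \<open>K_lev (Suc n)\<close>, it contains \<open>K_lev n\<close>.\<close>

definition right_part :: "(node \<Rightarrow> node) set \<Rightarrow> (node \<Rightarrow> node) set" where
  "right_part H = {z \<in> tree_aut. br False id z \<in> H}"

lemma tsub_right_part:
  assumes "tsub H"
  shows "tsub (right_part H)"
proof -
  have "br False id (\<sigma> \<circ> \<tau>) \<in> H" if "br False id \<sigma> \<in> H" "br False id \<tau> \<in> H" for \<sigma> \<tau>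
    using tsubD(3)[OF assms that] by (simp add: br_comp)
  moreover have "br False id (tinv \<sigma>) \<in> H" if "\<sigma> \<in> tree_aut" "br False id \<sigma> \<in> H" for \<sigma>
    using tsubD(4)[OF assms that(2)] by (simp add: inv_br tree_aut_id that)
  ultimately show ?thesis
    using tsubD(2)[OF assms]
    by (auto simp: tsub_def right_part_def tree_aut_comp tree_aut_inv tree_aut_id br_id)
qed

lemma K_lev_right_part: "K_lev (Suc n) \<subseteq> H \<Longrightarrow> K_lev n \<subseteq> right_part H"
  using br_K_lev[OF K_lev_id] by (auto simp: right_part_def) (auto simp: K_lev_def)

lemma tinv_tinv: "\<sigma> \<in> tree_aut \<Longrightarrow> tinv (tinv \<sigma>) = \<sigma>"
  by (simp add: inv_inv_eq tree_autD(1))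

lemma tinv_commutator:
  assumes "x \<in> tree_aut" "y \<in> tree_aut"
  shows "tinv (x \<circ> y \<circ> tinv x \<circ> tinv y) = y \<circ> x \<circ> tinv y \<circ> tinv x"
  by (rule inv_unique_comp) (auto simp: fun_eq_iff tree_aut_inv_comp(3,4) assms)

text \<open>An open subgroup containing the commutators of \<open>N_inf\<close> with
  \<open>B_inf\<close> contains the common kernel of \<open>Q\<close> and \<open>QQ\<close>. For
  \<open>br sw s t\<close> in \<open>L_inf\<close>, the equation \<open>Q = 0\<close> forces
  \<open>sw\<close> to be false and \<open>QQ s [] = 0\<close>. The commutator of
  \<open>br False s id\<close> with the standard generator \<open>a\<close> is
  \<open>br False s (tinv s)\<close>, and the remaining factor acts on the right subtree alone, by
  \<open>t \<circ> s\<close>, which lies again in \<open>L_inf\<close>.\<close>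

lemma L_inf_subset:
  assumes "tsub H" "K_lev n \<subseteq> H"
    and "\<And>x y. x \<in> N_inf \<Longrightarrow> y \<in> B_inf \<Longrightarrow> y \<circ> x \<circ> tinv y \<circ> tinv x \<in> H"
  shows "L_inf \<subseteq> H"
  using assms
proof (induction n arbitrary: H)
  case 0
  have "L_inf \<subseteq> K_lev 0"
    using tree_autD(2) by (auto simp: K_lev_def L_inf_def N_inf_def dest: B_infD)
  then show ?case using 0 by blast
next
  case (Suc n)
  let ?Y = "right_part H"
  have "L_inf \<subseteq> ?Y"
  proof (rule Suc.IH)
    show tsub: "tsub ?Y" by (rule tsub_right_part) fact
    show "K_lev n \<subseteq> ?Y" by (rule K_lev_right_part) fact
    fix x y assume x: "x \<in> N_inf" and y: "y \<in> B_inf"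
    note x' = N_infD[OF x] B_infD[OF N_infD(1)[OF x]] and y' = B_infD[OF y]
    \<comment> \<open>The left entry has the same \<open>QQ\<close> and the opposite
      \<open>Q\<close>, which puts \<open>br False y2 y\<close> into \<open>N_inf\<close>. It
      disappears from the commutator with \<open>br False id x\<close>, which is trivial on the
      left.\<close>
    define y2 where "y2 = beta (QQ y []) \<circ> alpha (- Q y [])"
    have y2: "y2 \<in> B_inf" "QQ y2 [] = QQ y []" "Q y2 [] = - Q y []"
      by (simp_all add: y2_def B_comp alpha_beta_B B_Q_comp QQ_beta Q_beta QQ_alpha Q_alpha)
    note y2' = B_infD[OF y2(1)]
    have "br False y2 y \<in> N_inf"
      using br_in_N_iff[OF y2'(2) y'(2)] y y2 by simp
    moreover have "br False id x \<in> B_inf"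
      using br_in_B_iff[OF tree_aut_id x'(4)] x' B_id by simp
    ultimately have "br False id x \<circ> br False y2 y \<circ> tinv (br False id x) \<circ> tinv (br False y2 y) \<in> H"
      by (rule Suc.prems(3))
    also have "br False id x \<circ> br False y2 y \<circ> tinv (br False id x) \<circ> tinv (br False y2 y)
        = br False id (x \<circ> y \<circ> tinv x \<circ> tinv y)"
      by (simp add: inv_br tree_aut_id x' y' y2' br_comp tree_aut_inv_comp comp_assoc)
    finally have "x \<circ> y \<circ> tinv x \<circ> tinv y \<in> ?Y"
      by (simp add: right_part_def tree_aut_comp tree_aut_inv x' y')
    from tsubD(4)[OF tsub this] show "y \<circ> x \<circ> tinv y \<circ> tinv x \<in> ?Y"
      by (simp add: tinv_commutator x' y')
  qed
  show ?case
  proof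
    fix \<sigma> assume \<sigma>: "\<sigma> \<in> L_inf"
    then have \<sigma>': "\<sigma> \<in> N_inf" "Q \<sigma> [] = 0" by (auto simp: L_inf_def)
    obtain sw s t where st: "s \<in> tree_aut" "t \<in> tree_aut" "\<sigma> = br sw s t"
      using B_infD(2)[OF N_infD(1)[OF \<sigma>'(1)]] by (rule tree_aut_br)
    have Q0: "of_bool sw + 2 * QQ s [] = 0"
      using \<sigma>'(2) st by (simp add: br_Nil)
    have sw: "\<not> sw"
      using Q0 zint2_not_even_odd[of 0 "QQ s []"] by (cases sw) auto
    then have "2 * QQ s [] = 2 * 0" using Q0 by simp
    then have s0: "QQ s [] = 0" by (simp only: zint2_double_cancel)
    have N: "s \<in> B_inf" "t \<in> B_inf" "QQ t [] = QQ s []" "Q s [] + Q t [] = 0"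
      using \<sigma>'(1) br_in_N_iff[OF st(1,2), of sw] sw by (auto simp: st(3))
    have sN: "s \<in> N_inf" using N s0 by (simp add: N_inf_def)
    define a where "a = alpha 1"
    have "zodd 1" "zhalf 1 = 0" using zodd_1_double[of 0] zhalf_1_double[of 0] by simp_all
    moreover have "beta 0 = id"
      using alpha_beta_trivial[of _ _ 0] by (auto simp: fun_eq_iff)
    ultimately have a: "a = br True id (beta 1)"
      unfolding a_def by (subst alpha_br) simp
    have "a \<in> N_inf" by (simp add: a_def N_inf_def alpha_beta_B QQ_alpha)
    moreover have "br False s id \<in> B_inf"
      using br_in_B_iff[OF st(1) tree_aut_id] N s0 B_id by simp
    ultimately have "br False s id \<circ> a \<circ> tinv (br False s id) \<circ> tinv a \<in> H"
      by (rule Suc.prems(3))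
    also have "br False s id \<circ> a \<circ> tinv (br False s id) \<circ> tinv a = br False s (tinv s)"
      by (simp add: a inv_br st tree_aut_id alpha_beta_tree_aut br_comp comp_assoc tree_aut_inv_comp)
    finally have 1: "br False s (tinv s) \<in> H" .
    have "t \<circ> s \<in> L_inf"
      using N s0 by (simp add: L_inf_def N_inf_def B_comp B_Q_comp add.commute)
    then have "br False id (t \<circ> s) \<in> H"
      using \<open>L_inf \<subseteq> ?Y\<close> by (auto simp: right_part_def)
    from tsubD(3)[OF Suc.prems(1) this 1] show "\<sigma> \<in> H"
      using sw by (simp add: st(3) br_comp comp_assoc tree_aut_inv_comp[OF st(1)])
  qed
qed

text \<open>Write \<open>\<tau> = br True p q\<close>. Modulo commutators, \<open>br False (tinv x) (p \<circ> x \<circ> tinv p) \<in> H\<close> moves \<open>x\<close> from the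
  left subtree to the right one, so that only elements of the right subtree matter. Conjugating
  this element and \<open>\<tau> \<circ> \<tau>\<close>, for which \<open>QQ\<close> is odd on the subtrees, by elements of \<open>B_inf\<close> that act on one
  subtree only provides the commutators needed in \<open>L_inf_subset\<close>.\<close>

lemma N_inf_subset:
  assumes H: "tsub H" and K: "K_lev n \<subseteq> H"
    and normal: "\<And>x y. x \<in> H \<Longrightarrow> y \<in> B_inf \<Longrightarrow> y \<circ> x \<circ> tinv y \<in> H"
    and \<tau>: "\<tau> \<in> H" "\<tau> \<in> N_inf" "Par \<tau> [] \<noteq> 0"
  shows "N_inf \<subseteq> H"
proof -
  have BB: "\<sigma> \<in> tree_aut" if "\<sigma> \<in> B_inf" for \<sigma> using B_infD(2)[OF that] .
  obtain sw p q where pq: "p \<in> tree_aut" "q \<in> tree_aut" and "\<tau> = br sw p q"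
    using BB[OF N_infD(1)[OF \<tau>(2)]] by (rule tree_aut_br)
  then have \<tau>_eq: "\<tau> = br True p q" using \<tau>(3) by (cases sw) (simp_all add: Par_br_Nil)
  have p: "p \<in> B_inf" and q: "q \<in> B_inf" and QQ_q: "QQ q [] = QQ p [] + 1" and Q_pq: "Q p [] + Q q [] = 0"
    using br_in_N_iff[OF pq, of True] \<tau>(2) by (simp_all add: \<tau>_eq)
  let ?Y = "right_part H"
  have Y: "tsub ?Y" by (rule tsub_right_part[OF H])
  have KY: "K_lev n \<subseteq> ?Y" using K K_lev_Suc[of n] by (intro K_lev_right_part) blast
  have YI: "x \<in> ?Y" if "br False id x \<in> H" "x \<in> tree_aut" for x
    using that by (simp add: right_part_def)
  \<comment> \<open>A commutator of \<tau> with an element supported on the left subtree;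
    \<open>QQ x [] = 0\<close> is what puts the latter into \<open>B_inf\<close>, under which
    \<open>H\<close> is invariant.\<close>
  have rel: "br False (tinv x) (p \<circ> x \<circ> tinv p) \<in> H" if x: "x \<in> N_inf" for x
  proof -
    note x' = N_infD[OF x] BB[OF N_infD(1)[OF x]]
    have h: "br False x id \<in> B_inf"
      using br_in_B_iff[OF x'(3) tree_aut_id] x' B_id by simp
    have "\<tau> \<circ> (br False x id \<circ> tinv \<tau> \<circ> tinv (br False x id)) \<in> H"
      by (intro tsubD(3)[OF H] \<tau>(1) normal[OF tsubD(4)[OF H \<tau>(1)] h])
    also have "\<tau> \<circ> (br False x id \<circ> tinv \<tau> \<circ> tinv (br False x id)) = br False (tinv x) (p \<circ> x \<circ> tinv p)"
      using inv_br[OF tree_aut_id tree_aut_id]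
      by (simp add: \<tau>_eq inv_br pq x'(3) tree_aut_id br_comp comp_assoc)
        (simp add: tree_aut_inv_comp[OF pq(2)] flip: comp_assoc)
    finally show ?thesis .
  qed
  have normY: "y \<circ> x \<circ> tinv y \<in> ?Y" if x: "x \<in> ?Y" and y: "y \<in> B_inf" for x y
  proof (rule YI)
    have "br False y y \<in> B_inf" using br_in_B_iff[OF BB[OF y] BB[OF y]] y by simp
    from normal[OF _ this, of "br False id x"] x
    have "br False y y \<circ> br False id x \<circ> tinv (br False y y) \<in> H" by (simp add: right_part_def)
    then show "br False id (y \<circ> x \<circ> tinv y) \<in> H"
      by (simp add: inv_br BB[OF y] br_comp tree_aut_inv_comp[OF BB[OF y]])
    show "y \<circ> x \<circ> tinv y \<in> tree_aut"
      using x BB[OF y] by (simp add: right_part_def tree_aut_comp tree_aut_inv)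
  qed
  \<comment> \<open>The aim is that \<open>C\<close> is all of \<open>B_inf\<close>, which is the
    hypothesis on commutators in \<open>L_inf_subset\<close> for the subgroup
    \<open>?Y\<close>.\<close>
  define C where "C = {y \<in> B_inf. \<forall>x\<in>N_inf. y \<circ> x \<circ> tinv y \<circ> tinv x \<in> ?Y}"
  have C_pair: "y \<in> C" if g: "br False g y \<in> H" "g \<in> tree_aut" and y: "y \<in> B_inf" for g y
    unfolding C_def
  proof (intro CollectI conjI ballI YI)
    fix x assume x: "x \<in> N_inf"
    note x' = N_infD[OF x] BB[OF N_infD(1)[OF x]]
    have h: "br False id x \<in> B_inf"
      using br_in_B_iff[OF tree_aut_id x'(3)] x' B_id by simp
    have "br False g y \<circ> (br False id x \<circ> tinv (br False g y) \<circ> tinv (br False id x)) \<in> H"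
      by (intro tsubD(3)[OF H] g normal[OF tsubD(4)[OF H g(1)] h])
    then show "br False id (y \<circ> x \<circ> tinv y \<circ> tinv x) \<in> H"
      by (simp add: inv_br g BB[OF y] x'(3) tree_aut_id br_comp comp_assoc tree_aut_inv_comp)
    show "y \<circ> x \<circ> tinv y \<circ> tinv x \<in> tree_aut"
      using BB[OF y] x'(3) by (simp add: tree_aut_comp tree_aut_inv)
  qed (fact y)
  have C_comp: "y \<circ> z \<in> C" if yz: "y \<in> C" "z \<in> C" for y z
    unfolding C_def
  proof (intro CollectI conjI ballI)
    have y: "y \<in> B_inf" and z: "z \<in> B_inf" using yz by (auto simp: C_def)
    show "y \<circ> z \<in> B_inf" using y z by (rule B_comp)
    fix x assume x: "x \<in> N_inf"
    \<comment> \<open>The commutator of a product y z with x is the conjugate by y of the commutator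
      of z and x, times the commutator of y and x.\<close>
    have "(y \<circ> (z \<circ> x \<circ> tinv z \<circ> tinv x) \<circ> tinv y) \<circ> (y \<circ> x \<circ> tinv y \<circ> tinv x) \<in> ?Y"
      by (rule tsubD(3)[OF Y normY[OF _ y]]) (use yz x in \<open>simp_all add: C_def\<close>)
    also have "(y \<circ> (z \<circ> x \<circ> tinv z \<circ> tinv x) \<circ> tinv y) \<circ> (y \<circ> x \<circ> tinv y \<circ> tinv x)
        = (y \<circ> z) \<circ> x \<circ> (tinv z \<circ> tinv y) \<circ> tinv x"
      using BB[OF y] BB[OF N_infD(1)[OF x]] by (auto simp: fun_eq_iff tree_aut_inv_comp)
    also have "tinv z \<circ> tinv y = tinv (y \<circ> z)"
      using BB[OF y] BB[OF z] by (simp add: o_inv_distrib tree_autD(1))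
    finally show "(y \<circ> z) \<circ> x \<circ> tinv (y \<circ> z) \<circ> tinv x \<in> ?Y" .
  qed
  have C_N: "y \<in> C" if y: "y \<in> N_inf" for y
  proof -
    define x where "x = tinv p \<circ> y \<circ> p"
    have "x \<in> N_inf"
      using N_infD[OF y] p by (simp add: x_def N_inf_def B_comp B_inv B_Q_comp B_Q_inv)
    from rel[OF this] have "br False (tinv x) (p \<circ> x \<circ> tinv p) \<in> H" .
    also have "p \<circ> x \<circ> tinv p = y"
      using BB[OF p] by (auto simp: x_def fun_eq_iff tree_aut_inv_comp)
    finally have "br False (tinv x) y \<in> H" .
    then show ?thesis
      by (rule C_pair) (intro tree_aut_inv BB N_infD(1) \<open>x \<in> N_inf\<close> y)+
  qed
  have \<tau>2: "br False (q \<circ> p) (p \<circ> q) \<in> H"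
    using tsubD(3)[OF H \<tau>(1) \<tau>(1)] by (simp add: \<tau>_eq br_comp)
  have C_pq: "p \<circ> q \<in> C"
    by (rule C_pair[OF \<tau>2]) (simp_all add: tree_aut_comp pq B_comp p q)
  have C_K: "y \<in> C" if y: "y \<in> K_lev n" "y \<in> B_inf" for y
    unfolding C_def
  proof (intro CollectI conjI ballI)
    fix x assume x: "x \<in> N_inf"
    note x' = BB[OF N_infD(1)[OF x]]
    have "y \<circ> (x \<circ> tinv y \<circ> tinv x) \<in> K_lev n"
      using y x' by (intro K_lev_comp K_lev_conj K_lev_inv)
    then show "y \<circ> x \<circ> tinv y \<circ> tinv x \<in> ?Y" using KY by (auto simp: comp_assoc)
  qed (fact y)
  \<comment> \<open>The right entry of \<open>\<tau> \<circ> \<tau>\<close> is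
    \<open>p \<circ> q\<close>. As its \<open>QQ\<close> is odd, its powers attain all values of
    \<open>QQ\<close> modulo \<open>2 ^ n\<close>; a factor \<open>beta (2 ^ n * z)\<close> corrects
    the value exactly, and what is left lies in \<open>N_inf\<close>.\<close>
  have odd: "zodd (QQ (p \<circ> q) [])"
    unfolding zodd_def by (rule exI[of _ "QQ p []"]) (simp add: B_Q_comp p q QQ_q algebra_simps)
  have pow: "(p \<circ> q) ^^ k \<in> C" for k
  proof (induction k)
    case 0
    have "id \<in> N_inf" by (simp add: N_inf_def B_id)
    then show ?case using C_N by (simp only: funpow.simps)
  next
    case (Suc k)
    then show ?case using C_comp C_pq by (simp only: funpow.simps)
  qed
  have C_B: "y \<in> C" if y: "y \<in> B_inf" for y
  proof -
    obtain k z where kz: "QQ y [] = of_nat k * QQ (p \<circ> q) [] + 2 ^ n * z"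
      using odd_multiple_approx[OF odd] by blast
    let ?m = "(p \<circ> q) ^^ k" and ?b = "beta (2 ^ n * z)"
    have m: "?m \<in> B_inf" "QQ ?m [] = of_nat k * QQ (p \<circ> q) []"
      using B_funpow[OF B_comp[OF p q]] by auto
    define v where "v = tinv ?m \<circ> y \<circ> tinv ?b"
    have "v \<in> N_inf"
      using m y kz
      by (simp add: v_def N_inf_def B_comp B_inv alpha_beta_B B_Q_comp B_Q_inv QQ_beta del: funpow.simps)
    then have "?m \<circ> v \<circ> ?b \<in> C"
      by (intro C_comp pow C_N C_K beta_K_lev alpha_beta_B)
    also have "?m \<circ> v \<circ> ?b = y"
      using BB[OF m(1)] BB[OF alpha_beta_B(2)[of "2 ^ n * z"]]
      by (simp add: v_def fun_eq_iff tree_aut_inv_comp del: funpow.simps)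
    finally show ?thesis .
  qed
  have L: "L_inf \<subseteq> ?Y"
    by (rule L_inf_subset[OF Y KY]) (use C_B in \<open>auto simp: C_def\<close>)
  have main: "br False s t \<in> H" if st: "s \<in> B_inf" "t \<in> B_inf" "QQ t [] = QQ s []" "Q s [] + Q t [] = 0" for s t
  proof -
    obtain k z where kz: "QQ s [] = of_nat k * QQ (p \<circ> q) [] + 2 ^ n * z"
      using odd_multiple_approx[OF odd] by blast
    let ?m1 = "(q \<circ> p) ^^ k" and ?m2 = "(p \<circ> q) ^^ k" and ?b = "beta (2 ^ n * z)"
    have m2: "?m2 \<in> B_inf" "QQ ?m2 [] = of_nat k * QQ (p \<circ> q) []" "Q ?m2 [] = of_nat k * Q (p \<circ> q) []"
      using B_funpow[OF B_comp[OF p q]] by auto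
    have m1: "?m1 \<in> B_inf" "QQ ?m1 [] = of_nat k * QQ (p \<circ> q) []" "Q ?m1 [] = of_nat k * Q (p \<circ> q) []"
      using B_funpow[OF B_comp[OF q p]] by (auto simp: B_Q_comp p q add.commute)
    have Q0: "Q (p \<circ> q) [] = 0" using Q_pq by (simp add: B_Q_comp p q)
    \<comment> \<open>The pair of \<open>?m1\<close> and \<open>?m2\<close> is an even power of
      \<tau>, so it lies in \<open>H\<close>. Dividing by it and by the deep \<open>?b\<close>
      removes \<open>QQ\<close> from both entries at once, and \<open>Q0\<close> ensures that
      \<open>Q\<close> is unchanged.\<close>
    define s' where "s' = tinv ?m1 \<circ> s \<circ> tinv ?b"
    define t' where "t' = tinv ?m2 \<circ> t \<circ> tinv ?b"
    have s': "s' \<in> N_inf" "Q s' [] = Q s []"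
      using m1 st kz Q0
      by (simp_all add: s'_def N_inf_def B_comp B_inv alpha_beta_B B_Q_comp B_Q_inv QQ_beta Q_beta del: funpow.simps)
    have t': "t' \<in> N_inf" "Q t' [] = Q t []"
      using m2 st kz Q0
      by (simp_all add: t'_def N_inf_def B_comp B_inv alpha_beta_B B_Q_comp B_Q_inv QQ_beta Q_beta del: funpow.simps)
    note s'' = N_infD[OF s'(1)] BB[OF N_infD(1)[OF s'(1)]] and t'' = N_infD[OF t'(1)] BB[OF N_infD(1)[OF t'(1)]]
    \<comment> \<open>This is the right entry that \<open>rel\<close> pairs with the left entry
      \<open>s'\<close>. Its \<open>Q\<close> is \<open>- Q s []\<close>, which equals
      \<open>Q t []\<close>, so both invariants of \<open>tinv u \<circ> t'\<close> vanish.\<close>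
    define u where "u = p \<circ> tinv s' \<circ> tinv p"
    have u: "u \<in> N_inf" "Q u [] = - Q s []"
      using p s' s'' by (simp_all add: u_def N_inf_def B_comp B_inv B_Q_comp B_Q_inv)
    note u' = BB[OF N_infD(1)[OF u(1)]]
    have "tinv u \<circ> t' \<in> L_inf"
      using u t' s' st(4) by (simp add: L_inf_def N_comp N_inv N_infD B_inv B_Q_comp B_Q_inv)
    then have 1: "br False id (tinv u \<circ> t') \<in> H" using L by (auto simp: right_part_def)
    have 2: "br False s' u \<in> H"
      using rel[OF N_inv[OF s'(1)]] by (simp add: u_def tinv_tinv s''(3))
    have "br False s' t' \<in> H"
      using tsubD(3)[OF H 2 1] by (simp add: br_comp tree_aut_inv_comp[OF u'] flip: comp_assoc)
    moreover have "br False ?m1 ?m2 \<in> H"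
      using tsub_funpow[OF H \<tau>2, of k] by (simp only: br_funpow)
    moreover have "br False ?b ?b \<in> H"
      using br_K_lev[OF beta_K_lev beta_K_lev] K_lev_Suc K by blast
    ultimately have "br False ?m1 ?m2 \<circ> br False s' t' \<circ> br False ?b ?b \<in> H"
      by (intro tsubD(3)[OF H])
    also have "br False ?m1 ?m2 \<circ> br False s' t' \<circ> br False ?b ?b
        = br False (?m1 \<circ> s' \<circ> ?b) (?m2 \<circ> t' \<circ> ?b)"
      by (simp only: br_comp simp_thms if_False)
    also have "?m1 \<circ> s' \<circ> ?b = s"
      using BB[OF m1(1)] BB[OF alpha_beta_B(2)[of "2 ^ n * z"]]
      by (simp add: s'_def fun_eq_iff tree_aut_inv_comp del: funpow.simps)
    also have "?m2 \<circ> t' \<circ> ?b = t"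
      using BB[OF m2(1)] BB[OF alpha_beta_B(2)[of "2 ^ n * z"]]
      by (simp add: t'_def fun_eq_iff tree_aut_inv_comp del: funpow.simps)
    finally show ?thesis .
  qed
  have main': "\<sigma> \<in> H" if \<sigma>: "\<sigma> \<in> N_inf" "Par \<sigma> [] = 0" for \<sigma>
  proof -
    obtain sw s t where st: "s \<in> tree_aut" "t \<in> tree_aut" "\<sigma> = br sw s t"
      using BB[OF N_infD(1)[OF \<sigma>(1)]] by (rule tree_aut_br)
    then have sw: "sw = False" using \<sigma>(2) by (cases sw) (simp_all add: Par_br_Nil)
    show ?thesis
      using br_in_N_iff[OF st(1,2), of False] \<sigma>(1) main by (simp add: st(3) sw)
  qed
  show ?thesis
  proof
    fix \<sigma> assume \<sigma>: "\<sigma> \<in> N_inf"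
    show "\<sigma> \<in> H"
    proof (cases "Par \<sigma> [] = 0")
      case False
      obtain sw s t where st: "s \<in> tree_aut" "t \<in> tree_aut" "\<sigma> = br sw s t"
        using BB[OF N_infD(1)[OF \<sigma>]] by (rule tree_aut_br)
      then have sw: "sw = True" using False by (cases sw) (simp_all add: Par_br_Nil)
      have "tinv \<tau> \<circ> \<sigma> \<in> N_inf" using \<tau>(2) \<sigma> by (intro N_comp N_inv)
      moreover have "Par (tinv \<tau> \<circ> \<sigma>) [] = 0"
        by (simp add: st(3) sw \<tau>_eq inv_br pq br_comp Par_br_Nil tree_aut_comp tree_aut_inv st(1,2))
      ultimately have "tinv \<tau> \<circ> \<sigma> \<in> H" by (rule main')
      from tsubD(3)[OF H \<tau>(1) this] show ?thesis
        by (simp add: tree_aut_inv_comp[OF BB[OF N_infD(1)[OF \<tau>(2)]]] flip: comp_assoc)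
    qed (rule main'[OF \<sigma>])
  qed
qed

section \<open>Field homomorphisms, their extension and automorphisms\<close>

section \<open>Extension of field homomorphisms\<close>

definition fhom :: "('a :: field \<Rightarrow> 'b :: field) \<Rightarrow> bool" where
  "fhom h \<longleftrightarrow> h 1 = 1 \<and> (\<forall>x y. h (x + y) = h x + h y) \<and> (\<forall>x y. h (x * y) = h x * h y)"

lemma fhomD:
  assumes "fhom h"
  shows "h 1 = 1" "h (x + y) = h x + h y" "h (x * y) = h x * h y" "h 0 = 0" "h (- x) = - h x"
    "h (x - y) = h x - h y" "h (inverse x) = inverse (h x)" "h (x / y) = h x / h y"
    "h (x ^ n) = h x ^ n" "h x = 0 \<longleftrightarrow> x = 0" "h x = h y \<longleftrightarrow> x = y"
proof -
  show 1: "h 1 = 1" and add: "h (x + y) = h x + h y" and mult: "h (x * y) = h x * h y" for x y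
    using assms by (auto simp: fhom_def)
  show 0: "h 0 = 0" using add[of 0 0] by (metis add_cancel_right_right)
  show minus: "h (- x) = - h x" for x
    using add[of x "- x"] 0 by (simp add: eq_neg_iff_add_eq_0 add.commute)
  show diff: "h (x - y) = h x - h y" for x y using add[of x "- y"] minus by simp
  show zero: "h x = 0 \<longleftrightarrow> x = 0" for x
    using mult[of x "inverse x"] 0 1 by (cases "x = 0") auto
  show inverse: "h (inverse x) = inverse (h x)" for x
    using mult[of x "inverse x"] 0 1 by (cases "x = 0") (auto simp: inverse_unique)
  show "h (x / y) = h x / h y" using mult[of x "inverse y"] inverse by (simp add: divide_inverse)
  show "h (x ^ n) = h x ^ n" by (induction n) (simp_all add: 1 mult)
  show "h x = h y \<longleftrightarrow> x = y" using diff[of x y] zero[of "x - y"] by auto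
qed

lemma fhom_poly:
  assumes "fhom h"
  shows "h (poly p x) = poly (map_poly h p) (h x)"
  by (induction p) (simp_all add: fhomD[OF assms] map_poly_pCons)

lemma fhom_comp: "fhom g \<Longrightarrow> fhom h \<Longrightarrow> fhom (g \<circ> h)"
  by (simp add: fhom_def)

definition is_sf :: "'a :: field set \<Rightarrow> bool" where
  "is_sf F \<longleftrightarrow> 0 \<in> F \<and> 1 \<in> F \<and> (\<forall>x\<in>F. \<forall>y\<in>F. x + y \<in> F) \<and> (\<forall>x\<in>F. - x \<in> F) \<and>
    (\<forall>x\<in>F. \<forall>y\<in>F. x * y \<in> F) \<and> (\<forall>x\<in>F. inverse x \<in> F)"

lemma is_sfD:
  assumes "is_sf F"
  shows "0 \<in> F" "1 \<in> F" "x \<in> F \<Longrightarrow> y \<in> F \<Longrightarrow> x + y \<in> F" "x \<in> F \<Longrightarrow> - x \<in> F"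
    "x \<in> F \<Longrightarrow> y \<in> F \<Longrightarrow> x * y \<in> F" "x \<in> F \<Longrightarrow> inverse x \<in> F"
    "x \<in> F \<Longrightarrow> y \<in> F \<Longrightarrow> x - y \<in> F" "x \<in> F \<Longrightarrow> y \<in> F \<Longrightarrow> x / y \<in> F"
    "x \<in> F \<Longrightarrow> x ^ n \<in> F"
proof -
  show A: "0 \<in> F" "1 \<in> F" "\<And>x y. x \<in> F \<Longrightarrow> y \<in> F \<Longrightarrow> x + y \<in> F" "\<And>x. x \<in> F \<Longrightarrow> - x \<in> F"
    "\<And>x y. x \<in> F \<Longrightarrow> y \<in> F \<Longrightarrow> x * y \<in> F" "\<And>x. x \<in> F \<Longrightarrow> inverse x \<in> F"
    using assms by (auto simp: is_sf_def)
  show "x \<in> F \<Longrightarrow> y \<in> F \<Longrightarrow> x - y \<in> F" using A(3)[of x "- y"] A(4) by simp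
  show "x \<in> F \<Longrightarrow> y \<in> F \<Longrightarrow> x / y \<in> F" using A(5)[of x "inverse y"] A(6) by (simp add: divide_inverse)
  show "x \<in> F \<Longrightarrow> x ^ n \<in> F" by (induction n) (auto intro: A)
qed

lemma is_sf_vimage: "fhom h \<Longrightarrow> is_sf F \<Longrightarrow> is_sf {x. h x \<in> F}"
  by (simp add: is_sf_def fhomD)

lemma is_sf_range: "fhom h \<Longrightarrow> is_sf (range h)"
  unfolding is_sf_def by (safe; (rule range_eqI, (rule fhomD(4)[symmetric] fhomD(1)[symmetric] fhomD(2)[symmetric]
    fhomD(5)[symmetric] fhomD(3)[symmetric] fhomD(7)[symmetric])))

lemma is_sf_fixed: "fhom h \<Longrightarrow> is_sf {x. h x = x}"
  by (simp add: is_sf_def fhomD)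

text \<open>Field homomorphisms defined on a subfield are represented by their graphs.\<close>

definition hom_graph :: "('a :: field \<times> 'b :: field) set \<Rightarrow> bool" where
  "hom_graph G \<longleftrightarrow> (0, 0) \<in> G \<and> (1, 1) \<in> G \<and>
    (\<forall>x x' y y'. (x, x') \<in> G \<longrightarrow> (y, y') \<in> G \<longrightarrow> (x + y, x' + y') \<in> G) \<and>
    (\<forall>x x'. (x, x') \<in> G \<longrightarrow> (- x, - x') \<in> G) \<and>
    (\<forall>x x' y y'. (x, x') \<in> G \<longrightarrow> (y, y') \<in> G \<longrightarrow> (x * y, x' * y') \<in> G) \<and>
    (\<forall>x x'. (x, x') \<in> G \<longrightarrow> (inverse x, inverse x') \<in> G) \<and>
    (\<forall>x x' x''. (x, x') \<in> G \<longrightarrow> (x, x'') \<in> G \<longrightarrow> x' = x'')"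

lemma hom_graphI:
  assumes "(0, 0) \<in> G" "(1, 1) \<in> G"
    "\<And>x x' y y'. (x, x') \<in> G \<Longrightarrow> (y, y') \<in> G \<Longrightarrow> (x + y, x' + y') \<in> G"
    "\<And>x x'. (x, x') \<in> G \<Longrightarrow> (- x, - x') \<in> G"
    "\<And>x x' y y'. (x, x') \<in> G \<Longrightarrow> (y, y') \<in> G \<Longrightarrow> (x * y, x' * y') \<in> G"
    "\<And>x x'. (x, x') \<in> G \<Longrightarrow> (inverse x, inverse x') \<in> G"
    "\<And>x x' x''. (x, x') \<in> G \<Longrightarrow> (x, x'') \<in> G \<Longrightarrow> x' = x''"
  shows "hom_graph G"
  using assms unfolding hom_graph_def by simp

lemma hom_graphD:
  assumes "hom_graph G"
  shows "(0, 0) \<in> G" "(1, 1) \<in> G"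
    "(x, x') \<in> G \<Longrightarrow> (y, y') \<in> G \<Longrightarrow> (x + y, x' + y') \<in> G"
    "(x, x') \<in> G \<Longrightarrow> (- x, - x') \<in> G"
    "(x, x') \<in> G \<Longrightarrow> (y, y') \<in> G \<Longrightarrow> (x * y, x' * y') \<in> G"
    "(x, x') \<in> G \<Longrightarrow> (inverse x, inverse x') \<in> G"
    "(x, x') \<in> G \<Longrightarrow> (x, x'') \<in> G \<Longrightarrow> x' = x''"
    "(x, x') \<in> G \<Longrightarrow> (y, y') \<in> G \<Longrightarrow> (x - y, x' - y') \<in> G"
    "(x, x') \<in> G \<Longrightarrow> x = 0 \<longleftrightarrow> x' = 0"
proof -
  show A: "(0, 0) \<in> G" "(1, 1) \<in> G"
    "\<And>x x' y y'. (x, x') \<in> G \<Longrightarrow> (y, y') \<in> G \<Longrightarrow> (x + y, x' + y') \<in> G"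
    "\<And>x x'. (x, x') \<in> G \<Longrightarrow> (- x, - x') \<in> G"
    "\<And>x x' y y'. (x, x') \<in> G \<Longrightarrow> (y, y') \<in> G \<Longrightarrow> (x * y, x' * y') \<in> G"
    "\<And>x x'. (x, x') \<in> G \<Longrightarrow> (inverse x, inverse x') \<in> G"
    "\<And>x x' x''. (x, x') \<in> G \<Longrightarrow> (x, x'') \<in> G \<Longrightarrow> x' = x''"
    using assms unfolding hom_graph_def by simp_all
  show "(x, x') \<in> G \<Longrightarrow> (y, y') \<in> G \<Longrightarrow> (x - y, x' - y') \<in> G"
    using A(3)[of x x' "- y" "- y'"] A(4) by simp
  show "x = 0 \<longleftrightarrow> x' = 0" if x: "(x, x') \<in> G"
  proof
    assume "x = 0" then show "x' = 0" using A(1,7) x by blast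
  next
    assume "x' = 0"
    then have "(inverse x * x, 0) \<in> G" using A(5)[OF A(6)[OF x] x] by simp
    then show "x = 0" using A(7)[OF A(2)] by (cases "x = 0") force+
  qed
qed

text \<open>The image of a polynomial under a homomorphism known only by its graph; a relation,
  because the homomorphism is defined on a subfield only.\<close>

definition PP :: "('a :: field \<times> 'b :: field) set \<Rightarrow> 'a poly \<Rightarrow> 'b poly \<Rightarrow> bool" where
  "PP G p p' \<longleftrightarrow> (\<forall>i. (coeff p i, coeff p' i) \<in> G)"

context
  fixes G :: "('a :: field \<times> 'b :: field) set"
  assumes G: "hom_graph G"
begin

lemma PP_add: "PP G p p' \<Longrightarrow> PP G q q' \<Longrightarrow> PP G (p + q) (p' + q')"
  by (simp add: PP_def hom_graphD[OF G])

lemma PP_minus: "PP G p p' \<Longrightarrow> PP G (- p) (- p')"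
  by (simp add: PP_def hom_graphD[OF G])

lemma PP_diff: "PP G p p' \<Longrightarrow> PP G q q' \<Longrightarrow> PP G (p - q) (p' - q')"
  by (simp add: PP_def hom_graphD[OF G])

lemma hom_graph_sum:
  assumes "finite A" "\<And>i. i \<in> A \<Longrightarrow> (f i, f' i) \<in> G"
  shows "(sum f A, sum f' A) \<in> G"
  using assms by (induction rule: finite_induct) (simp_all add: hom_graphD[OF G])

lemma PP_mult: "PP G p p' \<Longrightarrow> PP G q q' \<Longrightarrow> PP G (p * q) (p' * q')"
  by (auto simp: PP_def coeff_mult intro!: hom_graph_sum hom_graphD(5)[OF G])

lemma PP_monom: "(c, c') \<in> G \<Longrightarrow> PP G (monom c n) (monom c' n)"
  by (simp add: PP_def hom_graphD[OF G])

lemma PP_const: "(c, c') \<in> G \<Longrightarrow> PP G [:c:] [:c':]"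
  using PP_monom[of c c' 0] by (simp add: monom_0)

lemma PP_X: "PP G [:0, 1:] [:0, 1:]"
  using PP_monom[of 1 1 1] by (simp add: hom_graphD[OF G] monom_altdef)

lemma PP_eq_0: "PP G p p' \<Longrightarrow> p = 0 \<longleftrightarrow> p' = 0"
  unfolding PP_def poly_eq_iff using hom_graphD(9)[OF G] by simp metis

lemma PP_degree:
  assumes "PP G p p'" shows "degree p = degree p'"
proof -
  have "coeff p i = 0 \<longleftrightarrow> coeff p' i = 0" for i
    using assms hom_graphD(9)[OF G] by (auto simp: PP_def)
  then show ?thesis by (simp add: degree_def)
qed

text \<open>Division with remainder runs in parallel over both fields, because related coefficients
  vanish simultaneously. The measure places the zero polynomial below the nonzero constants, so that
  subtracting the last leading term still counts as progress.\<close>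

lemma PP_division:
  assumes m: "PP G m m'" "m \<noteq> 0"
  shows "PP G p p' \<Longrightarrow> \<exists>s s' r r'. PP G s s' \<and> PP G r r' \<and> p = s * m + r \<and> p' = s' * m' + r' \<and>
    (r = 0 \<or> degree r < degree m)"
proof (induction "if p = 0 then 0 else Suc (degree p)" arbitrary: p p' rule: less_induct)
  case less
  show ?case
  proof (cases "p = 0 \<or> degree p < degree m")
    case True
    then show ?thesis
      using less.prems hom_graphD(1)[OF G]
      by (intro exI[of _ 0] exI[of _ p] exI[of _ p']) (auto simp: PP_def)
  next
    case False
    let ?k = "degree p - degree m"
    define c where "c = monom (lead_coeff p * inverse (lead_coeff m)) ?k"
    define c' where "c' = monom (lead_coeff p' * inverse (lead_coeff m')) ?k"
    have c: "PP G c c'"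
      unfolding c_def c'_def
    proof (rule PP_monom, intro hom_graphD(5,6)[OF G])
      show "(lead_coeff p, lead_coeff p') \<in> G" "(lead_coeff m, lead_coeff m') \<in> G"
        using less.prems m(1) PP_degree by (metis PP_def)+
    qed
    define p1 where "p1 = p - c * m"
    define p1' where "p1' = p' - c' * m'"
    have P1: "PP G p1 p1'"
      unfolding p1_def p1'_def by (intro PP_diff PP_mult less.prems c m)
    have deg: "degree (c * m) = degree p"
    proof -
      have "c \<noteq> 0" "degree c = ?k" using False m(2) by (auto simp: c_def degree_monom_eq)
      then show ?thesis using m(2) False by (simp add: degree_mult_eq)
    qed
    have lead: "coeff (c * m) (degree p) = lead_coeff p"
    proof -
      have "lead_coeff (c * m) = lead_coeff p"
        unfolding lead_coeff_mult using False m(2) by (simp add: c_def degree_monom_eq)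
      then show ?thesis by (simp add: deg)
    qed
    have "p1 = 0 \<or> degree p1 < degree p"
    proof (cases "p1 = 0")
      case False
      have "degree p1 \<le> degree p"
        unfolding p1_def by (rule degree_diff_le) (simp_all add: deg)
      moreover have "degree p1 \<noteq> degree p"
      proof
        assume "degree p1 = degree p"
        moreover have "coeff p1 (degree p) = 0" by (simp add: p1_def lead)
        ultimately have "lead_coeff p1 = 0" by simp
        then show False using \<open>p1 \<noteq> 0\<close> by simp
      qed
      ultimately show ?thesis by simp
    qed simp
    then have "(if p1 = 0 then 0 else Suc (degree p1)) < (if p = 0 then 0 else Suc (degree p))"
      using False by auto
    from less.hyps[OF this P1] obtain s s' r r' where s: "PP G s s'" "PP G r r'" "p1 = s * m + r" "p1' = s' * m' + r'"
        "r = 0 \<or> degree r < degree m"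
      by blast
    have "p = (c + s) * m + r" "p' = (c' + s') * m' + r'"
      using s(3,4) by (simp_all add: p1_def p1'_def algebra_simps)
    then show ?thesis using PP_add[OF c s(1)] s(2,5) by blast
  qed
qed

text \<open>The graph of the extension sending \<open>x\<close> to \<open>v\<close>. Fractions are
  used so that algebraic and transcendental \<open>x\<close> are covered by the same
  construction.\<close>

definition extG :: "'a \<Rightarrow> 'b \<Rightarrow> ('a \<times> 'b) set" where
  "extG x v = {(poly p x / poly q x, poly p' v / poly q' v) |p p' q q'.
     PP G p p' \<and> PP G q q' \<and> poly q x \<noteq> 0 \<and> poly q' v \<noteq> 0}"

lemma extG_I:
  "PP G p p' \<Longrightarrow> PP G q q' \<Longrightarrow> poly q x \<noteq> 0 \<Longrightarrow> poly q' v \<noteq> 0 \<Longrightarrow>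
    a = poly p x / poly q x \<Longrightarrow> b = poly p' v / poly q' v \<Longrightarrow> (a, b) \<in> extG x v"
  unfolding extG_def by blast

lemma extG_mono: "G \<subseteq> extG x v"
proof safe
  fix a b assume "(a, b) \<in> G"
  then show "(a, b) \<in> extG x v"
    by (intro extG_I[OF PP_const[of a b] PP_const[of 1 1]]) (simp_all add: hom_graphD[OF G])
qed

lemma extG_root: "(x, v) \<in> extG x v"
  by (rule extG_I[OF PP_X PP_const[of 1 1]]) (simp_all add: hom_graphD[OF G])

lemma hom_graph_extG:
  assumes iff: "\<And>p p'. PP G p p' \<Longrightarrow> poly p x = 0 \<longleftrightarrow> poly p' v = 0"
  shows "hom_graph (extG x v)"
proof -
  have "(0, 0) \<in> extG x v" "(1, 1) \<in> extG x v"
    using extG_mono hom_graphD(1,2)[OF G] by blast+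
  moreover have "(a + b, a' + b') \<in> extG x v" "(a * b, a' * b') \<in> extG x v"
    if "(a, a') \<in> extG x v" "(b, b') \<in> extG x v" for a a' b b'
  proof -
    from that(1) obtain p p' q q' where 1: "PP G p p'" "PP G q q'" "poly q x \<noteq> 0" "poly q' v \<noteq> 0"
      "a = poly p x / poly q x" "a' = poly p' v / poly q' v" unfolding extG_def by blast
    from that(2) obtain r r' s s' where 2: "PP G r r'" "PP G s s'" "poly s x \<noteq> 0" "poly s' v \<noteq> 0"
      "b = poly r x / poly s x" "b' = poly r' v / poly s' v" unfolding extG_def by blast
    show "(a + b, a' + b') \<in> extG x v"
      by (rule extG_I[of "p * s + r * q" "p' * s' + r' * q'" "q * s" "q' * s'"])
        (use 1 2 in \<open>auto simp: add_frac_eq intro: PP_add PP_mult\<close>)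
    show "(a * b, a' * b') \<in> extG x v"
      by (rule extG_I[of "p * r" "p' * r'" "q * s" "q' * s'"])
        (use 1 2 in \<open>auto intro: PP_add PP_mult\<close>)
  qed
  moreover have "(- a, - a') \<in> extG x v" "(inverse a, inverse a') \<in> extG x v"
    if "(a, a') \<in> extG x v" for a a'
  proof -
    from that obtain p p' q q' where 1: "PP G p p'" "PP G q q'" "poly q x \<noteq> 0" "poly q' v \<noteq> 0"
      "a = poly p x / poly q x" "a' = poly p' v / poly q' v" unfolding extG_def by blast
    show "(- a, - a') \<in> extG x v"
      by (rule extG_I[of "- p" "- p'" q q']) (use 1 in \<open>auto intro: PP_minus\<close>)
    show "(inverse a, inverse a') \<in> extG x v"
    proof (cases "poly p x = 0")
      case True
      then have "a = 0" "a' = 0" using 1 iff[OF 1(1)] by simp_all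
      then show ?thesis using extG_mono hom_graphD(1)[OF G] by auto
    next
      case False
      then show ?thesis using 1 iff[OF 1(1)] by (intro extG_I[of q q' p p']) auto
    qed
  qed
  moreover have "a' = b'" if *: "(a, a') \<in> extG x v" "(a, b') \<in> extG x v" for a a' b'
  proof -
    from *(1) obtain p p' q q' where 1: "PP G p p'" "PP G q q'" "poly q x \<noteq> 0" "poly q' v \<noteq> 0"
      "a = poly p x / poly q x" "a' = poly p' v / poly q' v" unfolding extG_def by blast
    from *(2) obtain r r' s s' where 2: "PP G r r'" "PP G s s'" "poly s x \<noteq> 0" "poly s' v \<noteq> 0"
      "a = poly r x / poly s x" "b' = poly r' v / poly s' v" unfolding extG_def by blast
    have "PP G (p * s - r * q) (p' * s' - r' * q')" using 1 2 by (intro PP_diff PP_mult)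
    moreover have "poly (p * s - r * q) x = 0" using 1 2 by (simp add: frac_eq_eq)
    ultimately have "poly (p' * s' - r' * q') v = 0" using iff by blast
    then show ?thesis using 1 2 by (simp add: frac_eq_eq)
  qed
  ultimately show ?thesis by (intro hom_graphI)
qed

end

definition alg_over :: "'a :: field set \<Rightarrow> 'a \<Rightarrow> bool" where
  "alg_over F x \<longleftrightarrow> (\<exists>p. p \<noteq> 0 \<and> (\<forall>i. coeff p i \<in> F) \<and> poly p x = 0)"

lemma alg_over_mono: "alg_over F x \<Longrightarrow> F \<subseteq> F' \<Longrightarrow> alg_over F' x"
  unfolding alg_over_def by blast

lemma PP_exists:
  assumes G: "hom_graph G" and p: "\<And>i. coeff p i \<in> Domain G"
  shows "\<exists>p'. PP G p p'"
proof -
  have "\<forall>i. \<exists>c. (coeff p i, c) \<in> G" using p by auto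
  then obtain c where c: "\<And>i. (coeff p i, c i) \<in> G" by metis
  have "\<forall>\<^sub>\<infinity>i. c i = 0"
  proof (rule MOST_mono[OF MOST_coeff_eq_0[of p]])
    fix i assume "coeff p i = 0"
    then show "c i = 0" using hom_graphD(9)[OF G c[of i]] by simp
  qed
  then have "coeff (Abs_poly c) = c" by (simp add: Abs_poly_inverse)
  then have "PP G p (Abs_poly c)" using c by (simp add: PP_def)
  then show ?thesis ..
qed

text \<open>Irreducibility is expressed by least degrees. \<open>m\<close> has least degree among
  the polynomials over the domain that kill \<open>x\<close>, and \<open>v\<close> is a root of its
  image; \<open>d\<close> has least degree among those whose image kills \<open>v\<close>. Then
  \<open>d\<close> divides \<open>m\<close>, and minimality of \<open>m\<close> excludes that the
  cofactor kills \<open>x\<close>, so \<open>d\<close> does. Both directions of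
  \<open>poly p x = 0 \<longleftrightarrow> poly p' v = 0\<close> follow by division with remainder,
  by \<open>m\<close> and by \<open>d\<close>.\<close>

lemma hom_graph_extend_algebraic:
  fixes G :: "('a :: field \<times> 'b :: alg_closed_field) set"
  assumes G: "hom_graph G" and x: "alg_over (Domain G) x"
  shows "\<exists>G'. hom_graph G' \<and> G \<subseteq> G' \<and> x \<in> Domain G'"
proof -
  define A where "A p \<longleftrightarrow> p \<noteq> 0 \<and> poly p x = 0 \<and> (\<exists>p'. PP G p p')" for p
  have "\<exists>p. A p" using x PP_exists[OF G] unfolding alg_over_def A_def by blast
  then obtain m where m: "A m" "\<And>p. A p \<Longrightarrow> degree m \<le> degree p"
    using ex_has_least_nat[of A _ degree] by blast
  then obtain m' where m': "PP G m m'" "m \<noteq> 0" "poly m x = 0" by (auto simp: A_def)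
  have "degree m > 0"
  proof (rule ccontr)
    assume "\<not> degree m > 0"
    then obtain c where "m = [:c:]" by (meson degree_eq_zeroE gr0I)
    then show False using m' by auto
  qed
  then have "degree m' > 0" using PP_degree[OF G m'(1)] by simp
  then obtain v where v: "poly m' v = 0" using alg_closed_imp_poly_has_root by blast
  define B where "B p \<longleftrightarrow> p \<noteq> 0 \<and> (\<exists>p'. PP G p p' \<and> poly p' v = 0)" for p
  have Bm: "B m" using m' v by (auto simp: B_def)
  then obtain d where d: "B d" "\<And>p. B p \<Longrightarrow> degree d \<le> degree p"
    using ex_has_least_nat[of B _ degree] by blast
  then obtain d' where d': "d \<noteq> 0" "PP G d d'" "poly d' v = 0" by (auto simp: B_def)
  have dvd: "\<exists>s. p = s * d \<and> (\<exists>s'. PP G s s')" if p: "PP G p p'" "poly p' v = 0" for p p'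
  proof -
    obtain s s' r r' where s: "PP G s s'" "PP G r r'" "p = s * d + r" "p' = s' * d' + r'" "r = 0 \<or> degree r < degree d"
      using PP_division[OF G d'(2,1) p(1)] by blast
    have "r = 0"
    proof (rule ccontr)
      assume "r \<noteq> 0"
      moreover have "poly r' v = 0" using p(2) s(4) d'(3) by simp
      ultimately have "B r" using s(2) by (auto simp: B_def)
      then show False using d(2)[of r] s(5) \<open>r \<noteq> 0\<close> by simp
    qed
    then show ?thesis using s by auto
  qed
  have dx: "poly d x = 0"
  proof -
    obtain s s' where s: "m = s * d" "PP G s s'" using dvd[OF m'(1) v] by blast
    have "s \<noteq> 0" using s m'(2) by auto
    have "poly s x = 0 \<or> poly d x = 0" using m'(3) s(1) by simp
    moreover have "poly s x \<noteq> 0"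
    proof
      assume "poly s x = 0"
      then have "A s" using s \<open>s \<noteq> 0\<close> by (auto simp: A_def)
      then have "degree m \<le> degree s" by (rule m(2))
      then have "degree d = 0" using s(1) \<open>s \<noteq> 0\<close> d'(1) by (simp add: degree_mult_eq)
      then have "degree d' = 0" using PP_degree[OF G d'(2)] by simp
      then obtain c where "d' = [:c:]" by (meson degree_eq_zeroE)
      then show False using d' PP_eq_0[OF G d'(2)] by simp
    qed
    ultimately show ?thesis by blast
  qed
  have "poly p x = 0 \<longleftrightarrow> poly p' v = 0" if p: "PP G p p'" for p p'
  proof
    assume p0: "poly p x = 0"
    obtain s s' r r' where s: "PP G s s'" "PP G r r'" "p = s * m + r" "p' = s' * m' + r'" "r = 0 \<or> degree r < degree m"
      using PP_division[OF G m'(1,2) p(1)] by blast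
    have "r = 0"
    proof (rule ccontr)
      assume "r \<noteq> 0"
      then have "A r" using s p0 m'(3) by (auto simp: A_def)
      then show False using m(2)[of r] s(5) \<open>r \<noteq> 0\<close> by simp
    qed
    then have "r' = 0" using PP_eq_0[OF G s(2)] by simp
    then show "poly p' v = 0" using s(4) v by simp
  next
    assume "poly p' v = 0"
    then show "poly p x = 0" using dvd[OF p] dx by auto
  qed
  from hom_graph_extG[OF G this] show ?thesis
    using extG_mono[OF G, of x v] extG_root[OF G, of x v] by blast
qed

lemma hom_graph_extend_transcendental:
  assumes G: "hom_graph G" and x: "\<not> alg_over (Domain G) x" and v: "\<not> alg_over (Range G) v"
  shows "\<exists>G'. hom_graph G' \<and> G \<subseteq> G' \<and> (x, v) \<in> G'"
proof -
  have "poly p x = 0 \<longleftrightarrow> poly p' v = 0" if p: "PP G p p'" for p p'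
  proof -
    have "poly p x = 0 \<longleftrightarrow> p = 0"
      using x p unfolding alg_over_def PP_def by auto
    also have "\<dots> \<longleftrightarrow> p' = 0" by (rule PP_eq_0[OF G p])
    also have "\<dots> \<longleftrightarrow> poly p' v = 0"
      using v p unfolding alg_over_def PP_def by auto
    finally show ?thesis .
  qed
  from hom_graph_extG[OF G this] show ?thesis
    using extG_mono[OF G, of x v] extG_root[OF G, of x v] by blast
qed

lemma hom_graph_Union:
  assumes C: "subset.chain {G. hom_graph G} C" "C \<noteq> {}"
  shows "hom_graph (\<Union>C)"
proof -
  have hg: "hom_graph G" if "G \<in> C" for G using C that by (auto simp: subset_chain_def)
  have two: "\<exists>G\<in>C. a \<in> G \<and> b \<in> G" if "a \<in> \<Union>C" "b \<in> \<Union>C" for a b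
    using that C unfolding subset_chain_def by blast
  obtain G0 where G0: "G0 \<in> C" using C by blast
  have "(0, 0) \<in> \<Union>C" "(1, 1) \<in> \<Union>C" using hom_graphD(1,2)[OF hg[OF G0]] G0 by blast+
  moreover have "(a + b, a' + b') \<in> \<Union>C" "(a * b, a' * b') \<in> \<Union>C"
    if "(a, a') \<in> \<Union>C" "(b, b') \<in> \<Union>C" for a a' b b'
    using two[OF that] hom_graphD(3,5)[OF hg] by blast+
  moreover have "(- a, - a') \<in> \<Union>C" "(inverse a, inverse a') \<in> \<Union>C" if "(a, a') \<in> \<Union>C" for a a'
    using that hom_graphD(4,6)[OF hg] by blast+
  moreover have "b = c" if "(a, b) \<in> \<Union>C" "(a, c) \<in> \<Union>C" for a b c
    using two[OF that] hom_graphD(7)[OF hg] by blast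
  ultimately show ?thesis by (intro hom_graphI)
qed

theorem hom_graph_extend_total:
  fixes G :: "('a :: field \<times> 'b :: alg_closed_field) set"
  assumes G: "hom_graph G" and alg: "\<And>x. alg_over (Domain G) x"
  shows "\<exists>h. fhom h \<and> (\<forall>x y. (x, y) \<in> G \<longrightarrow> h x = y)"
proof -
  define A where "A = {G'. hom_graph G' \<and> G \<subseteq> G'}"
  have "\<exists>M\<in>A. \<forall>N\<in>A. M \<subseteq> N \<longrightarrow> N = M"
  proof (rule subset_Zorn_nonempty)
    show "A \<noteq> {}" using G by (auto simp: A_def)
    fix C assume C: "C \<noteq> {}" "subset.chain A C"
    then have "subset.chain {G. hom_graph G} C" by (auto simp: subset_chain_def A_def)
    from hom_graph_Union[OF this C(1)] have "hom_graph (\<Union>C)" .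
    moreover obtain G' where "G' \<in> C" "G \<subseteq> G'" using C by (auto simp: A_def subset_chain_def)
    ultimately show "\<Union>C \<in> A" by (auto simp: A_def)
  qed
  then obtain M where MA: "M \<in> A" "\<And>N. N \<in> A \<Longrightarrow> M \<subseteq> N \<Longrightarrow> N = M"
    by blast
  have M: "hom_graph M" "G \<subseteq> M" using MA(1) by (simp_all add: A_def)
  have max: "N = M" if "hom_graph N" "M \<subseteq> N" for N
    using that M(2) by (intro MA(2)) (auto simp: A_def)
  have dom: "x \<in> Domain M" for x
  proof -
    have "alg_over (Domain M) x" by (rule alg_over_mono[OF alg Domain_mono[OF M(2)]])
    from hom_graph_extend_algebraic[OF M(1) this]
    obtain G' where G': "hom_graph G'" "M \<subseteq> G'" "x \<in> Domain G'" by blast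
    show ?thesis using G'(3) unfolding max[OF G'(1,2)] .
  qed
  define h where "h x = (THE y. (x, y) \<in> M)" for x
  have h: "(x, h x) \<in> M" for x
  proof -
    obtain y where y: "(x, y) \<in> M" using dom[of x] by blast
    then have "h x = y" unfolding h_def using hom_graphD(7)[OF M(1)] by blast
    then show ?thesis using y by simp
  qed
  have hI: "h x = y" if "(x, y) \<in> M" for x y
    using hom_graphD(7)[OF M(1) that h] by simp
  have "fhom h"
    unfolding fhom_def by (auto intro!: hI hom_graphD[OF M(1)] h)
  then show ?thesis using hI M(2) by blast
qed

section \<open>Automorphisms of an algebraic extension\<close>

definition Gal :: "'a :: field set \<Rightarrow> ('a \<Rightarrow> 'a) set" where
  "Gal F = {h. fhom h \<and> bij h \<and> (\<forall>x\<in>F. h x = x)}"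

lemma GalD:
  assumes "h \<in> Gal F" shows "fhom h" "bij h" "x \<in> F \<Longrightarrow> h x = x"
  using assms by (auto simp: Gal_def)

lemma Gal_mono: "F \<subseteq> F' \<Longrightarrow> Gal F' \<subseteq> Gal F"
  by (auto simp: Gal_def)

lemma Gal_comp: "g \<in> Gal F \<Longrightarrow> h \<in> Gal F \<Longrightarrow> g \<circ> h \<in> Gal F"
  by (auto simp: Gal_def fhom_comp intro: bij_comp)

lemma Gal_id: "id \<in> Gal F"
  by (auto simp: Gal_def fhom_def)

lemma Gal_inv:
  assumes "g \<in> Gal F" shows "inv_into UNIV g \<in> Gal F"
proof -
  note g = GalD[OF assms]
  have gi: "g (inv_into UNIV g x) = x" for x using g(2) by (simp add: bij_is_surj surj_f_inv_f)
  have "fhom (inv_into UNIV g)"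
    unfolding fhom_def
    by (safe; rule injD[OF bij_is_inj[OF g(2)]]) (simp_all add: gi fhomD[OF g(1)])
  moreover have "inv_into UNIV g x = x" if "x \<in> F" for x
    using g(3)[OF that] g(2) by (metis bij_inv_eq_iff)
  ultimately show ?thesis using g(2) by (auto simp: Gal_def bij_imp_bij_inv)
qed

text \<open>Surjectivity holds because an injective endomorphism permutes the finitely many roots of
  each polynomial over the fixed field.\<close>

lemma Gal_I:
  fixes h :: "'a :: field \<Rightarrow> 'a"
  assumes h: "fhom h" and fixed: "\<And>x. x \<in> F \<Longrightarrow> h x = x" and alg: "\<And>x. alg_over F x"
  shows "h \<in> Gal F"
proof -
  have inj: "inj h" using fhomD(11)[OF h] by (auto intro: injI)
  have "surj h"
    unfolding surj_def
  proof
    fix x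
    obtain p where p: "p \<noteq> 0" "\<And>i. coeff p i \<in> F" "poly p x = 0"
      using alg[of x] by (auto simp: alg_over_def)
    let ?R = "{y. poly p y = 0}"
    have "map_poly h p = p" using p(2) fixed by (intro poly_eqI) (simp add: coeff_map_poly fhomD[OF h])
    then have "poly p (h y) = h (poly p y)" for y using fhom_poly[OF h, of p y] by simp
    then have "h ` ?R \<subseteq> ?R" using fhomD(4)[OF h] by auto
    moreover have "finite ?R" using p(1) by (rule poly_roots_finite)
    ultimately have "h ` ?R = ?R" by (intro endo_inj_surj inj_on_subset[OF inj]) auto
    then show "\<exists>y. x = h y" using p(3) by blast
  qed
  then show ?thesis using inj h fixed by (auto simp: Gal_def bij_def)
qed

lemma hom_graph_Id_on: "is_sf F \<Longrightarrow> hom_graph (Id_on F)"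
  by (auto simp: hom_graph_def is_sf_def Id_on_def)

lemma Gal_extend_graph:
  fixes F :: "'a :: alg_closed_field set"
  assumes G: "hom_graph G" "Id_on F \<subseteq> G" and alg: "\<And>x. alg_over F x"
  shows "\<exists>h\<in>Gal F. \<forall>x y. (x, y) \<in> G \<longrightarrow> h x = y"
proof -
  have "F \<subseteq> Domain G" using G(2) by auto
  from hom_graph_extend_total[OF G(1) alg_over_mono[OF alg this]]
  obtain h where h: "fhom h" "\<And>x y. (x, y) \<in> G \<Longrightarrow> h x = y"
    by auto
  then have "h \<in> Gal F" using G(2) alg by (intro Gal_I) auto
  then show ?thesis using h by blast
qed

text \<open>Values at \<open>d\<close> of polynomials over \<open>F\<close> have the form a + b d,
  and substituting - d gives a - b d. As \<open>d\<close> is not in \<open>F\<close>, each of these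
  vanishes only if a = b = 0, so sending \<open>d\<close> to \<open>- d\<close> is well
  defined.\<close>

lemma Gal_quadratic:
  fixes d :: "'a :: alg_closed_field"
  assumes F: "is_sf F" and alg: "\<And>x. alg_over F x" and d: "d \<notin> F" "d * d \<in> F"
  shows "\<exists>h\<in>Gal F. h d = - d"
proof -
  note G = hom_graph_Id_on[OF F]
  have ab: "\<exists>a\<in>F. \<exists>b\<in>F. poly p d = a + b * d \<and> poly p (- d) = a - b * d" if "\<forall>i. coeff p i \<in> F" for p
    using that
  proof (induction p)
    case 0
    then show ?case using is_sfD(1)[OF F] by force
  next
    case (pCons c p)
    have "\<forall>i. coeff p i \<in> F" using pCons.prems by (metis coeff_pCons_Suc)
    then obtain a b where ab: "a \<in> F" "b \<in> F" "poly p d = a + b * d" "poly p (- d) = a - b * d"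
      using pCons.IH by blast
    have "c \<in> F" using pCons.prems by (metis coeff_pCons_0)
    then have "c + b * (d * d) \<in> F" by (intro is_sfD(3,5)[OF F] ab d(2))
    then show ?case using ab(1) unfolding poly_pCons ab(3,4)
      by (intro bexI[of _ "c + b * (d * d)"] bexI[of _ a]) (auto simp: algebra_simps)
  qed
  have "poly p d = 0 \<longleftrightarrow> poly p' (- d) = 0" if p: "PP (Id_on F) p p'" for p p'
  proof -
    have "p = p'" and pF: "\<forall>i. coeff p i \<in> F" using p by (auto simp: PP_def poly_eq_iff Id_on_def)
    obtain a b where ab: "a \<in> F" "b \<in> F" "poly p d = a + b * d" "poly p (- d) = a - b * d"
      using ab[OF pF] by blast
    have b0: "b = 0" if "a + b * d = 0 \<or> a - b * d = 0"
    proof (rule ccontr)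
      assume "b \<noteq> 0"
      with that have "d = - a / b \<or> d = a / b" by (auto simp: field_simps eq_neg_iff_add_eq_0)
      then show False using d(1) ab is_sfD[OF F] by metis
    qed
    then show ?thesis using ab \<open>p = p'\<close> by auto
  qed
  note * = hom_graph_extG[OF G this]
  have "Id_on F \<subseteq> extG (Id_on F) d (- d)" by (rule extG_mono[OF G])
  from Gal_extend_graph[OF * this alg] obtain h
    where h: "h \<in> Gal F" "\<forall>x y. (x, y) \<in> extG (Id_on F) d (- d) \<longrightarrow> h x = y" by blast
  then have "h d = - d" using extG_root[OF G, of d "- d"] by blast
  then show ?thesis using h(1) by blast
qed

text \<open>Automorphisms which stabilise on more and more elements have a limit: the pairs \<open>(x, y)\<close> with
  \<open>g n x = y\<close> for all large \<open>n\<close> form the graph of a homomorphism.\<close>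

lemma Gal_glue:
  fixes F :: "'a :: alg_closed_field set" and lev :: "'i \<Rightarrow> nat"
  assumes alg: "\<And>x. alg_over F x"
    and ex: "\<And>n. \<exists>g\<in>Gal F. \<forall>i. lev i \<le> n \<longrightarrow> g (a i) = b i"
  shows "\<exists>g\<in>Gal F. \<forall>i. g (a i) = b i"
proof -
  from ex obtain g where g: "\<And>n. g n \<in> Gal F" "\<And>n i. lev i \<le> n \<Longrightarrow> g n (a i) = b i" by metis
  note gh = GalD(1)[OF g(1)]
  define G where "G = {(x, y). \<exists>n. \<forall>m\<ge>n. g m x = y}"
  have GI: "(x, y) \<in> G" if "\<And>m. n \<le> m \<Longrightarrow> g m x = y" for n x y
    unfolding G_def using that by blast
  have two: "\<exists>n. \<forall>m\<ge>n. g m x = x' \<and> g m y = y'" if "(x, x') \<in> G" "(y, y') \<in> G" for x x' y y'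
  proof -
    from that obtain n1 n2 where "\<forall>m\<ge>n1. g m x = x'" "\<forall>m\<ge>n2. g m y = y'" unfolding G_def by blast
    then show ?thesis by (intro exI[of _ "max n1 n2"]) auto
  qed
  have "(0, 0) \<in> G" "(1, 1) \<in> G" by (rule GI[of 0], simp add: fhomD[OF gh])+
  moreover have "(x + y, x' + y') \<in> G" "(x * y, x' * y') \<in> G"
    if "(x, x') \<in> G" "(y, y') \<in> G" for x x' y y'
  proof -
    obtain n where "\<forall>m\<ge>n. g m x = x' \<and> g m y = y'" using two[OF \<open>(x, x') \<in> G\<close> \<open>(y, y') \<in> G\<close>] by blast
    then show "(x + y, x' + y') \<in> G" "(x * y, x' * y') \<in> G"
      by (intro GI[of n]; simp add: fhomD[OF gh])+
  qed
  moreover have "(- x, - x') \<in> G" "(inverse x, inverse x') \<in> G" if "(x, x') \<in> G" for x x'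
  proof -
    obtain n where "\<forall>m\<ge>n. g m x = x' \<and> g m x = x'" using two[OF \<open>(x, x') \<in> G\<close> \<open>(x, x') \<in> G\<close>] by blast
    then show "(- x, - x') \<in> G" "(inverse x, inverse x') \<in> G"
      by (intro GI[of n]; simp add: fhomD[OF gh])+
  qed
  moreover have "y = z" if "(x, y) \<in> G" "(x, z) \<in> G" for x y z
    using two[OF that] by blast
  ultimately have "hom_graph G" by (intro hom_graphI)
  moreover have "Id_on F \<subseteq> G" using GalD(3)[OF g(1)] by (auto intro: GI)
  ultimately obtain h where "h \<in> Gal F" "\<forall>x y. (x, y) \<in> G \<longrightarrow> h x = y"
    using Gal_extend_graph alg by blast
  moreover have "(a i, b i) \<in> G" for i using g(2) by (intro GI) auto
  ultimately show ?thesis by blast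
qed

section \<open>From Galois automorphisms to elements of \<open>M_inf\<close>\<close>

section \<open>Powers of roots of unity with 2-adic exponents\<close>

text \<open>\<open>z n\<close> is a primitive root of unity of order \<open>2 ^ (n + 1)\<close>.\<close>

definition zsys :: "(nat \<Rightarrow> 'a :: field) \<Rightarrow> bool" where
  "zsys z \<longleftrightarrow> z 0 = - 1 \<and> (\<forall>n. z (Suc n) ^ 2 = z n) \<and> (2 :: 'a) \<noteq> 0"

text \<open>The power of \<open>z n\<close> with 2-adic exponent \<open>x\<close>; the order of
  \<open>z n\<close> is \<open>2 ^ Suc n\<close>, hence the index of the residue.\<close>

definition zp :: "(nat \<Rightarrow> 'a :: field) \<Rightarrow> nat \<Rightarrow> zint2 \<Rightarrow> 'a" where
  "zp z n x = z n ^ nat (residue x (Suc n))"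

lemma residue_nonneg: "residue x n \<ge> 0"
  using pos_mod_sign[of "2 ^ n" "residue x n"] by simp

lemma two_neq_0_iff: "(2 :: 'a :: field) \<noteq> 0 \<longleftrightarrow> (- 1 :: 'a) \<noteq> 1"
proof -
  have "(- 1 :: 'a) = 1 \<longleftrightarrow> 1 + 1 = (0 :: 'a)" by (simp only: neg_eq_iff_add_eq_0)
  then show ?thesis by simp
qed

context
  fixes z :: "nat \<Rightarrow> 'a :: field"
  assumes z: "zsys z"
begin

lemma zsysD: "z 0 = - 1" "z (Suc n) ^ 2 = z n" "(2 :: 'a) \<noteq> 0" "(- 1 :: 'a) \<noteq> 1"
  using z two_neq_0_iff[where 'a = 'a] by (auto simp: zsys_def)

lemma zsys_pow: "z n ^ 2 ^ n = - 1"
  by (induction n) (simp_all add: zsysD power_mult)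

lemma zsys_nonzero: "z n \<noteq> 0"
proof
  assume "z n = 0"
  then have "(0 :: 'a) ^ 2 ^ n = - 1" using zsys_pow[of n] by simp
  moreover have "(0 :: 'a) ^ 2 ^ n = 0" by (rule zero_power) simp
  ultimately show False by simp
qed

lemma zsys_pow_mod: "z n ^ (k mod 2 ^ Suc n) = z n ^ k"
proof -
  have "z n ^ 2 ^ Suc n = 1"
    unfolding power_Suc2[of 2 n] power_mult zsys_pow by simp
  then have "z n ^ (2 ^ Suc n * (k div 2 ^ Suc n) + k mod 2 ^ Suc n) = z n ^ (k mod 2 ^ Suc n)"
    by (simp only: power_add power_mult power_one mult_1)
  then show ?thesis by (simp only: mult_div_mod_eq)
qed

lemma zp_add: "zp z n (x + y) = zp z n x * zp z n y"
proof -
  have "nat (residue (x + y) (Suc n)) = (nat (residue x (Suc n)) + nat (residue y (Suc n))) mod 2 ^ Suc n"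
    using residue_nonneg by (simp add: plus_zint2.rep_eq nat_mod_distrib nat_add_distrib nat_power_eq nat_mult_distrib)
  then show ?thesis by (simp only: zp_def zsys_pow_mod power_add)
qed

lemma zp_0 [simp]: "zp z n 0 = 1" by (simp add: zp_def)

lemma zp_1 [simp]: "zp z n 1 = z n"
  by (simp add: zp_def one_zint2.rep_eq)

lemma zp_nonzero: "zp z n x \<noteq> 0" by (simp add: zp_def zsys_nonzero)

lemma zp_minus: "zp z n (- x) = inverse (zp z n x)"
  using zp_add[of n x "- x"] by (simp add: inverse_unique)

lemma zp_diff: "zp z n (x - y) = zp z n x / zp z n y"
  using zp_add[of n x "- y"] by (simp add: zp_minus divide_inverse)

lemma zp_double: "zp z (Suc n) (2 * x) = zp z n x"
  using residue_nonneg[of x "Suc n"]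
  by (simp add: zp_def residue_double nat_mult_distrib power_mult zsysD)

lemma zp_0_double: "zp z 0 (2 * x) = 1"
  by (simp add: zp_def residue_double)

lemma zp_eq_1_iff: "zp z n x = 1 \<longleftrightarrow> 2 ^ Suc n dvd x"
proof (induction n arbitrary: x)
  case 0
  show ?case
  proof (cases x rule: zint2_parity_cases)
    case (even h)
    then show ?thesis by (simp add: zp_0_double)
  next
    case (odd h)
    have "\<not> 2 dvd x" using odd zint2_not_even_odd by (metis dvdE)
    then show ?thesis by (simp add: odd zp_add zp_0_double zsysD)
  qed
next
  case (Suc n)
  show ?case
  proof (cases x rule: zint2_parity_cases)
    case (even h)
    have "2 ^ Suc (Suc n) dvd 2 * h \<longleftrightarrow> 2 ^ Suc n dvd h"
      using two_power_dvd_imp[of "Suc n" h] by (auto simp: mult_dvd_mono)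
    then show ?thesis using Suc.IH[of h] by (simp only: even zp_double)
  next
    case (odd h)
    have "zp z (Suc n) x \<noteq> 1"
    proof
      assume "zp z (Suc n) x = 1"
      \<comment> \<open>An odd exponent is excluded by raising to the power
        \<open>2 ^ Suc n\<close>: the even part of the exponent contributes 1 and the remaining
        factor \<open>z (Suc n)\<close> contributes -1.\<close>
      then have "1 = zp z (Suc n) x ^ 2 ^ Suc n" by simp
      also have "\<dots> = (z (Suc n) ^ 2 ^ Suc n) * (zp z n h ^ 2 ^ Suc n)"
        by (simp only: odd zp_add zp_1 zp_double power_mult_distrib)
      also have "zp z n h ^ 2 ^ Suc n = (z n ^ 2 ^ Suc n) ^ nat (residue h (Suc n))"
        unfolding zp_def by (simp only: mult.commute flip: power_mult)
      also have "z n ^ 2 ^ Suc n = 1"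
        unfolding power_Suc2[of 2 n] power_mult zsys_pow by simp
      finally have "1 = (- 1 :: 'a)" by (simp only: zsys_pow power_one mult_1_right)
      then show False using zsysD(4) by metis
    qed
    moreover have "\<not> 2 ^ Suc (Suc n) dvd x"
    proof
      assume "2 ^ Suc (Suc n) dvd x"
      then have "2 dvd x" unfolding power_Suc by (rule dvd_mult_left)
      then show False using odd zint2_not_even_odd by (metis dvdE)
    qed
    ultimately show ?thesis by blast
  qed
qed

lemma zp_eqD: "zp z n x = zp z n y \<Longrightarrow> 2 ^ Suc n dvd x - y"
  using zp_eq_1_iff[of n "x - y"] by (simp add: zp_diff zp_nonzero)

end

section \<open>Compatible labelings\<close>

text \<open>\<open>\<rho> w 0\<close> is the label of \<open>w\<close>, and \<open>\<rho> w n\<close> is the product of the labels of the nodes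
  \<open>w @ [s\<^sub>1, La, s\<^sub>2, La, \<dots>, s\<^sub>n, La]\<close>; it is a \<open>2 ^ n\<close>-th root of the negative of the label of \<open>w\<close>.
  The first condition normalises the labeling: it makes the action on the roots of unity visible
  in the exponents \<open>Q\<close>.\<close>

definition good :: "(nat \<Rightarrow> 'a :: field) \<Rightarrow> (node \<Rightarrow> nat \<Rightarrow> 'a) \<Rightarrow> bool" where
  "good z \<rho> \<longleftrightarrow> (\<forall>w n. \<rho> (w @ [Lb]) n = z n * \<rho> (w @ [La]) n) \<and>
    (\<forall>w n. \<rho> w (Suc n) = \<rho> (w @ [La, La]) n * \<rho> (w @ [Lb, La]) n) \<and>
    (\<forall>w. \<rho> (w @ [La]) 0 ^ 2 = \<rho> w 0 + 1) \<and> \<rho> [] 0 \<noteq> 0 \<and> \<rho> [] 0 \<noteq> - 1"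

definition lab :: "(node \<Rightarrow> nat \<Rightarrow> 'a) \<Rightarrow> node \<Rightarrow> 'a" where
  "lab \<rho> w = \<rho> w 0"

abbreviation act :: "(node \<Rightarrow> nat \<Rightarrow> 'a) \<Rightarrow> ('a \<Rightarrow> 'a) \<Rightarrow> node \<Rightarrow> node" where
  "act \<rho> \<equiv> induced_action (lab \<rho>)"

lemma basilica_funpow_Suc: "(basilica ^^ Suc n) x = (basilica ^^ n) (basilica x)"
  by (simp add: funpow_swap1)

context
  fixes z :: "nat \<Rightarrow> 'a :: field" and \<rho>
  assumes z: "zsys z" and \<rho>: "good z \<rho>"
begin

lemma goodD:
  "\<rho> (w @ [Lb]) n = z n * \<rho> (w @ [La]) n"
  "\<rho> w (Suc n) = \<rho> (w @ [La, La]) n * \<rho> (w @ [Lb, La]) n"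
  "lab \<rho> (w @ [c]) ^ 2 = lab \<rho> w + 1"
  "lab \<rho> (w @ [Lb]) = - lab \<rho> (w @ [La])"
proof -
  show 1: "\<rho> (w @ [Lb]) n = z n * \<rho> (w @ [La]) n" "\<rho> w (Suc n) = \<rho> (w @ [La, La]) n * \<rho> (w @ [Lb, La]) n" for w n
    using \<rho> by (auto simp: good_def)
  then show 2: "lab \<rho> (w @ [Lb]) = - lab \<rho> (w @ [La])"
    by (simp add: lab_def zsysD[OF z])
  show "lab \<rho> (w @ [c]) ^ 2 = lab \<rho> w + 1"
    using \<rho> 2 by (cases c) (simp_all add: good_def lab_def)
qed

lemma basilica_lab: "basilica (lab \<rho> (w @ [c])) = lab \<rho> w"
  by (simp add: basilica_def goodD)

text \<open>The polynomial exchanges 0 and -1, the two postcritical points. A child is 0 only above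
  -1, and -1 only above 0, so labels stay off this cycle if the root does. Then no label vanishes
  and siblings are distinct.\<close>

lemma lab_neq: "lab \<rho> w \<noteq> 0 \<and> lab \<rho> w \<noteq> - 1"
proof (induction w rule: rev_induct)
  case Nil
  then show ?case using \<rho> by (simp add: good_def lab_def)
next
  case (snoc c w)
  have "lab \<rho> (w @ [c]) ^ 2 \<noteq> 0" "lab \<rho> (w @ [c]) ^ 2 \<noteq> 1"
    using snoc by (simp_all add: goodD(3) eq_neg_iff_add_eq_0)
  then show ?case by auto
qed

lemma good_nonzero: "\<rho> w n \<noteq> 0"
proof (induction n arbitrary: w)
  case 0
  then show ?case using lab_neq[of w] by (simp add: lab_def)
qed (simp add: goodD)

lemma lab_sibling_neq: "lab \<rho> (w @ [La]) \<noteq> lab \<rho> (w @ [Lb])"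
proof
  assume "lab \<rho> (w @ [La]) = lab \<rho> (w @ [Lb])"
  then have "lab \<rho> (w @ [La]) + lab \<rho> (w @ [La]) = 0"
    using goodD(4)[of w] by (simp add: eq_neg_iff_add_eq_0)
  then have "2 * lab \<rho> (w @ [La]) = 0" by (simp only: mult_2)
  then show False using lab_neq[of "w @ [La]"] zsysD(3)[OF z] by simp
qed

lemma lab_inj: "length v = length w \<Longrightarrow> lab \<rho> v = lab \<rho> w \<Longrightarrow> v = w"
proof (induction w arbitrary: v rule: rev_induct)
  case (snoc c w)
  then obtain d v' where v: "v = v' @ [d]" by (cases v rule: rev_cases) auto
  have "lab \<rho> v' = lab \<rho> w"
    using snoc.prems(2) basilica_lab[of v' d] basilica_lab[of w c] v by simp
  then have "v' = w" using snoc v by simp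
  moreover have "d = c"
    using snoc.prems(2) \<open>v' = w\<close> v lab_sibling_neq[of w] by (cases c; cases d) auto
  ultimately show ?case using v by simp
qed simp

lemma basilica_funpow_lab: "(basilica ^^ length w) (lab \<rho> w) = lab \<rho> []"
proof (induction w rule: rev_induct)
  case (snoc c w)
  then show ?case by (simp only: length_append_singleton basilica_funpow_Suc basilica_lab)
qed simp

lemma lab_surj: "(basilica ^^ n) x = lab \<rho> [] \<Longrightarrow> \<exists>w. length w = n \<and> lab \<rho> w = x"
proof (induction n arbitrary: x)
  case (Suc n)
  then obtain w where w: "length w = n" "lab \<rho> w = basilica x"
    unfolding basilica_funpow_Suc by blast
  then have "x ^ 2 = lab \<rho> (w @ [La]) ^ 2" by (simp add: goodD basilica_def)
  then have "x = lab \<rho> (w @ [La]) \<or> x = lab \<rho> (w @ [Lb])"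
    using goodD(4)[of w] by (simp add: power2_eq_iff)
  then show ?case using w(1) by (metis length_append_singleton)
qed simp

lemma good_is_labeling: "is_labeling (lab \<rho> []) (lab \<rho>)"
  unfolding is_labeling_def
proof (intro conjI allI)
  have "inj (\<lambda>w. (length w, lab \<rho> w))" using lab_inj by (auto intro: injI)
  moreover have "range (\<lambda>w. (length w, lab \<rho> w)) = (SIGMA n:UNIV. preimages n (lab \<rho> []))"
    using lab_surj basilica_funpow_lab by (force simp: preimages_def)
  ultimately show "bij_betw (\<lambda>w. (length w, lab \<rho> w)) UNIV (SIGMA n:UNIV. preimages n (lab \<rho> []))"
    by (simp add: bij_betw_def)
  fix w
  have "x = lab \<rho> (w @ [La]) \<or> x = lab \<rho> (w @ [Lb])" if "basilica x = lab \<rho> w" for x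
  proof -
    have "x ^ 2 = lab \<rho> (w @ [La]) ^ 2" using that by (simp add: goodD basilica_def flip: that)
    then show ?thesis using goodD(4)[of w] by (simp add: power2_eq_iff)
  qed
  then show "{lab \<rho> (w @ [La]), lab \<rho> (w @ [Lb])} = {x. basilica x = lab \<rho> w}"
    using basilica_lab by auto
qed simp

lemma good_subtree: "good z (\<lambda>w. \<rho> (c # w))"
  using \<rho> lab_neq[of "[c]"] unfolding good_def by (simp add: lab_def flip: append_Cons)

section \<open>The action on the tree\<close>

context
  fixes g
  assumes g: "g \<in> Gal {lab \<rho> []}"
begin

lemma fhom_basilica_funpow: "g ((basilica ^^ n) x) = (basilica ^^ n) (g x)"
  by (induction n) (simp_all add: basilica_def fhomD[OF GalD(1)[OF g]])

lemma induced_action: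
  "length (act \<rho> g w) = length w"
  "lab \<rho> (act \<rho> g w) = g (lab \<rho> w)"
proof -
  have "(basilica ^^ length w) (g (lab \<rho> w)) = lab \<rho> []"
    using fhom_basilica_funpow[of "length w" "lab \<rho> w"] GalD(3)[OF g] by (simp add: basilica_funpow_lab)
  then obtain v where v: "length v = length w \<and> lab \<rho> v = g (lab \<rho> w)" using lab_surj by blast
  have "length (act \<rho> g w) = length w \<and> lab \<rho> (act \<rho> g w) = g (lab \<rho> w)"
    unfolding induced_action_def
    by (rule theI[where a = v], rule v, rule lab_inj) (use v in auto)
  then show "length (act \<rho> g w) = length w"
    "lab \<rho> (act \<rho> g w) = g (lab \<rho> w)" by auto
qed

lemma induced_actionI: "length v = length w \<Longrightarrow> lab \<rho> v = g (lab \<rho> w) \<Longrightarrow> act \<rho> g w = v"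
  by (rule lab_inj) (simp_all add: induced_action)

lemma induced_action_tree_aut: "act \<rho> g \<in> tree_aut"
proof (rule tree_autI)
  let ?\<sigma> = "act \<rho> g"
  show "?\<sigma> [] = []" using induced_action(1)[of "[]"] by simp
  have "inj ?\<sigma>"
  proof (rule injI)
    fix v w assume eq: "?\<sigma> v = ?\<sigma> w"
    have "length v = length w" "g (lab \<rho> v) = g (lab \<rho> w)"
      using induced_action[of v] induced_action[of w] eq by auto
    then show "v = w" using fhomD(11)[OF GalD(1)[OF g]] by (intro lab_inj) auto
  qed
  moreover have "\<exists>w. v = ?\<sigma> w" for v
  proof -
    obtain x where x: "lab \<rho> v = g x" using GalD(2)[OF g] by (metis bij_pointE)
    have "g ((basilica ^^ length v) x) = g (lab \<rho> [])"
      using fhom_basilica_funpow[of "length v" x] basilica_funpow_lab[of v] GalD(3)[OF g] x by simp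
    then have "(basilica ^^ length v) x = lab \<rho> []" using fhomD(11)[OF GalD(1)[OF g]] by simp
    then obtain w where "length w = length v" "lab \<rho> w = x" using lab_surj by blast
    then have "?\<sigma> w = v" using x by (intro induced_actionI) auto
    then show ?thesis by blast
  qed
  ultimately show "bij ?\<sigma>" by (auto simp: bij_def surj_def)
  fix w s
  obtain v c where v: "?\<sigma> (w @ [s]) = v @ [c]"
    using induced_action(1)[of "w @ [s]"] by (cases "?\<sigma> (w @ [s])" rule: rev_cases) auto
  have "lab \<rho> v = g (lab \<rho> w)"
  proof -
    have "lab \<rho> v = basilica (lab \<rho> (?\<sigma> (w @ [s])))" unfolding v by (rule basilica_lab[symmetric])
    also have "\<dots> = g (basilica (lab \<rho> (w @ [s])))"
      using fhom_basilica_funpow[of 1 "lab \<rho> (w @ [s])"] by (simp add: induced_action(2))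
    finally show ?thesis by (simp only: basilica_lab)
  qed
  moreover have "length v = length w" using induced_action(1)[of "w @ [s]"] v by simp
  ultimately show "\<exists>s'. ?\<sigma> (w @ [s]) = ?\<sigma> w @ [s']" using v induced_actionI by auto
qed

text \<open>\<open>\<rho> y (Suc n)\<close> is symmetric in the two children of \<open>y\<close>. An
  exchange of these children permutes the two factors, and the exponents of the factors add up to
  \<open>QQ\<close>.\<close>

lemma action_rho_Suc:
  assumes A: "\<And>x. g (\<rho> (x @ [La]) n) = \<rho> (act \<rho> g x @ [La]) n * zp z n (Q (act \<rho> g) x)"
  shows "g (\<rho> y (Suc n)) = \<rho> (act \<rho> g y) (Suc n) * zp z n (QQ (act \<rho> g) y)"
proof -
  let ?\<sigma> = "act \<rho> g"
  have "g (\<rho> y (Suc n)) = g (\<rho> ((y @ [La]) @ [La]) n) * g (\<rho> ((y @ [Lb]) @ [La]) n)"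
    by (simp add: goodD(2) fhomD[OF GalD(1)[OF g]])
  also have "\<dots> = (\<rho> (?\<sigma> (y @ [La]) @ [La]) n * \<rho> (?\<sigma> (y @ [Lb]) @ [La]) n) * zp z n (QQ ?\<sigma> y)"
    unfolding A by (simp add: QQ_def zp_add[OF z])
  also have "\<rho> (?\<sigma> (y @ [La]) @ [La]) n * \<rho> (?\<sigma> (y @ [Lb]) @ [La]) n = \<rho> (?\<sigma> y) (Suc n)"
    using induced_action_tree_aut by (cases rule: Par_cases[where x = y]) (simp_all add: goodD(2))
  finally show ?thesis .
qed

text \<open>An exchange at \<open>x\<close> replaces a value at the child \<open>La\<close> by the
  one at \<open>Lb\<close> and so costs one factor \<open>z n\<close>; the rest of the exponent is
  twice the \<open>QQ\<close> at \<open>x @ [La]\<close>. This is the recursion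
  \<open>Q_rec\<close>.\<close>

lemma action_rho:
  "g (\<rho> (x @ [La]) n) = \<rho> (act \<rho> g x @ [La]) n * zp z n (Q (act \<rho> g) x)"
proof (induction n arbitrary: x)
  let ?\<sigma> = "act \<rho> g"
  case 0
  have 1: "g (\<rho> (x @ [La]) 0) = \<rho> (?\<sigma> (x @ [La])) 0"
    using induced_action(2)[of "x @ [La]"] by (simp add: lab_def)
  have 2: "zp z 0 (Q ?\<sigma> x) = zp z 0 (of_nat (Par ?\<sigma> x))"
    by (simp add: Q_rec[of _ x] zp_add[OF z] zp_0_double[OF z])
  show ?case
    unfolding 1 2
    by (rule Par_cases[OF induced_action_tree_aut, of x])
      (simp_all add: zp_0[OF z] zp_1[OF z] goodD(1) mult.commute)
next
  let ?\<sigma> = "act \<rho> g"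
  case (Suc n)
  have "g (\<rho> (x @ [La]) (Suc n)) = \<rho> (?\<sigma> (x @ [La])) (Suc n) * zp z n (QQ ?\<sigma> (x @ [La]))"
    by (rule action_rho_Suc) (rule Suc.IH)
  also have "\<rho> (?\<sigma> (x @ [La])) (Suc n) = \<rho> (?\<sigma> x @ [La]) (Suc n) * zp z (Suc n) (of_nat (Par ?\<sigma> x))"
    using induced_action_tree_aut
    by (cases rule: Par_cases[where x = x]) (simp_all add: zp_0[OF z] zp_1[OF z] goodD(1) mult.commute)
  finally show ?case
    by (simp add: Q_rec[of _ x] zp_add[OF z] zp_double[OF z] mult.assoc)
qed

text \<open>The origin of the formula for \<open>P\<close>. The root of unity
  \<open>z (Suc n)\<close> is the quotient of the values of \<rho> at \<open>x @ [Lb]\<close> and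
  \<open>x @ [La]\<close>. Applying \<open>g\<close> multiplies these by powers with exponents 2
  \<open>QQ\<close>, and an exchange at \<open>x\<close> inverts the quotient. The left side does
  not mention \<open>x\<close>, so \<open>P\<close> must be constant.\<close>

lemma action_zeta: "g (z (Suc n)) = zp z (Suc n) (P (act \<rho> g) x)"
proof -
  let ?\<sigma> = "act \<rho> g"
  have S: "g (\<rho> y (Suc n)) = \<rho> (?\<sigma> y) (Suc n) * zp z (Suc n) (2 * QQ ?\<sigma> y)" for y
    using action_rho_Suc[OF action_rho] by (simp add: zp_double[OF z])
  have nz: "\<rho> (?\<sigma> (x @ [La])) (Suc n) \<noteq> 0" by (rule good_nonzero)
  have "z (Suc n) = \<rho> (x @ [Lb]) (Suc n) / \<rho> (x @ [La]) (Suc n)"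
    using good_nonzero by (simp add: goodD(1))
  then have "g (z (Suc n)) = g (\<rho> (x @ [Lb]) (Suc n)) / g (\<rho> (x @ [La]) (Suc n))"
    by (simp only: fhomD(8)[OF GalD(1)[OF g]])
  also have "\<dots> = \<rho> (?\<sigma> (x @ [Lb])) (Suc n) / \<rho> (?\<sigma> (x @ [La])) (Suc n)
      * (zp z (Suc n) (2 * QQ ?\<sigma> (x @ [Lb])) / zp z (Suc n) (2 * QQ ?\<sigma> (x @ [La])))"
    unfolding S by simp
  also have "\<rho> (?\<sigma> (x @ [Lb])) (Suc n) / \<rho> (?\<sigma> (x @ [La])) (Suc n) = zp z (Suc n) ((- 1) ^ Par ?\<sigma> x)"
    using induced_action_tree_aut
    by (cases rule: Par_cases[where x = x])
      (use good_nonzero in \<open>simp_all add: zp_1[OF z] zp_minus[OF z] goodD(1) divide_inverse zsys_nonzero[OF z]\<close>)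
  finally show ?thesis
    by (simp only: P_rec[of _ x] zp_add[OF z] zp_diff[OF z] times_divide_eq_right)
qed

lemma induced_action_M_inf: "act \<rho> g \<in> M_inf"
proof -
  let ?\<sigma> = "act \<rho> g"
  have "P ?\<sigma> x = P ?\<sigma> []" for x
  proof (rule zint2_eqI_dvd)
    fix n
    have "2 ^ Suc (Suc n) dvd P ?\<sigma> x - P ?\<sigma> []"
      by (rule zp_eqD[OF z]) (simp only: flip: action_zeta)
    then show "2 ^ n dvd P ?\<sigma> x - P ?\<sigma> []"
      by (rule dvd_trans[rotated]) (rule le_imp_power_dvd, simp)
  qed
  then show ?thesis using induced_action_tree_aut by (simp add: M_inf_def)
qed

end

lemma P_induced_action_eq_1:
  assumes g: "g \<in> Gal {lab \<rho> []}" and fixed: "\<And>n. g (z n) = z n"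
  shows "act \<rho> g \<in> B_inf"
proof -
  let ?\<sigma> = "act \<rho> g"
  have "P ?\<sigma> [] = 1"
  proof (rule zint2_eqI_dvd)
    fix n
    have "2 ^ Suc (Suc n) dvd P ?\<sigma> [] - 1"
      by (rule zp_eqD[OF z]) (simp only: fixed zp_1[OF z] flip: action_zeta[OF g])
    then show "2 ^ n dvd P ?\<sigma> [] - 1"
      by (rule dvd_trans[rotated]) (rule le_imp_power_dvd, simp)
  qed
  then show ?thesis using induced_action_M_inf[OF g] by (simp add: B_inf_def)
qed

lemma induced_action_comp:
  assumes g: "g \<in> Gal {lab \<rho> []}" and h: "h \<in> Gal {lab \<rho> []}"
  shows "act \<rho> (g \<circ> h) = act \<rho> g \<circ> act \<rho> h"
proof
  fix w
  show "act \<rho> (g \<circ> h) w = (act \<rho> g \<circ> act \<rho> h) w"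
    by (rule induced_actionI[OF Gal_comp[OF g h]]) (simp_all add: induced_action[OF g] induced_action[OF h])
qed

lemma induced_action_id: "act \<rho> id = id"
proof
  fix w show "act \<rho> id w = id w"
    by (rule induced_actionI[OF Gal_id]) simp_all
qed

lemma induced_action_inv:
  assumes g: "g \<in> Gal {lab \<rho> []}"
  shows "act \<rho> (inv_into UNIV g) = tinv (act \<rho> g)"
proof -
  have "inv_into UNIV g \<circ> g = id" "g \<circ> inv_into UNIV g = id"
    using GalD(2)[OF g] by (auto simp: bij_def surj_iff)
  then show ?thesis
    using induced_action_comp[OF g Gal_inv[OF g]] induced_action_comp[OF Gal_inv[OF g] g]
    by (intro inv_unique_comp[symmetric]) (simp_all add: induced_action_id)
qed

end

section \<open>Existence of compatible labelings\<close>

definition rt :: "'a :: alg_closed_field \<Rightarrow> 'a" where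
  "rt x = (SOME y. y ^ 2 = x)"

lemma rt: "rt x ^ 2 = x"
  unfolding rt_def by (rule someI_ex) (use nth_root_exists[of 2 x] in auto)

fun root_seq :: "'a :: alg_closed_field \<Rightarrow> nat \<Rightarrow> 'a" where
  "root_seq x 0 = x"
| "root_seq x (Suc 0) = rt (- x)"
| "root_seq x (Suc (Suc n)) = rt (root_seq x (Suc n))"

definition compat_seq :: "(nat \<Rightarrow> 'a :: field) \<Rightarrow> bool" where
  "compat_seq d \<longleftrightarrow> d (Suc 0) ^ 2 = - d 0 \<and> (\<forall>n. d (Suc (Suc n)) ^ 2 = d (Suc n)) \<and> d 0 \<noteq> 0"

lemma compat_root_seq: "x \<noteq> 0 \<Longrightarrow> compat_seq (root_seq x)"
  by (simp add: compat_seq_def rt)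

lemma compat_nonzero: "compat_seq d \<Longrightarrow> d n \<noteq> 0"
proof (induction n)
  case (Suc n)
  then have "d (Suc n) ^ 2 \<noteq> 0"
    by (cases n) (auto simp: compat_seq_def)
  then show ?case by auto
qed (simp add: compat_seq_def)

text \<open>The sequences \<open>\<rho> w\<close> and \<open>\<rho> (w @ [La])\<close>, by recursion on the reversed word. At \<open>w @ [La, La]\<close> the choice is
  free, and at \<open>w @ [Lb, La]\<close> it is forced by the product condition.\<close>

fun rho_state :: "(nat \<Rightarrow> 'a) \<Rightarrow> 'a :: alg_closed_field \<Rightarrow> node \<Rightarrow> (nat \<Rightarrow> 'a) \<times> (nat \<Rightarrow> 'a)" where
  "rho_state z u [] = (root_seq u, root_seq (rt (u + 1)))"
| "rho_state z u (La # w) = (let (p, a) = rho_state z u w in (a, root_seq (rt (a 0 + 1))))"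
| "rho_state z u (Lb # w) = (let (p, a) = rho_state z u w in
     (\<lambda>n. z n * a n, \<lambda>n. p (Suc n) / root_seq (rt (a 0 + 1)) n))"

text \<open>At \<open>Lb\<close> the new sequence is a quotient prescribed by the product condition,
  and it has to be a square root of one plus the label of that node. It is, because
  \<open>p' 0 = a' 0 ^ 2 - 1\<close> gives \<open>- p' 0 = (1 - a' 0) * (1 + a' 0)\<close>: the
  chosen sequence starts with a square root of \<open>1 + a' 0\<close>, which leaves one of
  \<open>1 - a' 0\<close>.\<close>

lemma rho_state_invariant:
  assumes z: "zsys z" and u: "u \<noteq> 0" "u \<noteq> - 1" and "rho_state z u w = (p, a)"
  shows "compat_seq p \<and> compat_seq a \<and> a 0 ^ 2 = p 0 + 1 \<and> p 0 \<noteq> - 1"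
  using assms(4)
proof (induction w arbitrary: p a)
  case Nil
  have "rt (u + 1) \<noteq> 0" using rt[of "u + 1"] u(2) by (auto simp: eq_neg_iff_add_eq_0)
  then show ?case using Nil u by (auto simp: compat_root_seq rt)
next
  case (Cons c w)
  obtain p' a' where pa: "rho_state z u w = (p', a')" by fastforce
  from Cons.IH[OF this] have IH: "compat_seq p'" "compat_seq a'" "a' 0 ^ 2 = p' 0 + 1" "p' 0 \<noteq> - 1" by auto
  let ?r = "root_seq (rt (a' 0 + 1))"
  have a0: "a' 0 \<noteq> 0" using compat_nonzero[OF IH(2)] .
  have a1: "a' 0 \<noteq> - 1" using IH(3) compat_nonzero[OF IH(1), of 0] by auto
  then have "rt (a' 0 + 1) \<noteq> 0" using rt[of "a' 0 + 1"] by (auto simp: eq_neg_iff_add_eq_0)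
  then have r: "compat_seq ?r" by (rule compat_root_seq)
  show ?case
  proof (cases c)
    case La
    then show ?thesis using Cons.prems pa IH r a1 by (auto simp: rt)
  next
    case Lb
    then have p: "p = (\<lambda>n. z n * a' n)" and a: "a = (\<lambda>n. p' (Suc n) / ?r n)"
      using Cons.prems pa by auto
    have "compat_seq p"
      using IH(2) zsysD[OF z] by (simp add: compat_seq_def p power_mult_distrib)
    moreover have "compat_seq a"
      using IH(1) r compat_nonzero[OF IH(1)] compat_nonzero[OF r]
      by (simp add: compat_seq_def a power_divide)
    moreover have "a 0 ^ 2 = p 0 + 1"
    proof -
      have "a 0 ^ 2 = - p' 0 / (a' 0 + 1)" using IH(1) by (simp add: a power_divide rt compat_seq_def)
      also have "- p' 0 = (1 - a' 0) * (a' 0 + 1)" using IH(3) by (simp add: algebra_simps power2_eq_square)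
      finally show ?thesis using a1 by (simp add: p zsysD[OF z] eq_neg_iff_add_eq_0)
    qed
    moreover have "p 0 \<noteq> - 1"
    proof
      assume "p 0 = - 1"
      then have "a' 0 = 1" by (simp add: p zsysD[OF z])
      then show False using IH(3) compat_nonzero[OF IH(1), of 0] by simp
    qed
    ultimately show ?thesis by blast
  qed
qed

theorem good_exists:
  fixes u :: "'a :: alg_closed_field"
  assumes z: "zsys z" and u: "u \<noteq> 0" "u \<noteq> - 1"
  shows "\<exists>\<rho>. good z \<rho> \<and> \<rho> [] 0 = u"
proof -
  define \<rho> where "\<rho> w = fst (rho_state z u (rev w))" for w
  have La: "\<rho> (w @ [La]) = snd (rho_state z u (rev w))" for w
    by (simp add: \<rho>_def case_prod_beta Let_def)
  have Lb: "\<rho> (w @ [Lb]) = (\<lambda>n. z n * \<rho> (w @ [La]) n)" for w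
    unfolding La by (simp add: \<rho>_def case_prod_beta Let_def)
  note inv = rho_state_invariant[OF z u surjective_pairing]
  have LaLa: "\<rho> (w @ [La, La]) = root_seq (rt (\<rho> (w @ [La]) 0 + 1))" for w
    using La[of "w @ [La]"] La[of w] by (simp add: case_prod_beta Let_def)
  have LbLa: "\<rho> (w @ [Lb, La]) = (\<lambda>n. \<rho> w (Suc n) / \<rho> (w @ [La, La]) n)" for w
    unfolding LaLa using La[of "w @ [Lb]"] La[of w] by (simp add: \<rho>_def case_prod_beta Let_def)
  have nz: "\<rho> (w @ [La, La]) n \<noteq> 0" for w n
    using compat_nonzero[of "\<rho> (w @ [La, La])" n] inv[of "rev (w @ [La])"] La[of "w @ [La]"] by simp
  have "good z \<rho>"
    unfolding good_def
  proof (intro conjI allI)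
    fix w n
    show "\<rho> (w @ [Lb]) n = z n * \<rho> (w @ [La]) n" by (simp only: Lb)
    show "\<rho> w (Suc n) = \<rho> (w @ [La, La]) n * \<rho> (w @ [Lb, La]) n" using nz by (simp add: LbLa)
    show "\<rho> (w @ [La]) 0 ^ 2 = \<rho> w 0 + 1" using inv[of "rev w"] by (simp add: La) (simp add: \<rho>_def)
  qed (use u in \<open>simp_all add: \<rho>_def\<close>)
  moreover have "\<rho> [] 0 = u" by (simp add: \<rho>_def)
  ultimately show ?thesis by blast
qed

section \<open>The Galois group over an algebraically closed field of constants\<close>

section \<open>Square roots of power series\<close>

text \<open>Comparison of coefficients in g^2 = f, solved for the newest coefficient of g; the
  division by \<open>2 * r\<close> needs odd characteristic or characteristic 0 and a nonzero
  constant term.\<close>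

function sqrt_coeffs :: "'a :: field \<Rightarrow> (nat \<Rightarrow> 'a) \<Rightarrow> nat \<Rightarrow> 'a" where
  "sqrt_coeffs r f 0 = r"
| "sqrt_coeffs r f (Suc n) =
     (f (Suc n) - (\<Sum>i\<in>{1..n}. sqrt_coeffs r f i * sqrt_coeffs r f (Suc n - i))) / (2 * r)"
  by pat_completeness auto
termination by (relation "measure (\<lambda>(r, f, n). n)") auto

lemma fps_square_root_exists:
  fixes f :: "'a :: alg_closed_field fps"
  assumes two: "(2 :: 'a) \<noteq> 0" and f0: "f $ 0 \<noteq> 0"
  shows "\<exists>g. g ^ 2 = f"
proof -
  define r where "r = rt (f $ 0)"
  have r: "r * r = f $ 0" "r \<noteq> 0" using rt[of "f $ 0"] f0 by (auto simp: r_def power2_eq_square)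
  define b where "b = sqrt_coeffs r (fps_nth f)"
  have "(\<Sum>i=0..n. b i * b (n - i)) = f $ n" for n
  proof (cases n)
    case 0
    then show ?thesis by (simp add: b_def r)
  next
    case (Suc m)
    have "(\<Sum>i=0..Suc m. b i * b (Suc m - i)) = b 0 * b (Suc m) + (\<Sum>i=1..m. b i * b (Suc m - i)) + b (Suc m) * b 0"
      by (simp add: sum.atLeast_Suc_atMost)
    also have "\<dots> = 2 * r * b (Suc m) + (\<Sum>i=1..m. b i * b (Suc m - i))"
      by (simp add: b_def algebra_simps del: sqrt_coeffs.simps(2))
    also have "2 * r * b (Suc m) = f $ Suc m - (\<Sum>i=1..m. b i * b (Suc m - i))"
      using two r by (simp add: b_def)
    finally show ?thesis using Suc by simp
  qed
  then have "Abs_fps b ^ 2 = f"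
    by (intro fps_ext) (simp add: power2_eq_square fps_mult_nth)
  then show ?thesis ..
qed

section \<open>Transcendental elements over an algebraically closed subfield\<close>

lemma fhom_sum: "fhom h \<Longrightarrow> h (sum f A) = (\<Sum>x\<in>A. h (f x))"
  by (induction A rule: infinite_finite_induct) (simp_all add: fhomD)

lemma map_poly_fhom_mult: "fhom h \<Longrightarrow> map_poly h (p * q) = map_poly h p * map_poly h q"
  by (rule poly_eqI) (simp add: coeff_map_poly coeff_mult fhomD fhom_sum)

text \<open>Over an algebraically closed field the polynomial splits, so its image splits with the
  images of the roots.\<close>

lemma root_of_map_poly_fhom:
  fixes p :: "'a :: alg_closed_field poly" and h :: "'a \<Rightarrow> 'b :: field"
  assumes h: "fhom h"
  shows "p \<noteq> 0 \<Longrightarrow> poly (map_poly h p) v = 0 \<Longrightarrow> \<exists>r. poly p r = 0 \<and> v = h r"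
proof (induction "degree p" arbitrary: p)
  case 0
  then obtain c where "p = [:c:]" by (metis degree_eq_zeroE)
  then show ?case using 0 by (simp add: map_poly_pCons fhomD[OF h])
next
  case (Suc n)
  then obtain r where r: "poly p r = 0" using alg_closed_imp_poly_has_root[of p] by auto
  then obtain q where q: "p = [:- r, 1:] * q" by (metis dvdE poly_eq_0_iff_dvd)
  have "q \<noteq> 0" using Suc.prems q by auto
  then have "degree p = 1 + degree q" unfolding q by (subst degree_mult_eq) simp_all
  then have deg: "n = degree q" using Suc.hyps(2) by simp
  have "map_poly h [:- r, 1:] = [:- h r, 1:]" by (simp add: map_poly_pCons fhomD[OF h])
  then have "map_poly h p = [:- h r, 1:] * map_poly h q"
    by (simp only: q map_poly_fhom_mult[OF h])
  then have "poly [:- h r, 1:] v * poly (map_poly h q) v = 0"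
    using Suc.prems(2) by (simp only: poly_mult)
  then have "(v - h r) * poly (map_poly h q) v = 0" by simp
  then show ?case
  proof (cases "v = h r")
    case False
    then have "poly (map_poly h q) v = 0" using \<open>(v - h r) * _ = 0\<close> by simp
    then obtain r' where "poly q r' = 0" "v = h r'" using Suc.hyps(1)[OF deg \<open>q \<noteq> 0\<close>] by blast
    then show ?thesis by (auto simp: q)
  qed (use r in blast)
qed

lemma hom_graph_Domain: "hom_graph G \<Longrightarrow> is_sf (Domain G)"
  unfolding is_sf_def by (blast intro: hom_graphD DomainI)

lemma hom_graph_pair:
  assumes f: "fhom f" and h: "fhom h" and F: "is_sf F"
  shows "hom_graph {(f c, h c) |c. c \<in> F}" (is "hom_graph ?G")
proof (rule hom_graphI)
  have I: "(f c, h c) \<in> ?G" if "c \<in> F" for c using that by blast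
  show "(0, 0) \<in> ?G" "(1, 1) \<in> ?G"
    using I[OF is_sfD(1)[OF F]] I[OF is_sfD(2)[OF F]] by (simp_all only: fhomD(1,4)[OF f] fhomD(1,4)[OF h])
  fix x x' assume x: "(x, x') \<in> ?G"
  then obtain c where c: "x = f c" "x' = h c" "c \<in> F" by blast
  show "(- x, - x') \<in> ?G" "(inverse x, inverse x') \<in> ?G"
    using I[OF is_sfD(4)[OF F c(3)]] I[OF is_sfD(6)[OF F c(3)]]
    by (simp_all only: c fhomD(5,7)[OF f] fhomD(5,7)[OF h])
  fix y y' assume "(y, y') \<in> ?G"
  then obtain d where d: "y = f d" "y' = h d" "d \<in> F" by blast
  show "(x + y, x' + y') \<in> ?G" "(x * y, x' * y') \<in> ?G"
    using I[OF is_sfD(3)[OF F c(3) d(3)]] I[OF is_sfD(5)[OF F c(3) d(3)]]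
    by (simp_all only: c d fhomD(2,3)[OF f] fhomD(2,3)[OF h])
next
  fix x x' x'' assume "(x, x') \<in> ?G" "(x, x'') \<in> ?G"
  then show "x' = x''" using fhomD(11)[OF f] by auto
qed

lemma fhom_id: "fhom id"
  by (simp add: fhom_def)

definition ac_subfield :: "'a :: field set \<Rightarrow> bool" where
  "ac_subfield \<kappa> \<longleftrightarrow> is_sf \<kappa> \<and> (\<forall>x. alg_over \<kappa> x \<longrightarrow> x \<in> \<kappa>)"

text \<open>For an algebraically closed \<open>\<kappa>\<close>, not belonging to \<open>\<kappa>\<close> is the same as being transcendental.\<close>

definition generic :: "'a :: field set \<Rightarrow> 'a \<Rightarrow> bool" where
  "generic \<kappa> u \<longleftrightarrow> u \<notin> \<kappa> \<and> (\<forall>F x. is_sf F \<longrightarrow> \<kappa> \<subseteq> F \<longrightarrow> u \<in> F \<longrightarrow> alg_over F x)"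

lemma ac_image_not_algebraic:
  fixes h :: "'a :: alg_closed_field \<Rightarrow> 'b :: field"
  assumes \<kappa>: "ac_subfield \<kappa>" and h: "fhom h" and v: "v \<notin> h ` \<kappa>"
  shows "\<not> alg_over (h ` \<kappa>) v"
proof
  assume "alg_over (h ` \<kappa>) v"
  then obtain p where p: "p \<noteq> 0" "\<And>i. coeff p i \<in> h ` \<kappa>" "poly p v = 0"
    by (auto simp: alg_over_def)
  have "inj h" using fhomD(11)[OF h] by (auto intro: injI)
  define p0 where "p0 = map_poly (inv_into UNIV h) p"
  have inv: "inv_into UNIV h (h c) = c" for c using \<open>inj h\<close> by simp
  have "inv_into UNIV h 0 = 0" using inv[of 0] fhomD(4)[OF h] by simp
  then have c: "coeff p0 i \<in> \<kappa>" "h (coeff p0 i) = coeff p i" for i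
    using p(2)[of i] inv by (auto simp: p0_def coeff_map_poly)
  have "map_poly h p0 = p" using c by (intro poly_eqI) (simp add: coeff_map_poly fhomD[OF h])
  moreover have "p0 \<noteq> 0" using p(1) \<open>map_poly h p0 = p\<close> by auto
  ultimately obtain r where r: "poly p0 r = 0" "v = h r"
    using root_of_map_poly_fhom[OF h] p(3) by blast
  then have "alg_over \<kappa> r" using c(1) \<open>p0 \<noteq> 0\<close> by (auto simp: alg_over_def)
  then show False using \<kappa> v r(2) by (auto simp: ac_subfield_def)
qed

text \<open>A transcendental element may be sent to any transcendental element, and the result
  extends to the whole field, which is algebraic over \<kappa>(u). The target field may be
  different, which allows expansions into power series.\<close>

lemma generic_hom:
  fixes h :: "'a :: alg_closed_field \<Rightarrow> 'b :: alg_closed_field"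
  assumes \<kappa>: "ac_subfield \<kappa>" and u: "generic \<kappa> u" and h: "fhom h" and v: "v \<notin> h ` \<kappa>"
  shows "\<exists>\<Phi>. fhom \<Phi> \<and> \<Phi> u = v \<and> (\<forall>c\<in>\<kappa>. \<Phi> c = h c)"
proof -
  let ?G = "{(c, h c) |c. c \<in> \<kappa>}"
  have dom: "Domain ?G = \<kappa>" "Range ?G = h ` \<kappa>" by auto
  have G: "hom_graph ?G" using hom_graph_pair[OF fhom_id h] \<kappa> by (simp add: ac_subfield_def)
  have "\<not> alg_over (Domain ?G) u" using \<kappa> u by (auto simp: ac_subfield_def generic_def dom)
  moreover have "\<not> alg_over (Range ?G) v"
    unfolding dom by (rule ac_image_not_algebraic[OF \<kappa> h v])
  ultimately obtain G' where G': "hom_graph G'" "?G \<subseteq> G'" "(u, v) \<in> G'"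
    using hom_graph_extend_transcendental[OF G] by blast
  have "\<kappa> \<subseteq> Domain G'" "u \<in> Domain G'" using G'(2,3) by auto
  then have "alg_over (Domain G') x" for x
    using u hom_graph_Domain[OF G'(1)] by (auto simp: generic_def)
  from hom_graph_extend_total[OF G'(1) this] obtain \<Phi>
    where "fhom \<Phi>" "\<And>x y. (x, y) \<in> G' \<Longrightarrow> \<Phi> x = y" by blast
  then show ?thesis using G' by blast
qed

locale generic_setup =
  fixes \<kappa> :: "'a :: alg_closed_field set" and z :: "nat \<Rightarrow> 'a"
  assumes \<kappa>: "ac_subfield \<kappa>" and z: "zsys z" and z_in: "z n \<in> \<kappa>"
begin

lemma \<kappa>_sf: "is_sf \<kappa>" using \<kappa> by (simp add: ac_subfield_def)

lemma generic_child:
  assumes u: "generic \<kappa> u" and v: "v ^ 2 = u + 1"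
  shows "generic \<kappa> v"
proof -
  have uv: "u = v ^ 2 - 1" using v by simp
  have "u \<in> F" if "is_sf F" "v \<in> F" for F
    unfolding uv using that by (intro is_sfD)
  then show ?thesis using u \<kappa>_sf by (auto simp: generic_def)
qed

lemma generic_parent_in:
  assumes "is_sf F" "v \<in> F" "v ^ 2 = u + 1" shows "u \<in> F"
proof -
  have "u = v ^ 2 - 1" using assms(3) by simp
  then show ?thesis using assms(1,2) by (simp add: is_sfD)
qed

lemma generic_flip:
  assumes u: "generic \<kappa> u" and v: "v ^ 2 = u + 1"
  shows "\<exists>h\<in>Gal (insert u \<kappa>). h v = - v"
proof -
  note v' = generic_child[OF u v]
  have "- v \<notin> \<kappa>" using v' is_sfD(4)[OF \<kappa>_sf, of "- v"] by (auto simp: generic_def)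
  then obtain h where h: "fhom h" "h v = - v" "\<forall>c\<in>\<kappa>. h c = c"
    using generic_hom[OF \<kappa> v', of id "- v"] by (auto simp: fhom_def)
  have "u = v ^ 2 - 1" using v by simp
  then have hu: "h u = u" by (simp add: fhomD[OF h(1)] h(2))
  have "alg_over {x. h x = x} x" for x
    using u is_sf_fixed[OF h(1)] h(3) hu by (auto simp: generic_def)
  then have "h \<in> Gal {x. h x = x}" by (intro Gal_I h(1)) auto
  then have "h \<in> Gal (insert u \<kappa>)" using h(3) hu by (auto simp: Gal_def)
  then show ?thesis using h(2) by blast
qed

text \<open>Inertia at the place \<open>\<alpha> = 1\<close>, where \<open>\<alpha>\<close> is the label of \<open>[La]\<close>: after the substitution
  \<open>\<alpha> = 1 + X\<close> all labels above \<open>[La]\<close> become power series, whereas the labels of the children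
  of \<open>[Lb]\<close> are square roots of \<open>- X\<close>.\<close>

lemma inertia:
  assumes \<rho>: "good z \<rho>" and u: "generic \<kappa> (lab \<rho> [])"
  shows "\<exists>h\<in>Gal (insert (lab \<rho> []) \<kappa>). (\<forall>w. h (lab \<rho> (La # w)) = lab \<rho> (La # w)) \<and>
    h (lab \<rho> [Lb, La]) = - lab \<rho> [Lb, La]"
proof -
  have child: "lab \<rho> (w @ [c]) ^ 2 = lab \<rho> w + 1" for w c by (rule goodD(3)[OF z \<rho>])
  define \<alpha> where "\<alpha> = lab \<rho> [La]"
  have \<alpha>2: "\<alpha> ^ 2 = lab \<rho> [] + 1" using child[of "[]" La] by (simp add: \<alpha>_def)
  note \<alpha> = generic_child[OF u \<alpha>2]
  let ?e = "\<lambda>f. to_ac (fps_to_fls f) :: 'a fls alg_closure"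
  define c0 :: "'a \<Rightarrow> 'a fls alg_closure" where "c0 c = ?e (fps_const c)" for c
  have c0: "fhom c0"
    by (simp add: fhom_def c0_def fls_plus_const fls_const_mult_const flip: to_ac_add to_ac_mult)
  have "?e (1 + fps_X) \<notin> c0 ` \<kappa>"
  proof
    assume "?e (1 + fps_X) \<in> c0 ` \<kappa>"
    then obtain c :: 'a where "1 + fps_X = fps_const c"
      by (auto simp: c0_def simp del: fps_to_fls_plus fps_const_to_fls)
    then have "(1 + fps_X) $ 1 = (fps_const c) $ 1" by simp
    then show False by simp
  qed
  from generic_hom[OF \<kappa> \<alpha> c0 this] obtain \<Phi>
    where \<Phi>: "fhom \<Phi>" "\<Phi> \<alpha> = ?e (1 + fps_X)" "\<And>c. c \<in> \<kappa> \<Longrightarrow> \<Phi> c = c0 c" by blast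
  \<comment> \<open>The subfield of all elements whose expansion at the place is a Laurent series.
    It contains \<kappa>, \<alpha> and, by the next claim, the whole tree above \<alpha>.\<close>
  define F where "F = {x. \<Phi> x \<in> range to_ac}"
  have "fhom (to_ac :: 'a fls \<Rightarrow> _)" by (simp add: fhom_def)
  then have F: "is_sf F" unfolding F_def by (intro is_sf_vimage \<Phi> is_sf_range)
  have \<kappa>F: "\<kappa> \<subseteq> F" using \<Phi>(3) by (auto simp: F_def c0_def)
  have "\<exists>f. \<Phi> (lab \<rho> (La # w)) = ?e f \<and> f $ 0 \<noteq> 0 \<and> f $ 0 \<noteq> - 1" for w
  proof (induction w rule: rev_induct)
    case Nil
    have "(1 + fps_X) $ 0 \<noteq> (0 :: 'a)" "(1 + fps_X) $ 0 \<noteq> (- 1 :: 'a)"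
      using zsysD(4)[OF z] by (auto dest: sym)
    then show ?case using \<Phi>(2) unfolding \<alpha>_def by blast
  next
    case (snoc c w)
    then obtain f where f: "\<Phi> (lab \<rho> (La # w)) = ?e f" "f $ 0 \<noteq> 0" "f $ 0 \<noteq> - 1" by blast
    have "(f + 1) $ 0 \<noteq> 0" using f(3) by (simp add: eq_neg_iff_add_eq_0)
    then obtain g where g: "g ^ 2 = f + 1" using fps_square_root_exists[OF zsysD(3)[OF z]] by blast
    have "\<Phi> (lab \<rho> (La # w @ [c])) ^ 2 = \<Phi> (lab \<rho> (La # w @ [c]) ^ 2)" by (simp add: fhomD[OF \<Phi>(1)])
    also have "\<dots> = ?e f + 1"
      using child[of "La # w" c] f(1) by (simp add: fhomD[OF \<Phi>(1)])
    also have "\<dots> = ?e g ^ 2"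
      by (simp add: g flip: to_ac_power fps_to_fls_power)
    finally have "\<Phi> (lab \<rho> (La # w @ [c])) = ?e g \<or> \<Phi> (lab \<rho> (La # w @ [c])) = ?e (- g)"
      by (simp add: power2_eq_iff)
    \<comment> \<open>For both signs of the root the constant term avoids the postcritical values 0
      and -1, so that adding 1 gives a unit again at the next level.\<close>
    moreover have "g $ 0 \<noteq> 0 \<and> g $ 0 \<noteq> 1 \<and> g $ 0 \<noteq> - 1"
    proof -
      have "(g $ 0) ^ 2 = f $ 0 + 1" using arg_cong[OF g, of "\<lambda>f. f $ 0"] by (simp add: power2_eq_square)
      moreover have "f $ 0 + 1 \<noteq> 0" using f(3) by (simp add: eq_neg_iff_add_eq_0)
      ultimately show ?thesis using f(2) by auto
    qed
    moreover have "(- g) $ 0 \<noteq> 0 \<and> (- g) $ 0 \<noteq> - 1" if "g $ 0 \<noteq> 0 \<and> g $ 0 \<noteq> 1"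
      using that by simp
    ultimately show ?case by blast
  qed
  then have labF: "lab \<rho> (La # w) \<in> F" for w unfolding F_def by blast
  then have \<alpha>F: "\<alpha> \<in> F" by (simp add: \<alpha>_def)
  define \<delta> where "\<delta> = lab \<rho> [Lb, La]"
  have \<delta>2: "\<delta> ^ 2 = 1 - \<alpha>"
    using child[of "[Lb]" La] goodD(4)[OF z \<rho>, of "[]"] by (simp add: \<delta>_def \<alpha>_def)
  have "\<delta> \<notin> F"
  proof
    assume "\<delta> \<in> F"
    then obtain y where y: "\<Phi> \<delta> = to_ac y" by (auto simp: F_def)
    have "to_ac (y ^ 2) = \<Phi> (\<delta> ^ 2)" by (simp add: y fhomD[OF \<Phi>(1)])
    also have "\<dots> = to_ac (- fls_X)"
      by (simp add: \<delta>2 fhomD[OF \<Phi>(1)] \<Phi>(2))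
    finally have "y ^ 2 = - fls_X" by (simp only: to_ac_eq_iff)
    then have "fls_subdegree (y ^ 2) = 1" by simp
    then have "2 * fls_subdegree y = 1" by (simp add: fls_subdegree_pow)
    then show False by presburger
  qed
  moreover have "\<delta> * \<delta> \<in> F"
    using is_sfD(7)[OF F is_sfD(2)[OF F] \<alpha>F] \<delta>2 by (simp add: power2_eq_square)
  moreover have "alg_over F x" for x using \<alpha> F \<kappa>F \<alpha>F by (auto simp: generic_def)
  ultimately obtain h where h: "h \<in> Gal F" "h \<delta> = - \<delta>" using Gal_quadratic[OF F] by blast
  have "insert (lab \<rho> []) \<kappa> \<subseteq> F" using \<kappa>F generic_parent_in[OF F \<alpha>F \<alpha>2] by simp
  then have "h \<in> Gal (insert (lab \<rho> []) \<kappa>)" using h(1) Gal_mono by blast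
  then show ?thesis using h labF GalD(3)[OF h(1)] unfolding \<delta>_def by blast
qed

section \<open>The geometric monodromy group\<close>

text \<open>The full preimage, in the automorphism group of the tree, of the Galois action on the
  first \<open>n\<close> levels.\<close>

definition G_lev :: "nat \<Rightarrow> (node \<Rightarrow> nat \<Rightarrow> 'a) \<Rightarrow> (node \<Rightarrow> node) set" where
  "G_lev n \<rho> = {\<sigma> \<in> tree_aut. \<exists>g\<in>Gal (insert (lab \<rho> []) \<kappa>).
     \<forall>w. length w \<le> n \<longrightarrow> \<sigma> w = act \<rho> g w}"

context
  fixes \<rho>
  assumes \<rho>: "good z \<rho>" and u: "generic \<kappa> (lab \<rho> [])"
begin

abbreviation "\<rho>a \<equiv> \<lambda>w. \<rho> (La # w)"
abbreviation "\<rho>b \<equiv> \<lambda>w. \<rho> (Lb # w)"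

lemma lab_sub: "lab (\<lambda>w. \<rho> (c # w)) w = lab \<rho> (c # w)"
  by (simp add: lab_def)

lemma Gal_root: "g \<in> Gal (insert (lab \<rho> []) \<kappa>) \<Longrightarrow> g \<in> Gal {lab \<rho> []}"
  using Gal_mono[of "{lab \<rho> []}"] by blast

lemma action_B: "g \<in> Gal (insert (lab \<rho> []) \<kappa>) \<Longrightarrow> act \<rho> g \<in> B_inf"
  by (rule P_induced_action_eq_1[OF z \<rho> Gal_root]) (auto intro: GalD(3) z_in)

lemma action_G_lev: "g \<in> Gal (insert (lab \<rho> []) \<kappa>) \<Longrightarrow> act \<rho> g \<in> G_lev n \<rho>"
  using action_B B_infD(2) by (auto simp: G_lev_def)

lemma tsub_G_lev: "tsub (G_lev n \<rho>)"
  unfolding tsub_def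
proof (intro conjI ballI)
  show "G_lev n \<rho> \<subseteq> tree_aut" by (auto simp: G_lev_def)
  show "id \<in> G_lev n \<rho>"
    using action_G_lev[OF Gal_id] by (simp add: induced_action_id[OF z \<rho>])
next
  fix \<sigma> \<tau> assume "\<sigma> \<in> G_lev n \<rho>" "\<tau> \<in> G_lev n \<rho>"
  then obtain g h where g: "\<sigma> \<in> tree_aut" "g \<in> Gal (insert (lab \<rho> []) \<kappa>)"
      "\<And>w. length w \<le> n \<Longrightarrow> \<sigma> w = act \<rho> g w"
    and h: "\<tau> \<in> tree_aut" "h \<in> Gal (insert (lab \<rho> []) \<kappa>)"
      "\<And>w. length w \<le> n \<Longrightarrow> \<tau> w = act \<rho> h w"
    by (auto simp: G_lev_def)
  have "(\<sigma> \<circ> \<tau>) w = act \<rho> (g \<circ> h) w" if "length w \<le> n" for w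
    using that tree_aut_length[OF h(1), of w] g(3)[of "\<tau> w"] h(3)[of w]
    by (simp add: induced_action_comp[OF z \<rho> Gal_root[OF g(2)] Gal_root[OF h(2)]])
  then show "\<sigma> \<circ> \<tau> \<in> G_lev n \<rho>"
    using tree_aut_comp[OF g(1) h(1)] Gal_comp[OF g(2) h(2)] by (auto simp: G_lev_def)
next
  fix \<sigma> assume "\<sigma> \<in> G_lev n \<rho>"
  then obtain g where g: "\<sigma> \<in> tree_aut" "g \<in> Gal (insert (lab \<rho> []) \<kappa>)"
      "\<And>w. length w \<le> n \<Longrightarrow> \<sigma> w = act \<rho> g w"
    by (auto simp: G_lev_def)
  have "tinv \<sigma> w = act \<rho> (inv_into UNIV g) w" if "length w \<le> n" for w
  proof -
    have "length (tinv \<sigma> w) \<le> n" using that tree_aut_length[OF tree_aut_inv[OF g(1)], of w] by simp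
    from g(3)[OF this] have "w = act \<rho> g (tinv \<sigma> w)"
      by (simp add: tree_aut_inv_comp[OF g(1)])
    then show ?thesis
      using tree_aut_inv_comp(4)[OF induced_action_tree_aut[OF z \<rho> Gal_root[OF g(2)]], of "tinv \<sigma> w"]
      by (simp add: induced_action_inv[OF z \<rho> Gal_root[OF g(2)]])
  qed
  then show "tinv \<sigma> \<in> G_lev n \<rho>"
    using tree_aut_inv[OF g(1)] Gal_inv[OF g(2)] by (auto simp: G_lev_def)
qed

lemma K_lev_G_lev: "K_lev n \<subseteq> G_lev n \<rho>"
  using induced_action_id[OF z \<rho>] Gal_id by (auto simp: G_lev_def K_lev_def intro!: bexI[of _ id])

lemma action_br:
  assumes g: "g \<in> Gal (insert (lab \<rho> []) \<kappa>)" and fixed: "g (lab \<rho> [La]) = lab \<rho> [La]"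
  shows "act \<rho> g =
    br False (act \<rho>a g) (act \<rho>b g)"
proof
  have fb: "g (lab \<rho> [Lb]) = lab \<rho> [Lb]"
    using fixed goodD(4)[OF z \<rho>, of "[]"] by (simp add: fhomD[OF GalD(1)[OF g]])
  have a: "g \<in> Gal {lab \<rho>a []}" and b: "g \<in> Gal {lab \<rho>b []}"
    using g fixed fb by (auto simp: Gal_def lab_sub)
  note ia = induced_action[OF z good_subtree[OF z \<rho>] a] and ib = induced_action[OF z good_subtree[OF z \<rho>] b]
  fix w
  show "act \<rho> g w = br False (act \<rho>a g) (act \<rho>b g) w"
  proof (rule induced_actionI[OF z \<rho> Gal_root[OF g]])
    show "length (br False (act \<rho>a g) (act \<rho>b g) w) = length w"
      by (cases w rule: node_cases) (simp_all add: ia ib)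
    show "lab \<rho> (br False (act \<rho>a g) (act \<rho>b g) w) = g (lab \<rho> w)"
      using ia(2) ib(2) GalD(3)[OF g]
      by (cases w rule: node_cases) (simp_all add: lab_sub)
  qed
qed

lemma generic_sub: "generic \<kappa> (lab (\<lambda>w. \<rho> (c # w)) [])"
  using generic_child[OF u] goodD(3)[OF z \<rho>, of "[]" c] by (simp add: lab_sub)

lemma Gal_sub:
  assumes g: "g \<in> Gal (insert (lab (\<lambda>w. \<rho> (c # w)) []) \<kappa>)"
  shows "g \<in> Gal (insert (lab \<rho> []) \<kappa>)" "g (lab \<rho> [La]) = lab \<rho> [La]" "g (lab \<rho> [Lb]) = lab \<rho> [Lb]"
proof -
  note g1 = GalD(1)[OF g]
  have gc: "g (lab \<rho> [c]) = lab \<rho> [c]" using GalD(3)[OF g] by (simp add: lab_sub)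
  then show "g (lab \<rho> [La]) = lab \<rho> [La]" "g (lab \<rho> [Lb]) = lab \<rho> [Lb]"
    using goodD(4)[OF z \<rho>, of "[]"] by (cases c; simp add: fhomD[OF g1])+
  have "lab \<rho> [] = lab \<rho> [c] ^ 2 - 1" using goodD(3)[OF z \<rho>, of "[]" c] by simp
  then have "g (lab \<rho> []) = lab \<rho> []" using gc by (simp add: fhomD[OF g1])
  then show "g \<in> Gal (insert (lab \<rho> []) \<kappa>)" using g by (auto simp: Gal_def)
qed

lemma geometric_step:
  assumes IHa: "B_inf \<subseteq> G_lev n \<rho>a" and IHb: "B_inf \<subseteq> G_lev n \<rho>b"
  shows "B_inf \<subseteq> G_lev (Suc n) \<rho>"
proof -
  let ?H = "G_lev (Suc n) \<rho>"
  note H = tsub_G_lev[of "Suc n"]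
  have KH: "K_lev (Suc n) \<subseteq> ?H" by (rule K_lev_G_lev)
  let ?ia = "act \<rho>a" and ?ib = "act \<rho>b"
  have pair: "br False (?ia g) (?ib g) \<in> ?H" "?ia g \<in> B_inf" "?ib g \<in> B_inf" "QQ (?ib g) [] = QQ (?ia g) []"
    if g: "g \<in> Gal (insert (lab \<rho> []) \<kappa>)" "g (lab \<rho> [La]) = lab \<rho> [La]" for g
  proof -
    have t: "?ia g \<in> tree_aut" "?ib g \<in> tree_aut"
    proof -
      have "g (lab \<rho> [Lb]) = lab \<rho> [Lb]"
        using g goodD(4)[OF z \<rho>, of "[]"] by (simp add: fhomD[OF GalD(1)[OF g(1)]])
      then have "g \<in> Gal {lab \<rho>a []}" "g \<in> Gal {lab \<rho>b []}"
        using g by (auto simp: Gal_def lab_sub)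
      then show "?ia g \<in> tree_aut" "?ib g \<in> tree_aut"
        using induced_action_tree_aut[OF z good_subtree[OF z \<rho>]] by blast+
    qed
    have B: "br False (?ia g) (?ib g) \<in> B_inf" using action_B[OF g(1)] by (simp add: action_br[OF g])
    then show "?ia g \<in> B_inf" "?ib g \<in> B_inf" "QQ (?ib g) [] = QQ (?ia g) []"
      using br_in_B_iff[OF t, of False] by auto
    show "br False (?ia g) (?ib g) \<in> ?H" using action_G_lev[OF g(1)] by (simp add: action_br[OF g])
  qed
  have lift: "tinv \<sigma> \<circ> \<tau> \<in> K_lev n" if "\<sigma> \<in> tree_aut" "\<tau> \<in> tree_aut" "\<And>w. length w \<le> n \<Longrightarrow> \<tau> w = \<sigma> w" for \<sigma> \<tau>
    using that by (auto simp: K_lev_def tree_aut_comp tree_aut_inv tree_aut_inv_comp)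
  have right: "N_inf \<subseteq> right_part ?H"
  proof -
    \<comment> \<open>By \<open>IHb\<close>, \<open>y\<close> agrees up to level \<open>n\<close>
      with an automorphism over \<kappa>(- alpha). Whatever this automorphism does on the left
      subtree cancels when an element supported on the right is conjugated.\<close>
    have normal: "y \<circ> x \<circ> tinv y \<in> right_part ?H" if x: "x \<in> right_part ?H" and y: "y \<in> B_inf" for x y
    proof -
      from y IHb obtain g where g: "g \<in> Gal (insert (lab \<rho>b []) \<kappa>)" "\<And>w. length w \<le> n \<Longrightarrow> y w = ?ib g w"
        by (auto simp: G_lev_def)
      note p = pair[OF Gal_sub(1,2)[OF g(1)]]
      note t = B_infD(2)[OF p(2)] B_infD(2)[OF p(3)] B_infD(2)[OF y]
      have "br False id (tinv (?ib g) \<circ> y) \<in> ?H"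
        using br_K_lev[OF K_lev_id lift[OF t(2,3) g(2)]] KH by blast
      from tsubD(3)[OF H p(1) this] have 1: "br False (?ia g) y \<in> ?H"
        by (simp add: br_comp tree_aut_inv_comp[OF t(2)] flip: comp_assoc)
      have "br False (?ia g) y \<circ> br False id x \<circ> tinv (br False (?ia g) y) \<in> ?H"
        using x by (intro tsubD(3)[OF H] tsubD(4)[OF H] 1) (simp add: right_part_def)
      then have "br False id (y \<circ> x \<circ> tinv y) \<in> ?H"
        by (simp add: inv_br t br_comp tree_aut_inv_comp)
      then show ?thesis using x t by (simp add: right_part_def tree_aut_comp tree_aut_inv)
    qed
    obtain h where h: "h \<in> Gal (insert (lab \<rho> []) \<kappa>)" "\<And>w. h (lab \<rho> (La # w)) = lab \<rho> (La # w)"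
        "h (lab \<rho> [Lb, La]) = - lab \<rho> [Lb, La]"
      using inertia[OF \<rho> u] by blast
    note p = pair[OF h(1,2)]
    have hb: "h \<in> Gal {lab \<rho>b []}"
      using h(2)[of "[]"] goodD(4)[OF z \<rho>, of "[]"] h(1) by (auto simp: Gal_def lab_sub fhomD)
    have ha: "h \<in> Gal {lab \<rho>a []}"
      using h(2)[of "[]"] h(1) by (auto simp: Gal_def lab_sub)
    have "?ia h = id"
    proof
      fix w show "?ia h w = id w"
        by (rule induced_actionI[OF z good_subtree[OF z \<rho>] ha]) (simp_all add: lab_sub h(2))
    qed
    then have \<tau>: "?ib h \<in> right_part ?H" "?ib h \<in> N_inf"
      using p by (simp_all add: right_part_def N_inf_def B_infD)
    have "Par (?ib h) [] \<noteq> 0"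
    proof
      assume "Par (?ib h) [] = 0"
      then have "?ib h [La] = [La]"
        using tree_autD(2)[OF B_infD(2)[OF p(3)]] by (simp add: Par_def split: if_splits)
      then have "h (lab \<rho> [Lb, La]) = lab \<rho> [Lb, La]"
        using induced_action(2)[OF z good_subtree[OF z \<rho>] hb, of "[La]"] by (simp add: lab_sub)
      then have "lab \<rho> [Lb, La] = lab \<rho> [Lb, Lb]" using h(3) goodD(4)[OF z \<rho>, of "[Lb]"] by simp
      then show False using lab_sibling_neq[OF z \<rho>, of "[Lb]"] by simp
    qed
    from N_inf_subset[OF tsub_right_part[OF H] K_lev_right_part[OF KH] normal \<tau> this] show ?thesis .
  qed
  have main: "\<sigma> \<in> ?H" if \<sigma>: "\<sigma> \<in> B_inf" "Par \<sigma> [] = 0" for \<sigma>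
  proof -
    obtain sw s t where st: "s \<in> tree_aut" "t \<in> tree_aut" "\<sigma> = br sw s t"
      using B_infD(2)[OF \<sigma>(1)] by (rule tree_aut_br)
    then have sw: "sw = False" using \<sigma>(2) by (cases sw) (simp_all add: Par_br_Nil)
    have B: "s \<in> B_inf" "t \<in> B_inf" "QQ t [] = QQ s []"
      using br_in_B_iff[OF st(1,2), of False] \<sigma>(1) by (simp_all add: st(3) sw)
    from B(1) IHa obtain g where g: "g \<in> Gal (insert (lab \<rho>a []) \<kappa>)" "\<And>w. length w \<le> n \<Longrightarrow> s w = ?ia g w"
      by (auto simp: G_lev_def)
    note p = pair[OF Gal_sub(1,2)[OF g(1)]]
    note t = B_infD(2)[OF p(2)] B_infD(2)[OF p(3)]
    \<comment> \<open>\<open>k\<close> is trivial up to level \<open>n\<close>, but its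
      \<open>QQ\<close> need not vanish. Applying it to both subtrees turns the left entry into
      exactly \<open>s\<close> and keeps the two values of \<open>QQ\<close> equal, so the remaining
      discrepancy \<open>v\<close> on the right lies in \<open>N_inf\<close>.\<close>
    define k where "k = tinv (?ia g) \<circ> s"
    have k: "k \<in> K_lev n" "k \<in> B_inf" "QQ k [] = QQ s [] - QQ (?ia g) []"
      using lift[OF t(1) st(1) g(2)] p B by (simp_all add: k_def B_comp B_inv B_Q_comp B_Q_inv)
    have "br False (?ia g) (?ib g) \<circ> br False k k \<in> ?H"
      using tsubD(3)[OF H p(1)] br_K_lev[OF k(1) k(1)] KH by blast
    then have 1: "br False s (?ib g \<circ> k) \<in> ?H"
      by (simp add: br_comp k_def tree_aut_inv_comp[OF t(1)] flip: comp_assoc)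
    define v where "v = tinv (?ib g \<circ> k) \<circ> t"
    have "v \<in> N_inf"
      using p k B by (simp add: v_def N_inf_def B_comp B_inv B_Q_comp B_Q_inv)
    then have "br False id v \<in> ?H" using right by (auto simp: right_part_def)
    from tsubD(3)[OF H 1 this] show ?thesis
      using tree_aut_inv_comp[OF tree_aut_comp[OF t(2) B_infD(2)[OF k(2)]]]
      by (simp add: st(3) sw br_comp v_def flip: comp_assoc)
  qed
  show ?thesis
  proof
    fix \<sigma> assume \<sigma>: "\<sigma> \<in> B_inf"
    show "\<sigma> \<in> ?H"
    proof (cases "Par \<sigma> [] = 0")
      case False
      \<comment> \<open>An automorphism with alpha sent to - alpha reduces the exchange of the two
        subtrees to the case already treated.\<close>
      obtain h where h: "h \<in> Gal (insert (lab \<rho> []) \<kappa>)" "h (lab \<rho> [La]) = - lab \<rho> [La]"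
        using generic_flip[OF u, of "lab \<rho> [La]"] goodD(3)[OF z \<rho>, of "[]" La] by auto
      define a where "a = act \<rho> h"
      have a: "a \<in> B_inf" "a \<in> ?H" using action_B[OF h(1)] action_G_lev[OF h(1)] by (simp_all add: a_def)
      note at = B_infD(2)[OF a(1)]
      have "a [La] = [Lb]"
        unfolding a_def
        by (rule induced_actionI[OF z \<rho> Gal_root[OF h(1)]])
          (use h(2) goodD(4)[OF z \<rho>, of "[]"] in simp_all)
      then have pa: "Par a [] = Suc 0"
        using tree_autD(2)[OF at] by (simp add: Par_def)
      from B_infD(2)[OF \<sigma>] have "\<sigma> [Lb] = [La]" "\<sigma> [La] = [Lb]"
        by (cases rule: Par_cases[where x = "[]"]; use False tree_autD(2)[OF B_infD(2)[OF \<sigma>]] in force)+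
      moreover from at have "a [Lb] = [La]" "a [La] = [Lb]"
        by (cases rule: Par_cases[where x = "[]"]; use pa tree_autD(2)[OF at] in force)+
      ultimately have "(tinv a \<circ> \<sigma>) [La] = [La]" "(tinv a \<circ> \<sigma>) [Lb] = [Lb]"
        using tree_aut_inv_comp(4)[OF at, of "[La]"] tree_aut_inv_comp(4)[OF at, of "[Lb]"] by simp_all
      moreover have B: "tinv a \<circ> \<sigma> \<in> B_inf" using a \<sigma> by (simp add: B_comp B_inv)
      ultimately have "Par (tinv a \<circ> \<sigma>) [] = 0"
        using tree_autD(2)[OF B_infD(2)[OF B]] by (simp add: Par_def)
      from tsubD(3)[OF H a(2) main[OF B this]] show ?thesis
        by (simp add: tree_aut_inv_comp[OF at] flip: comp_assoc)
    qed (rule main[OF \<sigma>])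
  qed
qed

end

theorem geometric_monodromy:
  "good z \<rho> \<Longrightarrow> generic \<kappa> (lab \<rho> []) \<Longrightarrow> B_inf \<subseteq> G_lev n \<rho>"
proof (induction n arbitrary: \<rho>)
  case 0
  have "B_inf \<subseteq> K_lev 0"
    using tree_autD(2) B_infD(2) by (auto simp: K_lev_def)
  then show ?case using K_lev_G_lev[OF 0] by blast
next
  case (Suc n)
  show ?case
    by (rule geometric_step[OF Suc.prems])
      (rule Suc.IH[OF good_subtree[OF z Suc.prems(1)] generic_sub[OF Suc.prems]])+
qed

end

section \<open>The constant field: degree of the cyclotomic extension and values of
  \<open>P\<close>\<close>

section \<open>Generated subfields and dimensions\<close>

lemma ring_of_type_algebra_simps [simp]:
  "carrier (ring_of_type_algebra :: 'a :: field ring) = UNIV"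
  "\<one>\<^bsub>(ring_of_type_algebra :: 'a ring)\<^esub> = 1" "\<zero>\<^bsub>(ring_of_type_algebra :: 'a ring)\<^esub> = 0"
  "x \<oplus>\<^bsub>(ring_of_type_algebra :: 'a ring)\<^esub> y = x + y"
  "x \<otimes>\<^bsub>(ring_of_type_algebra :: 'a ring)\<^esub> y = x * y"
  by (simp_all add: ring_of_type_algebra_def)

lemma a_inv_type_algebra [simp]: "\<ominus>\<^bsub>ring_of_type_algebra\<^esub> x = - (x :: 'a :: field)"
proof -
  interpret R: field "ring_of_type_algebra :: 'a ring" by (rule field_from_type_algebra)
  show ?thesis by (rule R.minus_equality) simp_all
qed

lemma m_inv_type_algebra [simp]:
  assumes "(x :: 'a :: field) \<noteq> 0"
  shows "inv\<^bsub>ring_of_type_algebra\<^esub> x = inverse x"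
proof -
  interpret R: field "ring_of_type_algebra :: 'a ring" by (rule field_from_type_algebra)
  show ?thesis using assms by (intro R.comm_inv_char) simp_all
qed

lemma is_sf_adjoin: "is_sf (adjoin K S)" for K :: "'a :: field set"
proof -
  let ?R = "ring_of_type_algebra :: 'a ring"
  interpret R: field ?R by (rule field_from_type_algebra)
  have A: "1 \<in> adjoin K S" "\<And>x y. x \<in> adjoin K S \<Longrightarrow> y \<in> adjoin K S \<Longrightarrow> x + y \<in> adjoin K S"
    "\<And>x y. x \<in> adjoin K S \<Longrightarrow> y \<in> adjoin K S \<Longrightarrow> x * y \<in> adjoin K S" "\<And>x. x \<in> adjoin K S \<Longrightarrow> - x \<in> adjoin K S"
    unfolding adjoin_def
    using generate_field.one[of ?R "K \<union> S"] generate_field.eng_add[of _ ?R "K \<union> S"]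
      generate_field.eng_mult[of _ ?R "K \<union> S"] generate_field.a_inv[of _ ?R "K \<union> S"] by simp_all
  have 0: "0 \<in> adjoin K S" using A(2)[OF A(1) A(4)[OF A(1)]] by simp
  have "inverse x \<in> adjoin K S" if "x \<in> adjoin K S" for x
  proof (cases "x = 0")
    case False
    then show ?thesis
      using that generate_field.m_inv[of x ?R "K \<union> S"] by (simp add: adjoin_def)
  qed (simp add: 0)
  then show ?thesis using A 0 by (simp add: is_sf_def)
qed

lemma adjoin_incl: "K \<subseteq> adjoin K S" "S \<subseteq> adjoin K S"
  unfolding adjoin_def by (auto intro: generate_field.incl)

lemma adjoin_least:
  assumes "is_sf E" "K \<subseteq> E" "S \<subseteq> E"
  shows "adjoin K S \<subseteq> E"
proof
  fix x assume "x \<in> adjoin K S"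
  then show "x \<in> E"
    unfolding adjoin_def
    by (induction rule: generate_field.induct) (use assms is_sfD[OF assms(1)] in auto)
qed

lemma subfield_type_algebra: "is_sf K \<Longrightarrow> subfield K (ring_of_type_algebra :: 'a :: field ring)"
proof -
  assume K: "is_sf K"
  interpret R: field "ring_of_type_algebra :: 'a ring" by (rule field_from_type_algebra)
  have "subring K ring_of_type_algebra"
    by (rule R.subringI) (simp_all add: is_sfD[OF K])
  then show ?thesis
    by (rule R.subfieldI') (auto simp: is_sfD[OF K])
qed

text \<open>A quadratic equation for \<zeta> makes the span of \<zeta> and 1 closed under
  multiplication and inverses, so it contains the generated field; linear independence then bounds
  the length of any basis.\<close>

lemma quadratic_dimension:
  fixes \<zeta> :: "'a :: field"
  assumes K: "is_sf K" and quad: "\<zeta> * \<zeta> = c * \<zeta> + d" "c \<in> K" "d \<in> K"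
    and dim: "ring.dimension ring_of_type_algebra n K (adjoin K {\<zeta>})"
  shows "n \<le> 2"
proof -
  let ?R = "ring_of_type_algebra :: 'a ring"
  interpret R: field ?R by (rule field_from_type_algebra)
  note subK = subfield_type_algebra[OF K]
  obtain Us where Us: "R.independent K Us" "length Us = n" "R.Span K Us = adjoin K {\<zeta>}"
    using R.exists_base[OF subK dim] by blast
  have Us_sub: "set Us \<subseteq> adjoin K {\<zeta>}"
    using R.Span_base_incl[OF subK, of Us] Us(3) by simp
  have one: "R.Span K [1] = K"
  proof -
    have "x \<in> R.Span K [1] \<longleftrightarrow> x \<in> K" for x
      using R.line_extension_mem_iff[of x K 1 "{0}"] by auto
    then show ?thesis by blast
  qed
  have ind1: "R.independent K [1]"
    by (rule R.li_Cons) (simp_all add: R.li_Nil)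
  show ?thesis
  proof (cases "\<zeta> \<in> K")
    case True
    then have "adjoin K {\<zeta>} \<subseteq> K" by (intro adjoin_least[OF K]) auto
    then have "length Us \<le> length [1 :: 'a]"
      using Us_sub one by (intro R.independent_length_le[OF subK Us(1) ind1]) (simp del: R.Span.simps)
    then show ?thesis using Us(2) by simp
  next
    case False
    have mem: "x \<in> R.Span K [\<zeta>, 1] \<longleftrightarrow> (\<exists>k\<in>K. \<exists>v\<in>K. x = k * \<zeta> + v)" for x
    proof -
      have "R.Span K [\<zeta>, 1] = R.line_extension K \<zeta> (R.Span K [1])" by simp
      then show ?thesis
        using R.line_extension_mem_iff[of x K \<zeta> K] by (simp add: one del: R.Span.simps)
    qed
    let ?E = "R.Span K [\<zeta>, 1]"
    have ind2: "R.independent K [\<zeta>, 1]"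
      by (rule R.li_Cons[OF _ _ ind1]) (use False one in \<open>simp_all del: R.Span.simps\<close>)
    have "is_sf ?E"
      unfolding is_sf_def
    proof (intro conjI ballI)
      show "0 \<in> ?E" unfolding mem using is_sfD(1)[OF K] by (intro bexI[of _ 0]) auto
      show "1 \<in> ?E" unfolding mem using is_sfD(1,2)[OF K] by (intro bexI[of _ 0] bexI[of _ 1]) auto
    next
      fix x y assume "x \<in> ?E" "y \<in> ?E"
      then obtain a b a' b' where *: "a \<in> K" "b \<in> K" "a' \<in> K" "b' \<in> K" "x = a * \<zeta> + b" "y = a' * \<zeta> + b'"
        unfolding mem by blast
      show "x + y \<in> ?E" unfolding mem
        by (rule bexI[of _ "a + a'"], rule bexI[of _ "b + b'"]) (use * is_sfD(3)[OF K] in \<open>auto simp: algebra_simps\<close>)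
      have "x * y = a * a' * (\<zeta> * \<zeta>) + (a * b' + a' * b) * \<zeta> + b * b'"
        by (simp add: * algebra_simps)
      also have "\<dots> = (a * a' * c + a * b' + a' * b) * \<zeta> + (a * a' * d + b * b')"
        unfolding quad(1) by (simp add: algebra_simps)
      finally show "x * y \<in> ?E" unfolding mem
        by (intro bexI[of _ "a * a' * c + a * b' + a' * b"] bexI[of _ "a * a' * d + b * b'"])
          (simp_all add: * quad(2,3) is_sfD(3,5)[OF K])
    next
      fix x assume "x \<in> ?E"
      then obtain a b where *: "a \<in> K" "b \<in> K" "x = a * \<zeta> + b" unfolding mem by blast
      show "- x \<in> ?E" unfolding mem
        by (rule bexI[of _ "- a"], rule bexI[of _ "- b"]) (use * is_sfD(4)[OF K] in auto)
      \<comment> \<open>\<open>y\<close> is the conjugate of \<open>x\<close>, obtained by replacing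
        \<zeta> by the other root \<open>c - \<zeta>\<close> of the quadratic equation, and
        \<open>N\<close> is the norm of \<open>x\<close>.\<close>
      define y where "y = (- a) * \<zeta> + (a * c + b)"
      define N where "N = b * (a * c + b) - a * a * d"
      have "x * y = - (a * a) * (\<zeta> * \<zeta>) + a * a * c * \<zeta> + b * (a * c + b)"
        by (simp add: * y_def algebra_simps)
      also have "\<dots> = N" unfolding quad(1) by (simp add: N_def algebra_simps)
      finally have xy: "x * y = N" .
      have NK: "N \<in> K" unfolding N_def by (intro is_sfD(7,3,5)[OF K] * quad)
      show "inverse x \<in> ?E"
      proof (cases "x = 0")
        case True
        then show ?thesis unfolding mem using is_sfD(1)[OF K] by (intro bexI[of _ 0]) auto
      next
        case x0: False
        have "y \<noteq> 0"
        proof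
          assume y0: "y = 0"
          then have "a * \<zeta> = a * c + b" by (simp add: y_def algebra_simps)
          then have "a = 0" using \<open>\<zeta> \<notin> K\<close> is_sfD(8)[OF K, of "a * c + b" a] is_sfD(3,5)[OF K] * quad
            by (metis nonzero_mult_div_cancel_left)
          then show False using y0 x0 * by (simp add: y_def)
        qed
        then have N0: "N \<noteq> 0" using xy x0 by auto
        have "inverse x = y / N" using xy x0 N0 by (simp add: field_simps)
        also have "\<dots> = (- a / N) * \<zeta> + (a * c + b) / N" by (simp add: y_def add_divide_distrib diff_divide_distrib)
        finally show ?thesis unfolding mem
          by (intro bexI[of _ "- a / N"] bexI[of _ "(a * c + b) / N"])
            (simp_all add: NK * quad is_sfD[OF K])
      qed
    qed
    moreover have "K \<subseteq> ?E" unfolding mem subset_eq using is_sfD(1)[OF K] by (metis mult_zero_left add_0)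
    moreover have "\<zeta> \<in> ?E" unfolding mem using is_sfD(1,2)[OF K] by (metis mult_1 add_0_right)
    ultimately have "adjoin K {\<zeta>} \<subseteq> ?E" by (intro adjoin_least) auto
    then have "length Us \<le> length [\<zeta>, 1]"
      using Us_sub by (intro R.independent_length_le[OF subK Us(1) ind2]) blast
    then show ?thesis using Us(2) by simp
  qed
qed

text \<open>Since \<zeta>^4 = -1, the inverse of \<zeta> is - \<zeta>^3. The elements \<zeta>^2,
  \<zeta> + 1/\<zeta> and \<zeta> - 1/\<zeta> are square roots of -1, 2 and -2; if one of them lay
  in k, then \<zeta> would satisfy a quadratic equation over k, against degree 4.\<close>

lemma nonsquares:
  fixes \<zeta> :: "'k :: field alg_closure"
  assumes prim: "primitive_root_of_unity 8 \<zeta>"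
    and dim: "ring.dimension ring_of_type_algebra 4 (range to_ac) (adjoin (range to_ac) {\<zeta>})"
  shows "(c :: 'k) ^ 2 \<noteq> - 1" "c ^ 2 \<noteq> 2" "c ^ 2 \<noteq> - 2"
proof -
  have "fhom (to_ac :: 'k \<Rightarrow> _)" by (simp add: fhom_def)
  then have K: "is_sf (range (to_ac :: 'k \<Rightarrow> _))" by (rule is_sf_range)
  have "\<zeta> ^ 8 = 1" "\<zeta> ^ 4 \<noteq> 1" using prim by (auto simp: primitive_root_of_unity_def)
  moreover have "(\<zeta> ^ 4 - 1) * (\<zeta> ^ 4 + 1) = \<zeta> ^ 8 - 1" by (simp add: algebra_simps flip: power_add)
  ultimately have \<zeta>4: "\<zeta> ^ 4 = - 1" by (simp add: eq_neg_iff_add_eq_0)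
  have no: False if "\<zeta> * \<zeta> = to_ac c * \<zeta> + to_ac d" for c d
    using quadratic_dimension[OF K that _ _ dim] by simp
  have \<zeta>3: "\<zeta> * \<zeta> ^ 3 = - 1" "\<zeta> ^ 3 * \<zeta> ^ 3 = - (\<zeta> * \<zeta>)"
    using \<zeta>4 by (simp_all add: eval_nat_numeral mult.assoc)
  show "c ^ 2 \<noteq> - 1"
  proof
    assume "c ^ 2 = - 1"
    then have "to_ac c ^ 2 = - 1" by (simp flip: to_ac_power)
    then have "to_ac c ^ 2 = (\<zeta> ^ 2) ^ 2" using \<zeta>4 by (simp flip: power_mult)
    then have "(\<zeta> ^ 2) ^ 2 = to_ac c ^ 2" by (rule sym)
    then have "\<zeta> ^ 2 = to_ac c \<or> \<zeta> ^ 2 = to_ac (- c)" unfolding power2_eq_iff by simp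
    then show False using no[of 0 c] no[of 0 "- c"] by (auto simp: power2_eq_square)
  qed
  show "c ^ 2 \<noteq> 2"
  proof
    assume c: "c ^ 2 = 2"
    define s where "s = \<zeta> - \<zeta> ^ 3"
    have "s ^ 2 = \<zeta> * \<zeta> - 2 * (\<zeta> * \<zeta> ^ 3) + \<zeta> ^ 3 * \<zeta> ^ 3"
      by (simp add: s_def power2_eq_square algebra_simps)
    then have "s ^ 2 = to_ac c ^ 2" using c \<zeta>3 by (simp flip: to_ac_power)
    then have "s = to_ac c \<or> s = to_ac (- c)" by (auto simp: power2_eq_iff)
    moreover have "\<zeta> * \<zeta> = s * \<zeta> + (- 1)" using \<zeta>3 by (simp add: s_def algebra_simps)
    ultimately show False using no[of c "- 1"] no[of "- c" "- 1"] by auto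
  qed
  show "c ^ 2 \<noteq> - 2"
  proof
    assume c: "c ^ 2 = - 2"
    define s where "s = \<zeta> + \<zeta> ^ 3"
    have "s ^ 2 = \<zeta> * \<zeta> + 2 * (\<zeta> * \<zeta> ^ 3) + \<zeta> ^ 3 * \<zeta> ^ 3"
      by (simp add: s_def power2_eq_square algebra_simps)
    then have "s ^ 2 = to_ac c ^ 2" using c \<zeta>3 by (simp flip: to_ac_power)
    then have "s = to_ac c \<or> s = to_ac (- c)" by (auto simp: power2_eq_iff)
    moreover have "\<zeta> * \<zeta> = s * \<zeta> + 1" using \<zeta>3 by (simp add: s_def algebra_simps)
    ultimately show False using no[of c 1] no[of "- c" 1] by auto
  qed
qed

section \<open>The rational function field\<close>

text \<open>In p^2 = a q^2 the leading coefficients alone exhibit a square root of a, so a nonsquare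
  of k stays a nonsquare in k(t).\<close>

lemma fract_square_const:
  fixes y :: "'k :: field poly fract"
  assumes "y ^ 2 = Fract [:a:] 1"
  shows "\<exists>c. c ^ 2 = a"
proof -
  obtain p q where y: "y = Fract p q" "q \<noteq> 0" by (cases y) auto
  have "Fract (p * p) (q * q) = Fract [:a:] 1" using assms by (simp add: y power2_eq_square)
  then have "p * p = [:a:] * (q * q)" using y(2) by (simp add: eq_fract)
  then have "lead_coeff p * lead_coeff p = a * (lead_coeff q * lead_coeff q)"
    by (metis lead_coeff_mult lead_coeff_pCons(2))
  then have "(lead_coeff p / lead_coeff q) ^ 2 = a"
    using y(2) by (simp add: power2_eq_square field_simps)
  then show ?thesis by blast
qed

definition const_emb :: "'k :: field \<Rightarrow> 'k poly fract alg_closure" where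
  "const_emb c = to_ac (Fract [:c:] 1)"

lemma fhom_const_emb: "fhom const_emb"
  by (simp add: fhom_def const_emb_def flip: to_ac_add to_ac_mult)
    (simp add: One_fract_def pCons_one mult.commute)

lemma poly_const_emb: "poly (map_poly const_emb p) var_t = to_ac (Fract p 1)"
proof (induction p)
  case 0
  then show ?case by (simp add: Zero_fract_def[symmetric])
next
  case (pCons c p)
  have "Fract (pCons c p) 1 = Fract [:c:] 1 + Fract [:0, 1:] 1 * Fract p 1" by simp
  then show ?case
    using pCons
    by (simp only: map_poly_pCons fhomD(4)[OF fhom_const_emb] poly_pCons to_ac_add to_ac_mult)
      (simp add: const_emb_def var_t_def)
qed

lemma is_sf_base_field: "is_sf base_field"
  unfolding base_field_def by (rule is_sf_range) (simp add: fhom_def)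

lemma alg_over_base_field: "alg_over base_field (x :: 'k :: field poly fract alg_closure)"
proof -
  obtain p where p: "p \<noteq> 0" "poly (map_poly to_ac p) x = 0" by (rule alg_closure_algebraic)
  moreover have "map_poly to_ac p \<noteq> 0"
    using p(1) by (metis (no_types, lifting) coeff_map_poly poly_eqI coeff_0 to_ac_0 to_ac_eq_0_iff)
  ultimately show ?thesis
    unfolding alg_over_def base_field_def by (auto simp: coeff_map_poly)
qed

lemma poly_in_sf:
  assumes F: "is_sf F" and "\<And>i. coeff p i \<in> F" and x: "x \<in> F"
  shows "poly p x \<in> F"
  using assms(2)
proof (induction p)
  case (pCons c p)
  have "c \<in> F" using pCons.prems[of 0] by simp
  moreover have "coeff p i \<in> F" for i using pCons.prems[of "Suc i"] by simp
  ultimately show ?case using pCons.IH x by (simp add: is_sfD[OF F])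
qed (simp add: is_sfD[OF F])

lemma base_field_subset:
  assumes F: "is_sf F" and k: "range const_emb \<subseteq> F" and t: "var_t \<in> F"
  shows "base_field \<subseteq> F"
proof -
  have "to_ac (Fract p 1) \<in> F" for p
    unfolding poly_const_emb[symmetric] using k
    by (intro poly_in_sf[OF F _ t]) (auto simp: coeff_map_poly fhomD[OF fhom_const_emb])
  then have "to_ac (Fract p 1) / to_ac (Fract q 1) \<in> F" for p q by (intro is_sfD(8)[OF F])
  moreover have "\<exists>p q. y = Fract p 1 / Fract q 1" for y :: "'a poly fract"
    by (cases y) (auto intro!: exI)
  ultimately show ?thesis
    unfolding base_field_def by (metis image_subsetI to_ac_divide)
qed

lemma const_alg_closure_emb:
  "\<exists>j :: 'k :: field alg_closure \<Rightarrow> 'k poly fract alg_closure. fhom j \<and> (\<forall>c. j (to_ac c) = const_emb c)"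
proof -
  let ?G = "{(to_ac c, const_emb c) |c. True} :: ('k alg_closure \<times> 'k poly fract alg_closure) set"
  have to_ac: "fhom (to_ac :: 'k \<Rightarrow> _)" by (simp add: fhom_def)
  have "hom_graph ?G"
    using hom_graph_pair[OF to_ac fhom_const_emb, of UNIV] by (simp add: is_sf_def)
  moreover have "alg_over (Domain ?G) x" for x
  proof -
    obtain p where p: "p \<noteq> 0" "poly (map_poly to_ac p) x = 0" by (rule alg_closure_algebraic)
    moreover have "map_poly to_ac p \<noteq> 0"
      using p(1) by (metis (no_types, lifting) coeff_map_poly poly_eqI coeff_0 to_ac_0 to_ac_eq_0_iff)
    ultimately show ?thesis
      unfolding alg_over_def by (auto simp: coeff_map_poly Domain_iff intro!: exI[of _ "map_poly to_ac p"])
  qed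
  ultimately obtain h where "fhom h" "\<forall>x y. (x, y) \<in> ?G \<longrightarrow> h x = y"
    using hom_graph_extend_total by blast
  then show ?thesis by blast
qed

text \<open>\<kappa> is an embedded algebraic closure of k, and the roots of unity are iterated
  square roots of -1 in it. If t belonged to \<kappa>, a nonzero polynomial over k would vanish at
  t, whereas \<open>poly_const_emb\<close> identifies its value with the polynomial itself.\<close>

lemma function_field_setup:
  assumes two: "(2 :: 'k :: field) \<noteq> 0"
  shows "\<exists>(\<kappa> :: 'k poly fract alg_closure set) z. generic_setup \<kappa> z \<and> generic \<kappa> var_t \<and> range const_emb \<subseteq> \<kappa>"
proof -
  obtain j :: "'k alg_closure \<Rightarrow> 'k poly fract alg_closure" where j: "fhom j" "\<And>c. j (to_ac c) = const_emb c"
    using const_alg_closure_emb by blast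
  define \<kappa> where "\<kappa> = range j"
  have UNIV: "ac_subfield (UNIV :: 'k alg_closure set)" by (simp add: ac_subfield_def is_sf_def)
  have sf: "is_sf \<kappa>" unfolding \<kappa>_def by (rule is_sf_range[OF j(1)])
  have ac: "ac_subfield \<kappa>"
    using ac_image_not_algebraic[OF UNIV j(1)] sf unfolding ac_subfield_def \<kappa>_def by blast
  define z0 :: "nat \<Rightarrow> 'k alg_closure" where "z0 n = (rt ^^ n) (- 1)" for n
  define z where "z n = j (z0 n)" for n
  have "const_emb (1 :: 'k) = 1" by (rule fhomD(1)[OF fhom_const_emb])
  then have "(2 :: 'k poly fract alg_closure) = const_emb 2"
    using fhomD(2)[OF fhom_const_emb, of "1 :: 'k" 1] by simp
  then have two': "(2 :: 'k poly fract alg_closure) \<noteq> 0"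
    using two fhomD(10)[OF fhom_const_emb, of "2 :: 'k"] by simp
  have "zsys z"
    using two' by (simp add: zsys_def z_def z0_def fhomD[OF j(1)] rt flip: fhomD(9)[OF j(1)])
  then have gs: "generic_setup \<kappa> z"
    by unfold_locales (simp_all add: ac, simp add: z_def \<kappa>_def)
  have "var_t \<notin> \<kappa>"
  proof
    assume "var_t \<in> \<kappa>"
    then obtain x where x: "var_t = j x" by (auto simp: \<kappa>_def)
    obtain p where p: "p \<noteq> 0" "poly (map_poly to_ac p) x = 0" by (rule alg_closure_algebraic)
    have "map_poly j (map_poly to_ac p) = map_poly const_emb p"
      by (rule poly_eqI) (simp add: coeff_map_poly j fhomD[OF j(1)] fhomD[OF fhom_const_emb])
    then have "poly (map_poly const_emb p) var_t = 0"
      using fhom_poly[OF j(1), of "map_poly to_ac p" x] p(2) by (simp add: x fhomD[OF j(1)])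
    then have "Fract p 1 = 0" by (simp add: poly_const_emb)
    then show False using p(1) by (simp add: Zero_fract_def eq_fract)
  qed
  moreover have k\<kappa>: "range const_emb \<subseteq> \<kappa>" by (auto simp: \<kappa>_def simp flip: j(2))
  moreover have "alg_over F x" if "is_sf F" "\<kappa> \<subseteq> F" "var_t \<in> F" for F x
    using alg_over_mono[OF alg_over_base_field base_field_subset[OF that(1) _ that(3)]] k\<kappa> that(2) by blast
  ultimately have "generic \<kappa> var_t" by (auto simp: generic_def)
  then show ?thesis using gs k\<kappa> by blast
qed

section \<open>The arithmetic part\<close>

lemma square_power_expansion:
  fixes v :: zint2
  assumes "v = 1 + 4 * w" "zodd w"
  shows "\<exists>c. zodd c \<and> v ^ 2 ^ m = 1 + 2 ^ (m + 2) * c"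
proof (induction m)
  case 0
  then show ?case using assms by auto
next
  case (Suc m)
  then obtain c where c: "zodd c" "v ^ 2 ^ m = 1 + 2 ^ (m + 2) * c" by blast
  obtain h where h: "c = 1 + 2 * h" using c(1) by (auto simp: zodd_def)
  define d where "d = c + 2 ^ (m + 1) * (c * c)"
  have "v ^ 2 ^ Suc m = (1 + 2 ^ (m + 2) * c) * (1 + 2 ^ (m + 2) * c)"
    unfolding power_Suc2 power_mult c(2) by (simp add: power2_eq_square)
  also have "\<dots> = 1 + 2 ^ (Suc m + 2) * d"
    by (simp add: d_def algebra_simps)
  finally have "v ^ 2 ^ Suc m = 1 + 2 ^ (Suc m + 2) * d" .
  moreover have "d = 1 + 2 * (h + 2 ^ m * (c * c))" by (simp add: d_def h algebra_simps)
  then have "zodd d" by (simp only: zodd_1_double)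
  ultimately show ?case by blast
qed

lemma zodd_mult: "zodd x \<Longrightarrow> zodd y \<Longrightarrow> zodd (x * y)"
proof -
  assume "zodd x" "zodd y"
  then obtain a b where "x = 1 + 2 * a" "y = 1 + 2 * b" by (auto simp: zodd_def)
  then have "x * y = 1 + 2 * (a + b + 2 * a * b)" by (simp add: algebra_simps)
  then show ?thesis by (simp only: zodd_1_double)
qed

lemma zodd_power: "zodd x \<Longrightarrow> zodd (x ^ n)"
  using zodd_1_double[of 0] by (induction n) (auto intro: zodd_mult)

text \<open>A unit congruent to 5 modulo 8 generates a dense subgroup of the units congruent to 1
  modulo 4: if \<open>v ^ k\<close> is correct modulo \<open>2 ^ (n + 2)\<close> but not one digit
  further, the factor \<open>v ^ 2 ^ n\<close>, which is 1 plus an odd multiple of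
  \<open>2 ^ (n + 2)\<close>, corrects precisely that digit.\<close>

lemma unit_power_approx:
  fixes v x :: zint2
  assumes v: "v = 1 + 4 * w" "zodd w" and x: "4 dvd x - 1"
  shows "\<exists>k. 2 ^ (n + 2) dvd x - v ^ k"
proof (induction n)
  case 0
  show ?case by (rule exI[of _ 0]) (use x in simp)
next
  case (Suc n)
  then obtain k y where y: "x - v ^ k = 2 ^ (n + 2) * y" by (auto elim!: dvdE)
  show ?case
  proof (cases y rule: zint2_parity_cases)
    case (even h)
    then have "x - v ^ k = 2 ^ (Suc n + 2) * h" using y by (simp add: algebra_simps)
    then show ?thesis by (metis dvd_triv_left)
  next
    case (odd h)
    obtain c where c: "zodd c" "v ^ 2 ^ n = 1 + 2 ^ (n + 2) * c"
      using square_power_expansion[OF v] by blast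
    have "v = 1 + 2 * (2 * w)" using v(1) by simp
    then have "zodd v" by (simp only: zodd_1_double)
    then have "zodd (c * v ^ k)" by (intro zodd_mult zodd_power c(1))
    then obtain e where e: "c * v ^ k = 1 + 2 * e" by (auto simp: zodd_def)
    have "x - v ^ (k + 2 ^ n) = (x - v ^ k) - 2 ^ (n + 2) * (c * v ^ k)"
      by (simp add: power_add c(2) algebra_simps)
    also have "\<dots> = 2 ^ (Suc n + 2) * (h - e)"
      unfolding y e odd by (simp add: algebra_simps)
    finally show ?thesis by (metis dvd_triv_left)
  qed
qed

lemma P_odd:
  assumes "\<sigma> \<in> tree_aut"
  shows "zodd (P \<sigma> x)"
proof -
  have "P \<sigma> x = 1 + 2 * (QQ \<sigma> (x @ [Lb]) - QQ \<sigma> (x @ [La]) - of_nat (Par \<sigma> x))"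
    by (simp add: P_rec[of _ x] P_minus_one_power[OF assms] algebra_simps)
  then show ?thesis by (simp only: zodd_1_double)
qed

locale arith_setup = generic_setup \<kappa> z for \<kappa> :: "'k :: field poly fract alg_closure set" and z +
  fixes \<rho>
  assumes generic_t: "generic \<kappa> var_t" and const_in: "range const_emb \<subseteq> \<kappa>"
    and nonsq: "\<And>c :: 'k. c ^ 2 \<noteq> - 1" "\<And>c :: 'k. c ^ 2 \<noteq> 2" "\<And>c :: 'k. c ^ 2 \<noteq> - 2"
    and \<rho>: "good z \<rho>" and lab_root: "lab \<rho> [] = var_t"
begin

lemma t_in: "var_t \<in> base_field"
  by (simp add: var_t_def base_field_def)

lemma Gal_t: "g \<in> Gal base_field \<Longrightarrow> g \<in> Gal {lab \<rho> []}"
  using Gal_mono[of "{lab \<rho> []}" base_field] t_in by (auto simp: lab_root)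

lemma geometric_Gal: "g \<in> Gal (insert (lab \<rho> []) \<kappa>) \<Longrightarrow> g \<in> Gal base_field"
proof -
  assume g: "g \<in> Gal (insert (lab \<rho> []) \<kappa>)"
  have "base_field \<subseteq> {x. g x = x}"
    using const_in GalD(3)[OF g] lab_root by (intro base_field_subset is_sf_fixed GalD(1)[OF g]) auto
  then show ?thesis using g by (auto simp: Gal_def)
qed

lemma square_in_base:
  fixes a :: 'k
  assumes "x \<in> base_field" "x ^ 2 = const_emb a"
  shows "\<exists>c. c ^ 2 = a"
proof -
  obtain y where y: "x = to_ac y" using assms(1) by (auto simp: base_field_def)
  have "to_ac (y ^ 2) = to_ac (Fract [:a:] 1)" using assms(2) by (simp add: y const_emb_def)
  then have "y ^ 2 = Fract [:a:] 1" by (simp only: to_ac_eq_iff)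
  then show ?thesis by (rule fract_square_const)
qed

lemma base_nonsquares:
  fixes x :: "'k poly fract alg_closure"
  assumes "x \<in> base_field"
  shows "x ^ 2 \<noteq> - 1" "x ^ 2 \<noteq> 2" "x ^ 2 \<noteq> - 2"
proof -
  note h = fhomD[OF fhom_const_emb]
  have 1: "const_emb (1 :: 'k) = 1" by (rule h(1))
  have 2: "const_emb (2 :: 'k) = 2" using h(2)[of "1 :: 'k" 1] 1 by simp
  have "const_emb (- 1 :: 'k) = - 1" "const_emb (- 2 :: 'k) = - 2" by (simp_all only: h(5) 1 2)
  then show "x ^ 2 \<noteq> - 1" "x ^ 2 \<noteq> 2" "x ^ 2 \<noteq> - 2"
    using square_in_base[OF assms, of "- 1"] square_in_base[OF assms, of 2] square_in_base[OF assms, of "- 2"]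
      nonsq 2 by auto
qed

lemma flip_nonsquare:
  assumes "d \<notin> base_field" "d * d \<in> base_field"
  obtains h where "h \<in> Gal base_field" "h d = - d"
  using Gal_quadratic[OF is_sf_base_field alg_over_base_field assms] by blast

abbreviation P0 where "P0 g \<equiv> P (act \<rho> g) []"

lemma P0_comp: "g \<in> Gal base_field \<Longrightarrow> h \<in> Gal base_field \<Longrightarrow> P0 (g \<circ> h) = P0 g * P0 h"
  using P_comp[OF induced_action_M_inf[OF z \<rho> Gal_t] induced_action_tree_aut[OF z \<rho> Gal_t], of g h "[]"]
    induced_action_comp[OF z \<rho> Gal_t Gal_t, of g h] by simp

lemma P0_pow: "g \<in> Gal base_field \<Longrightarrow> g ^^ k \<in> Gal base_field \<and> P0 (g ^^ k) = P0 g ^ k"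
proof (induction k)
  case 0
  have "act \<rho> id = id" by (rule induced_action_id[OF z \<rho>])
  then show ?case by (simp only: funpow.simps P_id power_0 Gal_id simp_thms)
next
  case (Suc k)
  then show ?case by (simp only: funpow.simps power_Suc P0_comp Gal_comp)
qed

lemma zeta_action: "g \<in> Gal base_field \<Longrightarrow> g (z (Suc n)) = zp z (Suc n) (P0 g)"
  by (rule action_zeta[OF z \<rho> Gal_t])

lemma in_base: "1 \<in> base_field" "2 \<in> base_field" "- 1 \<in> base_field" "- 2 \<in> base_field"
proof -
  show 1: "1 \<in> base_field" by (rule is_sfD(2)[OF is_sf_base_field])
  then have "1 + 1 \<in> base_field" by (intro is_sfD(3)[OF is_sf_base_field])
  then show 2: "2 \<in> base_field" by simp
  show "- 1 \<in> base_field" "- 2 \<in> base_field"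
    using 1 2 is_sfD(4)[OF is_sf_base_field] by blast+
qed

text \<open>\<open>z 1\<close> is a square root of -1. An automorphism that negates it also inverts
  it, so its \<open>P\<close> is -1 modulo 4.\<close>

lemma exists_P0_3_mod_4: "\<exists>g\<in>Gal base_field. 4 dvd P0 g + 1"
proof -
  have z1: "z 1 ^ 2 = - 1" using zsysD(1,2)[OF z] by (metis One_nat_def)
  have "z 1 \<notin> base_field" using base_nonsquares(1)[of "z 1"] z1 by blast
  moreover have "z 1 * z 1 \<in> base_field" using z1 in_base by (simp add: power2_eq_square)
  ultimately obtain g where g: "g \<in> Gal base_field" "g (z 1) = - z 1" by (rule flip_nonsquare)
  have "- z 1 = inverse (z 1)"
    using z1 by (intro inverse_unique[symmetric]) (simp add: power2_eq_square)
  then have "zp z 1 (P0 g) = zp z 1 (- 1)"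
    using g zeta_action[OF g(1), of 0] by (simp add: zp_minus[OF z] zp_1[OF z])
  then have "4 dvd P0 g - (- 1)" using zp_eqD[OF z, of 1] by fastforce
  then show ?thesis using g(1) by auto
qed

text \<open>With \<open>i\<close> of order 4 and \<open>e\<close> of order 8, \<open>s\<close> is a
  square root of 2 and \<open>i * s\<close> one of -2. Fixing \<open>i\<close> means that
  \<open>P\<close> is 1 modulo 4. If \<open>s\<close> is negated, then \<open>e\<close> is moved, so
  \<open>P\<close> is not 1 modulo 8.\<close>

lemma exists_P0_5_mod_8: "\<exists>g\<in>Gal base_field. \<exists>w. P0 g = 1 + 4 * w \<and> zodd w"
proof -
  define i where "i = z 1"
  define e where "e = z 2"
  have i2: "i * i = - 1" using zsysD(1)[OF z] zsysD(2)[OF z, of 0] by (simp add: i_def power2_eq_square)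
  have e2: "e * e = i" using zsysD(2)[OF z, of 1] by (simp add: i_def e_def power2_eq_square numeral_2_eq_2)
  define s where "s = e * (1 - i)"
  have "s * s = (e * e) * (1 - 2 * i + i * i)" by (simp add: s_def algebra_simps)
  then have s2: "s * s = 2" by (simp add: e2 i2 algebra_simps) (simp flip: mult.assoc add: i2)
  have is2: "(i * s) * (i * s) = - 2"
  proof -
    have "(i * s) * (i * s) = (i * i) * (s * s)" by (simp add: algebra_simps)
    then show ?thesis by (simp add: i2 s2)
  qed
  have two: "(2 :: 'k poly fract alg_closure) \<noteq> 0" by (rule zsysD(3)[OF z])
  have nz: "i \<noteq> 0" "s \<noteq> 0" using i2 s2 two by auto
  have i_pm: "g i = i \<or> g i = - i" "g s = s \<or> g s = - s" if "g \<in> Gal base_field" for g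
  proof -
    note g = fhomD[OF GalD(1)[OF that]]
    have "g i * g i = i * i" "g s * g s = s * s"
      using GalD(3)[OF that in_base(3)] GalD(3)[OF that in_base(2)] i2 s2 by (simp_all flip: g(3))
    then show "g i = i \<or> g i = - i" "g s = s \<or> g s = - s"
      by (simp_all add: square_eq_iff)
  qed
  have "s \<notin> base_field" using base_nonsquares(2)[of s] s2 by (auto simp: power2_eq_square)
  moreover have "s * s \<in> base_field" using in_base by (simp add: s2)
  ultimately obtain g1 where g1: "g1 \<in> Gal base_field" "g1 s = - s" by (rule flip_nonsquare)
  have "i * s \<notin> base_field" using base_nonsquares(3)[of "i * s"] is2 by (auto simp: power2_eq_square)
  moreover have "(i * s) * (i * s) \<in> base_field" using in_base by (simp only: is2)
  ultimately obtain g2 where g2: "g2 \<in> Gal base_field" "g2 (i * s) = - (i * s)" by (rule flip_nonsquare)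
  have neq: "x \<noteq> - x" if "x \<noteq> 0" for x :: "'k poly fract alg_closure"
  proof
    assume "x = - x"
    then have "2 * x = 0" by (metis add.right_inverse mult_2)
    then show False using that two by simp
  qed
  have g2': "g2 i * g2 s = - (i * s)" using g2 fhomD(3)[OF GalD(1)[OF g2(1)]] by simp
  \<comment> \<open>If \<open>g1\<close> and \<open>g2\<close> both negate \<open>i\<close>, then
    \<open>g2\<close> fixes \<open>s\<close>, and the composition fixes \<open>i\<close> and negates
    \<open>s\<close>. Otherwise one of them already has this property.\<close>
  have "\<exists>g\<in>Gal base_field. g i = i \<and> g s = - s"
  proof (cases "g1 i = i")
    case False
    then have 1: "g1 i = - i" using i_pm(1)[OF g1(1)] by blast
    show ?thesis
    proof (cases "g2 i = i")
      case True
      then have "i * g2 s = i * (- s)" using g2' by simp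
      then have "g2 s = - s" using nz(1) by (simp only: mult_cancel_left) blast
      then show ?thesis using g2(1) True by blast
    next
      case False
      then have 2: "g2 i = - i" using i_pm(1)[OF g2(1)] by blast
      then have "g2 s = s" using g2' nz by simp
      then have "(g1 \<circ> g2) s = - s" "(g1 \<circ> g2) i = i"
        using 1 2 g1 fhomD(5)[OF GalD(1)[OF g1(1)]] by simp_all
      then show ?thesis using Gal_comp[OF g1(1) g2(1)] by blast
    qed
  qed (use g1 in blast)
  then obtain g where g: "g \<in> Gal base_field" "g i = i" "g s = - s" by blast
  note gh = fhomD[OF GalD(1)[OF g(1)]]
  have "zp z 1 (P0 g) = zp z 1 1"
    using zeta_action[OF g(1), of 0] g(2) by (simp add: zp_1[OF z] i_def)
  then have "4 dvd P0 g - 1" using zp_eqD[OF z, of 1] by fastforce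
  then obtain w where w: "P0 g - 1 = 4 * w" by (rule dvdE)
  have "zodd w"
  proof (rule ccontr)
    assume "\<not> zodd w"
    then obtain h where "w = 2 * h" using zint2_even_odd[of w] by (auto simp: zodd_def)
    then have "P0 g = 1 + 2 ^ Suc 2 * h" using w by (simp add: algebra_simps)
    moreover have "zp z 2 (2 ^ Suc 2 * h) = 1" using zp_eq_1_iff[OF z, of 2] by (metis dvd_triv_left)
    ultimately have "zp z 2 (P0 g) = z 2" by (simp only: zp_add[OF z] zp_1[OF z] mult_1_right)
    then have "g e = e" using zeta_action[OF g(1), of 1] by (simp add: e_def numeral_2_eq_2)
    then have "g s = s" using g(2) by (simp add: s_def gh)
    then show False using g(3) neq[OF nz(2)] by simp
  qed
  moreover have "P0 g = 1 + 4 * w" using w by (simp add: algebra_simps)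
  ultimately show ?thesis using g(1) by blast
qed

text \<open>Units congruent to 1 modulo 4 are approximated by powers of \<open>P0 g5\<close>; the
  others are brought into that class by the inverse of \<open>g3\<close>.\<close>

lemma P0_approx:
  assumes U: "zodd U"
  shows "\<exists>g\<in>Gal base_field. 2 ^ (n + 2) dvd P0 g - U"
proof -
  obtain g5 w where g5: "g5 \<in> Gal base_field" "P0 g5 = 1 + 4 * w" "zodd w"
    using exists_P0_5_mod_8 by blast
  obtain g3 where g3: "g3 \<in> Gal base_field" "4 dvd P0 g3 + 1" using exists_P0_3_mod_4 by blast
  have one: "\<exists>g\<in>Gal base_field. 2 ^ (n + 2) dvd P0 g - V" if V: "4 dvd V - 1" for V
  proof -
    obtain k where k: "2 ^ (n + 2) dvd V - P0 g5 ^ k" using unit_power_approx[OF g5(2,3) V] by blast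
    have "P0 (g5 ^^ k) - V = - (V - P0 g5 ^ k)" using P0_pow[OF g5(1)] by simp
    then have "2 ^ (n + 2) dvd P0 (g5 ^^ k) - V" using k by (simp only: dvd_minus_iff)
    then show ?thesis using P0_pow[OF g5(1)] by blast
  qed
  obtain h where h: "U = 1 + 2 * h" using U by (auto simp: zodd_def)
  show ?thesis
  proof (cases h rule: zint2_parity_cases)
    case (even h')
    then have "U - 1 = 4 * h'" using h by simp
    then show ?thesis by (intro one) simp
  next
    case (odd h')
    have g3i: "inv_into UNIV g3 \<in> Gal base_field" by (rule Gal_inv[OF g3(1)])
    have "inv_into UNIV g3 \<circ> g3 = id" using GalD(2)[OF g3(1)] by (simp add: bij_is_inj)
    then have PP: "P0 (inv_into UNIV g3) * P0 g3 = 1"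
      using P0_comp[OF g3i g3(1)] induced_action_id[OF z \<rho>] by simp
    define V where "V = P0 (inv_into UNIV g3) * U"
    obtain d where d: "P0 g3 + 1 = 4 * d" using g3(2) by (rule dvdE)
    have U': "U = 4 * (h' + 1) - 1" using h odd by (simp add: algebra_simps)
    have "V - 1 = P0 (inv_into UNIV g3) * (U - P0 g3)"
      using PP by (simp add: V_def algebra_simps)
    also have "U - P0 g3 = 4 * (h' + 1 - d)" using d U' by (simp add: algebra_simps)
    finally have "4 dvd V - 1" by simp
    from one[OF this] obtain g where g: "g \<in> Gal base_field" "2 ^ (n + 2) dvd P0 g - V" by blast
    have "P0 (g3 \<circ> g) - U = P0 g3 * P0 g - (P0 (inv_into UNIV g3) * P0 g3) * U"
      using P0_comp[OF g3(1) g(1)] PP by simp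
    also have "\<dots> = P0 g3 * (P0 g - V)" by (simp add: V_def algebra_simps)
    finally have "2 ^ (n + 2) dvd P0 (g3 \<circ> g) - U" using g(2) by simp
    then show ?thesis using Gal_comp[OF g3(1) g(1)] by blast
  qed
qed

text \<open>The approximating automorphisms may be unrelated, but on each root of unity their values
  are eventually constant, so they can be glued to one with the exact value of
  \<open>P\<close>.\<close>

lemma P0_surj:
  assumes U: "zodd U"
  shows "\<exists>g\<in>Gal base_field. P0 g = U"
proof -
  have "\<exists>g\<in>Gal base_field. \<forall>i. g (z (Suc i)) = zp z (Suc i) U"
  proof (rule Gal_glue[where lev = "\<lambda>n. n"])
    fix n
    obtain g where g: "g \<in> Gal base_field" "2 ^ (n + 2) dvd P0 g - U" using P0_approx[OF U] by blast
    have "g (z (Suc i)) = zp z (Suc i) U" if "i \<le> n" for i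
    proof -
      have "2 ^ Suc (Suc i) dvd P0 g - U"
        by (rule dvd_trans[OF le_imp_power_dvd g(2)]) (use that in simp)
      then have "zp z (Suc i) (P0 g - U) = 1" using zp_eq_1_iff[OF z] by blast
      then have "zp z (Suc i) (P0 g) = zp z (Suc i) U"
        using zp_nonzero[OF z, of "Suc i" U] by (simp add: zp_diff[OF z])
      then show ?thesis by (simp only: zeta_action[OF g(1)])
    qed
    then show "\<exists>g\<in>Gal base_field. \<forall>i. i \<le> n \<longrightarrow> g (z (Suc i)) = zp z (Suc i) U" using g(1) by blast
  qed (rule alg_over_base_field)
  then obtain g where g: "g \<in> Gal base_field" "\<And>i. g (z (Suc i)) = zp z (Suc i) U" by blast
  have "P0 g = U"
  proof (rule zint2_eqI_dvd)
    fix n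
    have "2 ^ Suc (Suc n) dvd P0 g - U"
      using zeta_action[OF g(1), of n] g(2)[of n] by (intro zp_eqD[OF z]) simp
    then show "2 ^ n dvd P0 g - U" by (rule dvd_trans[rotated]) (rule le_imp_power_dvd, simp)
  qed
  then show ?thesis using g(1) by blast
qed

theorem action_surj:
  assumes \<sigma>: "\<sigma> \<in> M_inf"
  shows "\<exists>g\<in>Gal base_field. act \<rho> g = \<sigma>"
proof -
  obtain g0 where g0: "g0 \<in> Gal base_field" "P0 g0 = P \<sigma> []"
    using P0_surj[OF P_odd[OF M_infD(1)[OF \<sigma>]]] by blast
  note M0 = induced_action_M_inf[OF z \<rho> Gal_t[OF g0(1)]]
  note t0 = M_infD(1)[OF M0]
  \<comment> \<open>Dividing by a Galois automorphism with the same \<open>P\<close> leaves an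
    element of \<open>B_inf\<close>. This is realised on each level over \<kappa>(t), and
    multiplying back and gluing over all levels recovers \<sigma>.\<close>
  define \<tau> where "\<tau> = tinv (act \<rho> g0) \<circ> \<sigma>"
  have \<tau>M: "\<tau> \<in> M_inf" unfolding \<tau>_def by (intro M_inf_comp M_inf_inv M0 \<sigma>)
  have "P \<tau> [] = P (tinv (act \<rho> g0)) [] * P (act \<rho> g0) []"
    unfolding \<tau>_def using P_comp[OF M_inf_inv[OF M0] M_infD(1)[OF \<sigma>], of "[]"] g0(2) by simp
  also have "\<dots> = 1"
    using P_comp[OF M_inf_inv[OF M0] t0, of "[]"] by (simp add: tree_aut_inv_comp[OF t0])
  finally have \<tau>B: "\<tau> \<in> B_inf" using \<tau>M by (simp add: B_inf_def)
  have "\<exists>g\<in>Gal base_field. \<forall>w. g (lab \<rho> w) = lab \<rho> (\<sigma> w)"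
  proof (rule Gal_glue[where lev = length])
    fix n
    have "\<tau> \<in> G_lev n \<rho>"
      using geometric_monodromy[OF \<rho>, of n] generic_t \<tau>B by (auto simp: lab_root)
    then obtain g where g: "g \<in> Gal (insert (lab \<rho> []) \<kappa>)" "\<And>w. length w \<le> n \<Longrightarrow> \<tau> w = act \<rho> g w"
      by (auto simp: G_lev_def)
    note g' = geometric_Gal[OF g(1)]
    have "(g0 \<circ> g) (lab \<rho> w) = lab \<rho> (\<sigma> w)" if "length w \<le> n" for w
    proof -
      have "(g0 \<circ> g) (lab \<rho> w) = lab \<rho> (act \<rho> g0 (act \<rho> g w))"
        using induced_action(2)[OF z \<rho> Gal_t[OF g0(1)]] induced_action(2)[OF z \<rho> Gal_t[OF g']] by simp
      also have "act \<rho> g0 (act \<rho> g w) = \<sigma> w"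
        using g(2)[OF that] by (simp add: \<tau>_def tree_aut_inv_comp[OF t0] flip: g(2)[OF that])
      finally show ?thesis .
    qed
    then show "\<exists>g\<in>Gal base_field. \<forall>w. length w \<le> n \<longrightarrow> g (lab \<rho> w) = lab \<rho> (\<sigma> w)"
      using Gal_comp[OF g0(1) g'] by blast
  qed (rule alg_over_base_field)
  then obtain g where g: "g \<in> Gal base_field" "\<And>w. g (lab \<rho> w) = lab \<rho> (\<sigma> w)" by blast
  have "act \<rho> g w = \<sigma> w" for w
    by (rule induced_actionI[OF z \<rho> Gal_t[OF g(1)]]) (simp_all add: g(2) tree_aut_length[OF M_infD(1)[OF \<sigma>]])
  then show ?thesis using g(1) by blast
qed

section \<open>Transfer from the algebraic closure to the Galois group of
  \<open>K_inf\<close>\<close>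

section \<open>The Galois group of the union of the preimage fields\<close>

abbreviation (input) KI where "KI \<equiv> K_inf :: 'k poly fract alg_closure set"
abbreviation (input) GI where "GI \<equiv> G_inf :: ('k poly fract alg_closure \<Rightarrow> 'k poly fract alg_closure) monoid"

lemma preimages_eq: "preimages n var_t = {lab \<rho> w |w. length w = n}"
  using lab_surj[OF z \<rho>] basilica_funpow_lab[OF z \<rho>] by (force simp: preimages_def lab_root)

text \<open>Each label is the square of a child minus 1, so the fields generated by successive
  levels form an increasing chain and their union is a field.\<close>

lemma K_inf_sf: "is_sf KI"
proof -
  let ?A = "\<lambda>n. adjoin base_field (preimages n var_t) :: 'k poly fract alg_closure set"
  have step: "?A n \<subseteq> ?A (Suc n)" for n
  proof (rule adjoin_least[OF is_sf_adjoin adjoin_incl(1)], safe)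
    fix x :: "'k poly fract alg_closure" assume "x \<in> preimages n var_t"
    then obtain w where w: "x = lab \<rho> w" "length w = n" by (auto simp: preimages_eq)
    have in_A: "lab \<rho> (w @ [La]) \<in> ?A (Suc n)"
    proof (rule subsetD[OF adjoin_incl(2)])
      show "lab \<rho> (w @ [La]) \<in> preimages (Suc n) var_t"
        unfolding preimages_eq using w(2) by (intro CollectI exI[of _ "w @ [La]"]) simp
    qed
    show "x \<in> ?A (Suc n)"
      unfolding w(1) by (rule generic_parent_in[OF is_sf_adjoin in_A goodD(3)[OF z \<rho>]])
  qed
  have mono: "?A m \<subseteq> ?A n" if "m \<le> n" for m n
    using that by (rule lift_Suc_mono_le[of ?A, rotated]) (rule step)
  have two: "\<exists>n. x \<in> ?A n \<and> y \<in> ?A n" if xy: "x \<in> KI" "y \<in> KI" for x y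
  proof -
    from xy obtain a b where ab: "x \<in> ?A a" "y \<in> ?A b" by (auto simp: K_inf_def)
    then have "x \<in> ?A (max a b)" "y \<in> ?A (max a b)" using mono[of a "max a b"] mono[of b "max a b"] by auto
    then show ?thesis by blast
  qed
  note sf = is_sfD[OF is_sf_adjoin[of base_field "preimages n var_t" for n]]
  have I: "x \<in> KI" if "x \<in> ?A n" for x n using that by (auto simp: K_inf_def)
  show ?thesis
    unfolding is_sf_def
  proof (intro conjI ballI)
    show "0 \<in> KI" "1 \<in> KI" using I[OF sf(1)] I[OF sf(2)] .
    fix x assume x: "x \<in> KI"
    from two[OF this this] obtain n where n: "x \<in> ?A n" by blast
    show "- x \<in> KI" "inverse x \<in> KI" using I[OF sf(4)[OF n]] I[OF sf(6)[OF n]] .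
    fix y assume "y \<in> KI"
    from two[OF x this] obtain n where n: "x \<in> ?A n" "y \<in> ?A n" by blast
    show "x + y \<in> KI" "x * y \<in> KI" using I[OF sf(3)[OF n]] I[OF sf(5)[OF n]] .
  qed
qed

lemma K_inf_incl: "base_field \<subseteq> KI" "lab \<rho> w \<in> KI"
proof -
  show "base_field \<subseteq> KI" unfolding K_inf_def using adjoin_incl(1) by blast
  have "lab \<rho> w \<in> preimages (length w) var_t" by (auto simp: preimages_eq)
  then show "lab \<rho> w \<in> KI" unfolding K_inf_def using adjoin_incl(2) by blast
qed

lemma K_inf_least:
  assumes "is_sf E" "base_field \<subseteq> E" "\<And>w. lab \<rho> w \<in> E"
  shows "KI \<subseteq> E"
  unfolding K_inf_def using assms by (intro UN_least adjoin_least) (auto simp: preimages_eq)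

lemma carrier_G_inf:
  "\<sigma> \<in> carrier GI \<longleftrightarrow> \<sigma> \<in> extensional KI \<and> bij_betw \<sigma> KI KI \<and> \<sigma> 1 = 1 \<and>
    (\<forall>x\<in>KI. \<forall>y\<in>KI. \<sigma> (x + y) = \<sigma> x + \<sigma> y \<and> \<sigma> (x * y) = \<sigma> x * \<sigma> y) \<and> (\<forall>x\<in>base_field. \<sigma> x = x)"
  by (auto simp: G_inf_def GaloisGroup_def Bij_def ring_hom_def bij_betw_def Pi_def)

lemma restrict_Gal:
  fixes g :: "'k poly fract alg_closure \<Rightarrow> 'k poly fract alg_closure"
  assumes g: "g \<in> Gal base_field"
  shows "restrict g KI \<in> carrier GI"
proof -
  have sub: "h ` KI \<subseteq> KI" if h: "h \<in> Gal base_field" for h :: "'k poly fract alg_closure \<Rightarrow> _"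
  proof -
    have "KI \<subseteq> {x. h x \<in> KI}"
    proof (rule K_inf_least)
      show "is_sf {x. h x \<in> KI}" by (rule is_sf_vimage[OF GalD(1)[OF h] K_inf_sf])
      show "base_field \<subseteq> {x. h x \<in> KI}" using GalD(3)[OF h] K_inf_incl(1) by auto
      show "lab \<rho> w \<in> {x. h x \<in> KI}" for w
        using K_inf_incl(2) by (simp flip: induced_action(2)[OF z \<rho> Gal_t[OF h]])
    qed
    then show ?thesis by blast
  qed
  have "g ` KI = KI"
  proof
    show "g ` KI \<subseteq> KI" by (rule sub[OF g])
    show "KI \<subseteq> g ` KI"
    proof
      fix x assume "x \<in> KI"
      then have "inv_into UNIV g x \<in> KI" using sub[OF Gal_inv[OF g]] by blast
      moreover have "x = g (inv_into UNIV g x)"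
        using GalD(2)[OF g] by (simp add: bij_is_surj surj_f_inv_f)
      ultimately show "x \<in> g ` KI" by (rule rev_image_eqI)
    qed
  qed
  moreover have "inj_on g KI" using GalD(2)[OF g] by (auto simp: bij_def intro: inj_on_subset)
  ultimately have "bij_betw (restrict g KI) KI KI"
    by (simp add: bij_betw_def inj_on_restrict_eq)
  then show ?thesis
    unfolding carrier_G_inf
    using is_sfD(2,3,5)[OF K_inf_sf] K_inf_incl(1) GalD(3)[OF g] fhomD[OF GalD(1)[OF g]] by auto
qed

text \<open>Elements of \<open>G_inf\<close> are maps on \<open>K_inf\<close>, extended by
  \<open>undefined\<close>, whereas the preceding results concern automorphisms of the algebraic
  closure. The induced action depends on the values at labels only, hence is the same for
  both.\<close>

lemma extend_G_inf:
  fixes \<sigma> :: "'k poly fract alg_closure \<Rightarrow> 'k poly fract alg_closure"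
  assumes \<sigma>: "\<sigma> \<in> carrier GI"
  obtains g where "g \<in> Gal base_field" "\<And>x. x \<in> KI \<Longrightarrow> g x = \<sigma> x"
proof -
  note S = is_sfD[OF K_inf_sf]
  from \<sigma> have bij: "bij_betw \<sigma> KI KI" and one: "\<sigma> 1 = 1" and fixed: "\<And>x. x \<in> base_field \<Longrightarrow> \<sigma> x = x"
    and add: "\<And>x y. x \<in> KI \<Longrightarrow> y \<in> KI \<Longrightarrow> \<sigma> (x + y) = \<sigma> x + \<sigma> y"
    and mult: "\<And>x y. x \<in> KI \<Longrightarrow> y \<in> KI \<Longrightarrow> \<sigma> (x * y) = \<sigma> x * \<sigma> y"
    unfolding carrier_G_inf by blast+
  have zero: "\<sigma> 0 = 0" using fixed is_sfD(1)[OF is_sf_base_field] by blast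
  have minus: "\<sigma> (- x) = - \<sigma> x" if "x \<in> KI" for x
    using add[OF that S(4)[OF that]] zero by (simp add: eq_neg_iff_add_eq_0 add.commute)
  have inverse: "\<sigma> (inverse x) = inverse (\<sigma> x)" if "x \<in> KI" for x
  proof (cases "x = 0")
    case False
    then have "\<sigma> x * \<sigma> (inverse x) = 1" using mult[OF that S(6)[OF that]] one by simp
    then show ?thesis by (simp add: inverse_unique)
  qed (simp add: zero)
  let ?G = "{(x, \<sigma> x) |x. x \<in> KI}"
  have I: "(x, y) \<in> ?G" if "x \<in> KI" "y = \<sigma> x" for x y using that by blast
  have "hom_graph ?G"
  proof (rule hom_graphI)
    show "(0, 0) \<in> ?G" "(1, 1) \<in> ?G" using zero one S(1,2) by (intro I; simp)+
    fix x x' y y'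
    show "(x, x') \<in> ?G \<Longrightarrow> (y, y') \<in> ?G \<Longrightarrow> (x + y, x' + y') \<in> ?G"
      using add S(3) by (intro I) auto
    show "(x, x') \<in> ?G \<Longrightarrow> (y, y') \<in> ?G \<Longrightarrow> (x * y, x' * y') \<in> ?G"
      using mult S(5) by (intro I) auto
    show "(x, x') \<in> ?G \<Longrightarrow> (- x, - x') \<in> ?G"
      using minus S(4) by (intro I) auto
    show "(x, x') \<in> ?G \<Longrightarrow> (inverse x, inverse x') \<in> ?G"
      using inverse S(6) by (intro I) auto
  qed auto
  moreover have "Id_on base_field \<subseteq> ?G"
    using fixed K_inf_incl(1) by (auto intro!: I)
  ultimately obtain g where "g \<in> Gal base_field" "\<forall>x y. (x, y) \<in> ?G \<longrightarrow> g x = y"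
    using Gal_extend_graph alg_over_base_field by blast
  then show thesis using that by blast
qed

lemma induced_action_cong:
  assumes "\<And>w. g (lab \<rho> w) = h (lab \<rho> w)"
  shows "act \<rho> g = act \<rho> h"
  unfolding induced_action_def assms ..

lemma extend_G_inf_act:
  assumes "\<sigma> \<in> carrier GI"
  obtains g where "g \<in> Gal base_field" "\<And>x. x \<in> KI \<Longrightarrow> g x = \<sigma> x" "act \<rho> \<sigma> = act \<rho> g"
proof -
  obtain g where g: "g \<in> Gal base_field" "\<And>x. x \<in> KI \<Longrightarrow> g x = \<sigma> x"
    using extend_G_inf[OF assms] by blast
  moreover have "act \<rho> \<sigma> = act \<rho> g"
    by (rule induced_action_cong) (simp add: g(2) K_inf_incl(2))
  ultimately show thesis by (rule that)
qed

lemma mult_G_inf: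
  "\<sigma> \<in> carrier GI \<Longrightarrow> \<tau> \<in> carrier GI \<Longrightarrow> \<sigma> \<otimes>\<^bsub>GI\<^esub> \<tau> = compose KI \<sigma> \<tau>"
  by (simp add: G_inf_def GaloisGroup_def BijGroup_def)

lemma mult_TreeAutGroup:
  "\<sigma> \<in> tree_aut \<Longrightarrow> \<tau> \<in> tree_aut \<Longrightarrow> \<sigma> \<otimes>\<^bsub>TreeAutGroup\<^esub> \<tau> = \<sigma> \<circ> \<tau>"
  by (auto simp: TreeAutGroup_def BijGroup_def Bij_def compose_def tree_autD(1))

theorem G_inf_iso_M_inf:
  "act \<rho> \<in> hom GI TreeAutGroup" "inj_on (act \<rho>) (carrier GI)" "act \<rho> ` carrier GI = M_inf"
proof -
  have tree: "act \<rho> \<sigma> \<in> M_inf" if "\<sigma> \<in> carrier GI" for \<sigma>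
  proof -
    obtain g where "g \<in> Gal base_field" "act \<rho> \<sigma> = act \<rho> g" using extend_G_inf_act[OF \<open>\<sigma> \<in> carrier GI\<close>] by blast
    then show ?thesis using induced_action_M_inf[OF z \<rho> Gal_t] by simp
  qed
  show "act \<rho> \<in> hom GI TreeAutGroup"
  proof (rule homI)
    fix \<sigma> assume \<sigma>: "\<sigma> \<in> carrier GI"
    show "act \<rho> \<sigma> \<in> carrier TreeAutGroup"
      using M_infD(1)[OF tree[OF \<sigma>]] by (simp add: TreeAutGroup_def)
    fix \<tau> assume \<tau>: "\<tau> \<in> carrier GI"
    obtain g where g: "g \<in> Gal base_field" "\<And>x. x \<in> KI \<Longrightarrow> g x = \<sigma> x" "act \<rho> \<sigma> = act \<rho> g"
      using extend_G_inf_act[OF \<sigma>] by blast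
    obtain h where h: "h \<in> Gal base_field" "\<And>x. x \<in> KI \<Longrightarrow> h x = \<tau> x" "act \<rho> \<tau> = act \<rho> h"
      using extend_G_inf_act[OF \<tau>] by blast
    have "act \<rho> (compose KI \<sigma> \<tau>) = act \<rho> (g \<circ> h)"
    proof (rule induced_action_cong)
      fix w
      have "\<tau> (lab \<rho> w) \<in> KI"
        using \<tau> K_inf_incl(2) by (auto simp: carrier_G_inf bij_betw_def)
      then show "compose KI \<sigma> \<tau> (lab \<rho> w) = (g \<circ> h) (lab \<rho> w)"
        using K_inf_incl(2) by (simp add: compose_def g(2) h(2))
    qed
    then show "act \<rho> (\<sigma> \<otimes>\<^bsub>GI\<^esub> \<tau>) = act \<rho> \<sigma> \<otimes>\<^bsub>TreeAutGroup\<^esub> act \<rho> \<tau>"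
      using M_infD(1)[OF tree[OF \<sigma>]] M_infD(1)[OF tree[OF \<tau>]]
      by (simp add: mult_G_inf \<sigma> \<tau> mult_TreeAutGroup) (simp add: g h induced_action_comp[OF z \<rho> Gal_t Gal_t])
  qed
  show "inj_on (act \<rho>) (carrier GI)"
  proof (rule inj_onI)
    fix \<sigma> \<tau> assume \<sigma>: "\<sigma> \<in> carrier GI" and \<tau>: "\<tau> \<in> carrier GI" and eq: "act \<rho> \<sigma> = act \<rho> \<tau>"
    obtain g where g: "g \<in> Gal base_field" "\<And>x. x \<in> KI \<Longrightarrow> g x = \<sigma> x" "act \<rho> \<sigma> = act \<rho> g"
      using extend_G_inf_act[OF \<sigma>] by blast
    obtain h where h: "h \<in> Gal base_field" "\<And>x. x \<in> KI \<Longrightarrow> h x = \<tau> x" "act \<rho> \<tau> = act \<rho> h"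
      using extend_G_inf_act[OF \<tau>] by blast
    have "act \<rho> g = act \<rho> h" using eq g(3) h(3) by simp
    then have "g (lab \<rho> w) = h (lab \<rho> w)" for w
      by (simp flip: induced_action(2)[OF z \<rho> Gal_t[OF g(1)]] induced_action(2)[OF z \<rho> Gal_t[OF h(1)]])
    moreover have "is_sf {x. g x = h x}"
      by (simp add: is_sf_def fhomD[OF GalD(1)[OF g(1)]] fhomD[OF GalD(1)[OF h(1)]])
    ultimately have "KI \<subseteq> {x. g x = h x}"
      using GalD(3)[OF g(1)] GalD(3)[OF h(1)] by (intro K_inf_least) auto
    then have "\<sigma> x = \<tau> x" if "x \<in> KI" for x
      using that g(2) h(2) by (auto simp flip: g(2) h(2))
    then show "\<sigma> = \<tau>"
      using \<sigma> \<tau> by (intro extensionalityI[of _ KI]) (auto simp: carrier_G_inf)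
  qed
  show "act \<rho> ` carrier GI = M_inf"
  proof (intro subset_antisym subsetI)
    fix \<sigma> assume "\<sigma> \<in> M_inf"
    then obtain g where g: "g \<in> Gal base_field" "act \<rho> g = \<sigma>" using action_surj by blast
    have "act \<rho> (restrict g KI) = act \<rho> g"
      by (rule induced_action_cong) (simp add: K_inf_incl(2))
    then show "\<sigma> \<in> act \<rho> ` carrier GI" using restrict_Gal[OF g(1)] g(2) by (metis image_eqI)
  qed (use tree in auto)
qed

end

theorem theorem5p1:
  fixes \<zeta> :: "'k :: field alg_closure"
  assumes "CHAR('k) \<noteq> 2"
    and "primitive_root_of_unity 8 \<zeta>"
    and "ring.dimension ring_of_type_algebra 4 (range to_ac) (adjoin (range to_ac) {\<zeta>})"
  shows "\<exists>lab :: node \<Rightarrow> 'k poly fract alg_closure.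
    is_labeling var_t lab \<and>
    induced_action lab \<in> hom G_inf TreeAutGroup \<and>
    inj_on (induced_action lab) (carrier G_inf) \<and>
    induced_action lab ` carrier G_inf = M_inf"
proof -
  have "(of_nat 2 :: 'k) \<noteq> 0"
  proof
    assume "(of_nat 2 :: 'k) = 0"
    then have "CHAR('k) dvd 2" by (simp only: of_nat_eq_0_iff_char_dvd)
    then have "CHAR('k) = 1 \<or> CHAR('k) = 2" using two_is_prime_nat prime_nat_iff by blast
    then show False using assms(1) by simp
  qed
  then have "(2 :: 'k) \<noteq> 0" by simp
  from function_field_setup[OF this] obtain \<kappa> :: "'k poly fract alg_closure set" and z
    where gs: "generic_setup \<kappa> z" and gen: "generic \<kappa> var_t" and const: "range const_emb \<subseteq> \<kappa>"
    by blast
  interpret generic_setup \<kappa> z by (rule gs)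
  have "0 \<in> \<kappa>" "- 1 \<in> \<kappa>" using is_sfD(1,2,4)[OF \<kappa>_sf] by blast+
  then have "var_t \<noteq> (0 :: 'k poly fract alg_closure)" "var_t \<noteq> (- 1 :: 'k poly fract alg_closure)"
    using gen by (metis generic_def)+
  from good_exists[OF z this] obtain \<rho> where \<rho>: "good z \<rho>" "\<rho> [] 0 = (var_t :: 'k poly fract alg_closure)"
    by blast
  interpret arith_setup \<kappa> z \<rho>
    by unfold_locales (simp_all add: gen const nonsquares[OF assms(2,3)] \<rho> lab_def)
  show ?thesis
    using good_is_labeling[OF z \<rho>(1)] G_inf_iso_M_inf lab_root by auto
qed

end
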